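(* Let $\Sigma$ be an implicational base over a finite set $U$, and assume there is a partition $U_1,\dots,U_k$ of $U$ such that for every implication $A\to b\in\Sigma$ there are indices $1\le i<j\le k$ with $A\subseteq U_i$ and $b\in U_j$. Then the meet-irreducible elements of the closure system of $\Sigma$ can be enumerated from $\Sigma$ in output-quasipolynomial time, i.e. in time $N^{O(\log N)}$ where $N$ is the combined size of the input $\Sigma$ and the output.
   Context: An implication over $U$ is written $A \to b$ with $A \subseteq U$ nonempty and $b \in U$; an implicational base is a finite set of implications. $C\subseteq U$ satisfies $\Sigma$ if for all $A\to b\in\Sigma$, $A\subseteq C$ implies $b\in C$; the closure system $\mathcal{C}$ of $\Sigma$ is the family of all subsets of $U$ satisfying $\Sigma$. A meet-irreducible element of $\mathcal{C}$ is a closed set $M\neq U$ such that $M=C\cap C'$ with $C,C'\in\mathcal{C}$ implies $M=C$ or $M=C'$. The problem considered takes $\Sigma$ as input and must output the set of all meet-irreducible elements of $\mathcal{C}$. *)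

theory Defs
  imports Complex_Main "HOL-Library.Disjoint_Sets" "HOL-Library.Landau_Symbols"
begin

section \<open>Implicational bases and meet-irreducible elements\<close>

type_synonym 'a implication = "'a set \<times> 'a"

definition implicational_base :: "'a set \<Rightarrow> 'a implication set \<Rightarrow> bool" where
  "implicational_base U \<Sigma> \<longleftrightarrow> finite \<Sigma> \<and> (\<forall>(A, b)\<in>\<Sigma>. A \<noteq> {} \<and> A \<subseteq> U \<and> b \<in> U)"

definition satisfies :: "'a set \<Rightarrow> 'a implication set \<Rightarrow> bool" where
  "satisfies C \<Sigma> \<longleftrightarrow> (\<forall>(A, b)\<in>\<Sigma>. A \<subseteq> C \<longrightarrow> b \<in> C)"

definition closure_system :: "'a set \<Rightarrow> 'a implication set \<Rightarrow> 'a set set" where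
  "closure_system U \<Sigma> = {C. C \<subseteq> U \<and> satisfies C \<Sigma>}"

definition meet_irreducibles :: "'a set \<Rightarrow> 'a implication set \<Rightarrow> 'a set set" where
  "meet_irreducibles U \<Sigma> =
     {M \<in> closure_system U \<Sigma>. M \<noteq> U \<and>
        (\<forall>C \<in> closure_system U \<Sigma>. \<forall>C' \<in> closure_system U \<Sigma>. M = C \<inter> C' \<longrightarrow> M = C \<or> M = C')}"

definition has_layering :: "'a set \<Rightarrow> 'a implication set \<Rightarrow> bool" where
  "has_layering U \<Sigma> \<longleftrightarrow>
     (\<exists>(k::nat) (L :: nat \<Rightarrow> 'a set).
        partition_on U (L ` {1..k}) \<and> inj_on L {1..k} \<and>
        (\<forall>(A, b)\<in>\<Sigma>. \<exists>i j. 1 \<le> i \<and> i < j \<and> j \<le> k \<and> A \<subseteq> L i \<and> b \<in> L j))"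


section \<open>Machine model\<close>

text \<open>
  Running time is measured in a pure first-order Lisp, in the style of the tree-manipulating
  languages of N. D. Jones (Computability and Complexity, 1997). Data are binary trees; a program is
  a finite list of mutually recursive function bodies, whose parameters are referred to by
  position; evaluation is call-by-value, and every construct costs one unit. The only test
  available is whether a tree is a leaf.

  With trees represented by pointers, each unit of cost is a bounded number of pointer operations
  (environments have a length bounded by the program text), so this cost and the running time of
  Turing machines or of random access machines with logarithmic cost simulate each other with
  polynomial overhead in the running time and the sizes of input and output.
\<close>

datatype tree = Leaf | Node tree tree

fun left :: "tree \<Rightarrow> tree" where
  "left Leaf = Leaf"
| "left (Node x y) = x"

fun right :: "tree \<Rightarrow> tree" where
  "right Leaf = Leaf"
| "right (Node x y) = y"

fun nodes :: "tree \<Rightarrow> nat" where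
  "nodes Leaf = 1"
| "nodes (Node x y) = nodes x + nodes y + 1"

datatype expr =
    Param nat
  | LeafE
  | NodeE expr expr
  | LeftE expr
  | RightE expr
  | IfNode expr expr expr
  | Call nat "expr list"

type_synonym program = "expr list"

inductive eval :: "program \<Rightarrow> tree list \<Rightarrow> expr \<Rightarrow> tree \<Rightarrow> nat \<Rightarrow> bool"
  and evals :: "program \<Rightarrow> tree list \<Rightarrow> expr list \<Rightarrow> tree list \<Rightarrow> nat \<Rightarrow> bool"
  for P :: program
where
  eval_Param: "i < length env \<Longrightarrow> eval P env (Param i) (env ! i) 1"
| eval_LeafE: "eval P env LeafE Leaf 1"
| eval_NodeE: "eval P env e x s \<Longrightarrow> eval P env e' y t \<Longrightarrow> eval P env (NodeE e e') (Node x y) (s + t + 1)"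
| eval_LeftE: "eval P env e x t \<Longrightarrow> eval P env (LeftE e) (left x) (t + 1)"
| eval_RightE: "eval P env e x t \<Longrightarrow> eval P env (RightE e) (right x) (t + 1)"
| eval_IfNode_True: "eval P env e x s \<Longrightarrow> x \<noteq> Leaf \<Longrightarrow> eval P env e1 y t \<Longrightarrow>
    eval P env (IfNode e e1 e2) y (s + t + 1)"
| eval_IfNode_False: "eval P env e x s \<Longrightarrow> x = Leaf \<Longrightarrow> eval P env e2 y t \<Longrightarrow>
    eval P env (IfNode e e1 e2) y (s + t + 1)"
| eval_Call: "f < length P \<Longrightarrow> evals P env es xs s \<Longrightarrow> eval P xs (P ! f) y t \<Longrightarrow>
    eval P env (Call f es) y (s + t + 1)"
| evals_Nil: "evals P env [] [] 0"
| evals_Cons: "eval P env e x s \<Longrightarrow> evals P env es xs t \<Longrightarrow> evals P env (e # es) (x # xs) (s + t)"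

lemma
  shows eval_deterministic: "eval P env e x s \<Longrightarrow> eval P env e y t \<Longrightarrow> y = x \<and> t = s"
    and evals_deterministic: "evals P env es xs s \<Longrightarrow> evals P env es ys t \<Longrightarrow> ys = xs \<and> t = s"
proof (induction arbitrary: y t and ys t rule: eval_evals.inducts)
  case eval_Param then show ?case by (auto elim: eval.cases)
next
  case eval_LeafE then show ?case by (auto elim: eval.cases)
next
  case eval_NodeE
  from eval_NodeE.prems show ?case
    by cases (auto dest!: eval_NodeE.IH(2,4))
next
  case eval_LeftE
  from eval_LeftE.prems show ?case
    by cases (auto dest!: eval_LeftE.IH(2))
next
  case eval_RightE
  from eval_RightE.prems show ?case
    by cases (auto dest!: eval_RightE.IH(2))
next
  case eval_IfNode_True
  from eval_IfNode_True.prems show ?case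
    by cases (auto simp: eval_IfNode_True.hyps dest!: eval_IfNode_True.IH(2,4))
next
  case eval_IfNode_False
  from eval_IfNode_False.prems show ?case
    by cases (auto simp: eval_IfNode_False.hyps dest!: eval_IfNode_False.IH(2,4))
next
  case eval_Call
  from eval_Call.prems show ?case
    by cases (auto dest!: eval_Call.IH(3,5))
next
  case evals_Nil then show ?case by (auto elim: evals.cases)
next
  case evals_Cons
  from evals_Cons.prems show ?case
    by cases (auto dest!: evals_Cons.IH(2,4))
qed

text \<open>The main function of a program is its first one; it takes the input as its only argument.\<close>

definition runs_to :: "program \<Rightarrow> tree \<Rightarrow> tree \<Rightarrow> nat \<Rightarrow> bool" where
  "runs_to P v w t \<longleftrightarrow> eval P [v] (Call 0 [Param 0]) w t"


section \<open>Encodings\<close>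

text \<open>
  Elements of the ground set are named by natural numbers, written in binary with the least
  significant bit first. A finite set is encoded by listing its elements without repetition in
  an arbitrary order, so encoding is a relation rather than a function; all encodings of the same
  object have the same number of nodes.
\<close>

fun nat_tree :: "nat \<Rightarrow> tree" where
  "nat_tree n =
     (if n = 0 then Leaf
      else Node (if odd n then Node Leaf Leaf else Leaf) (nat_tree (n div 2)))"

declare nat_tree.simps [simp del]

fun list_tree :: "tree list \<Rightarrow> tree" where
  "list_tree [] = Leaf"
| "list_tree (v # vs) = Node v (list_tree vs)"

definition encodes_nat :: "nat \<Rightarrow> tree \<Rightarrow> bool" where
  "encodes_nat n v \<longleftrightarrow> v = nat_tree n"

definition encodes_pair ::
    "('a \<Rightarrow> tree \<Rightarrow> bool) \<Rightarrow> ('b \<Rightarrow> tree \<Rightarrow> bool) \<Rightarrow> 'a \<times> 'b \<Rightarrow> tree \<Rightarrow> bool" where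
  "encodes_pair E F p v \<longleftrightarrow> (\<exists>x y. E (fst p) x \<and> F (snd p) y \<and> v = Node x y)"

definition encodes_set :: "('a \<Rightarrow> tree \<Rightarrow> bool) \<Rightarrow> 'a set \<Rightarrow> tree \<Rightarrow> bool" where
  "encodes_set E S v \<longleftrightarrow>
     (\<exists>xs vs. distinct xs \<and> set xs = S \<and> list_all2 E xs vs \<and> v = list_tree vs)"

definition encodes_base :: "nat set \<times> nat implication set \<Rightarrow> tree \<Rightarrow> bool" where
  "encodes_base =
     encodes_pair (encodes_set encodes_nat)
       (encodes_set (encodes_pair (encodes_set encodes_nat) encodes_nat))"

definition encodes_family :: "nat set set \<Rightarrow> tree \<Rightarrow> bool" where
  "encodes_family = encodes_set (encodes_set encodes_nat)"


section \<open>Output-quasipolynomial time\<close>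

text \<open>
  One program must, on every encoding of every admissible instance, halt with an encoding of the
  required output within \<open>N powr f N\<close> steps, where \<open>f N = O(log N)\<close> and \<open>N\<close> is the size of the
  input plus the size of the output. Behaviour on other inputs is unconstrained. As
  \<open>nodes v \<ge> 1\<close> for every tree, \<open>N \<ge> 2\<close>, and the arbitrary values of \<open>f\<close> at small arguments
  only affect finitely many sizes.
\<close>

definition output_quasipolynomial_time ::
    "('i \<Rightarrow> tree \<Rightarrow> bool) \<Rightarrow> ('o \<Rightarrow> tree \<Rightarrow> bool) \<Rightarrow> 'i set \<Rightarrow> ('i \<Rightarrow> 'o) \<Rightarrow> bool" where
  "output_quasipolynomial_time E F I sol \<longleftrightarrow>
     (\<exists>(P :: program) (f :: nat \<Rightarrow> real).
        f \<in> O(\<lambda>N. ln (real N)) \<and>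
        (\<forall>x \<in> I. \<forall>v. E x v \<longrightarrow>
           (\<exists>w t. runs_to P v w t \<and> F (sol x) w \<and>
              (let N = nodes v + nodes w in real t \<le> real N powr f N))))"

end

theory Submission
  imports Defs "HOL-Library.While_Combinator" "HOL-Library.Discrete_Functions"
begin

text \<open>
  Let \<open>T\<close> be the complement of a set \<open>M \<subseteq> U\<close>. Then \<open>M\<close> is meet-irreducible iff there is an
  \<open>a \<in> T\<close> such that every premise of an element of \<open>T\<close> meets \<open>T\<close>, and every \<open>x \<in> T\<close> other than
  \<open>a\<close> is the only element of \<open>T\<close> in some premise of an element of \<open>T\<close>. So, going through the
  layers from the last to the first, the part of \<open>T\<close> in a layer is a minimal transversal of the
  premises inside that layer whose conclusions are in the part of \<open>T\<close> already chosen. Every such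
  choice extends to at least one \<open>T\<close>, and different choices to different ones, hence no
  intermediate family is larger than the output. The layering itself need not be known: the number
  of elements reachable from \<open>x\<close> through shared premises and implications is a valid level for \<open>x\<close>.

  Minimal transversals are enumerated by repeatedly searching for a transversal that contains none
  of the known ones and reducing it to a minimal one. Each branching of the search at least halves
  the number of known transversals that matter, so the search tree has logarithmic depth and
  polynomial degree.
\<close>

text \<open>The difficulty is to tie every loop bound to the size of the output, which the program
  does not know in advance. So \<open>feasible D m F\<close> bounds time and size by a fixed power
  of a measure \<open>m\<close> that may mention uncomputed quantities, such as the number of
  meet-irreducible elements, and only on a domain \<open>D\<close>, because loops are controlled
  only under their invariants. As \<open>m\<close> is at least 2, constant overhead is absorbed by
  raising the exponent. For quasipolynomial bounds the measure is a value of \<open>qpoly\<close>: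
  replacing \<open>n\<close> by a power of \<open>n\<close> raises \<open>qpoly n\<close> only to a
  constant power, so polynomially larger subproblems stay in the same class.

  The characterisation of \<open>T\<close> rests on this: a closed \<open>M\<close> is
  meet-irreducible iff some \<open>a\<close> outside \<open>M\<close> lies in every closed proper
  superset of \<open>M\<close>. A private premise of \<open>x\<close> forces an element of
  \<open>T\<close> of smaller level into each closed superset of \<open>M\<close> containing
  \<open>x\<close>, and this descent ends in \<open>a\<close>. It also makes \<open>a\<close> the
  unique element of least level, so \<open>a\<close> can be guessed before any layer is
  filled.\<close>

lemma
  shows eval_append: "eval P env e x t \<Longrightarrow> eval (P @ R) env e x t"
    and evals_append: "evals P env es xs t \<Longrightarrow> evals (P @ R) env es xs t"
proof (induction rule: eval_evals.inducts)
  case (eval_Call f env es xs s y t)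
  then have "eval (P @ R) xs ((P @ R) ! f) y t" by (simp add: nth_append)
  with eval_Call.IH show ?case by (intro eval_evals.eval_Call) auto
qed (intro eval_evals.intros; assumption)+

lemma eval_Call1:
  assumes "f < length P" "eval P env e x s" "eval P [x] (P ! f) y t"
  shows "eval P env (Call f [e]) y (s + t + 1)"
proof -
  have "evals P env [e] [x] (s + 0)" using assms by (intro eval_evals.intros)
  then show ?thesis using eval_evals.eval_Call[OF assms(1) _ assms(3)] by simp
qed

lemma eval_Param0: "eval P [a] (Param 0) a 1"
  using eval_evals.eval_Param[of 0 "[a]" P] by simp

lemma nodes_pos: "1 \<le> nodes t"
  by (cases t) auto

lemma nodes_left: "nodes (left t) \<le> nodes t" and nodes_right: "nodes (right t) \<le> nodes t"
  by (cases t; simp)+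

subsection \<open>Feasible functions\<close>

text \<open>
  A program fragment \<open>Q\<close> may be placed behind any \<open>n\<close> function bodies; that \<open>Q\<close> depends
  only on their number lets the main body be put at index 0 afterwards.
\<close>

definition computes ::
    "program \<Rightarrow> expr \<Rightarrow> (tree \<Rightarrow> bool) \<Rightarrow> (tree \<Rightarrow> nat) \<Rightarrow> nat \<Rightarrow> (tree \<Rightarrow> tree) \<Rightarrow> bool" where
  "computes P e D m k F \<longleftrightarrow> (\<forall>a. D a \<longrightarrow> (\<exists>t \<le> m a ^ k. eval P [a] e (F a) t))"

text \<open>The size of the result needs its own bound: a parameter is read at unit cost whatever
  its size, so repeated duplication can build a tree exponentially larger than the running time. The
  exponent \<open>k\<close> is fixed before \<open>n\<close>, so moving a fragment within a program
  does not change its bound.\<close>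

definition feasible :: "(tree \<Rightarrow> bool) \<Rightarrow> (tree \<Rightarrow> nat) \<Rightarrow> (tree \<Rightarrow> tree) \<Rightarrow> bool" where
  "feasible D m F \<longleftrightarrow>
     (\<exists>k. (\<forall>a. D a \<longrightarrow> 2 \<le> m a \<and> nodes (F a) \<le> m a ^ k) \<and>
          (\<forall>n. \<exists>Q e. \<forall>P. length P = n \<longrightarrow> computes (P @ Q) e D m k F))"

lemma power_le: "2 \<le> (m::nat) \<Longrightarrow> x \<le> m ^ k \<Longrightarrow> k \<le> l \<Longrightarrow> x \<le> m ^ l"
  by (rule order_trans, assumption) (simp add: power_increasing)

text \<open>Two more factors of at least 2 pay for \<open>2 * m ^ k + 1\<close>. This is how the
  overhead of each program construct is turned into a larger exponent.\<close>

lemma power_sum_le: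
  assumes "2 \<le> (m::nat)" "x \<le> m ^ k" "y \<le> m ^ k"
  shows "x + y + 1 \<le> m ^ (k + 2)"
proof -
  have "m ^ k * 2 ^ 2 \<le> m ^ k * m ^ 2"
    using power_mono[OF assms(1), of 2] by simp
  then have "m ^ (k + 2) \<ge> m ^ k * 4" unfolding power_add by simp
  moreover have "m ^ k \<ge> 1" using assms(1) by simp
  ultimately show ?thesis using assms by linarith
qed

lemma computesD: "computes P e D m k F \<Longrightarrow> D a \<Longrightarrow> \<exists>t \<le> m a ^ k. eval P [a] e (F a) t"
  unfolding computes_def by blast

lemma computes_append: "computes P e D m k F \<Longrightarrow> computes (P @ R) e D m k F"
  unfolding computes_def using eval_append by blast

lemma computes_mono:
  assumes "computes P e D m k F" "\<And>a. D a \<Longrightarrow> 2 \<le> m a" "k \<le> l"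
  shows "computes P e D m l F"
  unfolding computes_def
proof (intro allI impI)
  fix a assume "D a"
  then obtain t where "t \<le> m a ^ k" "eval P [a] e (F a) t" using computesD[OF assms(1)] by blast
  then show "\<exists>t \<le> m a ^ l. eval P [a] e (F a) t"
    using power_le[OF assms(2)[OF \<open>D a\<close>], of t k l] assms(3) by auto
qed

lemma feasible_ge2: "feasible D m F \<Longrightarrow> D a \<Longrightarrow> 2 \<le> m a"
  unfolding feasible_def by blast

lemma feasible_nodes: "feasible D m F \<Longrightarrow> \<exists>k. \<forall>a. D a \<longrightarrow> nodes (F a) \<le> m a ^ k"
  unfolding feasible_def by blast

lemma feasibleI:
  assumes "\<And>a. D a \<Longrightarrow> 2 \<le> m a" "\<And>a. D a \<Longrightarrow> nodes (F a) \<le> m a ^ k"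
    "\<And>n. \<exists>Q e. \<forall>P. length P = n \<longrightarrow> computes (P @ Q) e D m k F"
  shows "feasible D m F"
  unfolding feasible_def using assms by blast

lemma feasibleD:
  assumes "feasible D m F"
  shows "\<exists>k. \<forall>l\<ge>k. (\<forall>a. D a \<longrightarrow> nodes (F a) \<le> m a ^ l) \<and>
     (\<forall>n. \<exists>Q e. \<forall>P. length P = n \<longrightarrow> computes (P @ Q) e D m l F)"
proof -
  obtain k where k: "\<forall>a. D a \<longrightarrow> 2 \<le> m a \<and> nodes (F a) \<le> m a ^ k"
    "\<forall>n. \<exists>Q e. \<forall>P. length P = n \<longrightarrow> computes (P @ Q) e D m k F"
    using assms unfolding feasible_def by blast
  show ?thesis
  proof (rule exI[of _ k], intro allI impI conjI)
    fix l n assume "k \<le> l"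
    obtain Q e where "\<forall>P. length P = n \<longrightarrow> computes (P @ Q) e D m k F"
      using spec[OF k(2), of n] by blast
    then have "\<forall>P. length P = n \<longrightarrow> computes (P @ Q) e D m l F"
      using k(1) computes_mono[OF _ _ \<open>k \<le> l\<close>] by simp
    then show "\<exists>Q e. \<forall>P. length P = n \<longrightarrow> computes (P @ Q) e D m l F" by blast
  next
    fix l a assume "k \<le> l" "D a"
    then show "nodes (F a) \<le> m a ^ l" using k(1) power_le[of "m a" "nodes (F a)" k l] by simp
  qed
qed

lemma feasibleD0:
  "feasible D m F \<Longrightarrow> \<exists>k. (\<forall>a. D a \<longrightarrow> nodes (F a) \<le> m a ^ k) \<and>
     (\<forall>n. \<exists>Q e. \<forall>P. length P = n \<longrightarrow> computes (P @ Q) e D m k F)"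
  unfolding feasible_def by blast

text \<open>The second fragment is requested for the position behind the first, and appending it
  leaves the evaluations of the first intact. Both exponents are raised to their sum.\<close>

lemma feasible_two:
  assumes "feasible D m F" "feasible D' m' G"
  shows "\<exists>k. (\<forall>a. D a \<longrightarrow> nodes (F a) \<le> m a ^ k) \<and> (\<forall>a. D' a \<longrightarrow> nodes (G a) \<le> m' a ^ k) \<and>
    (\<forall>n. \<exists>Q e e'. \<forall>P. length P = n \<longrightarrow>
        computes (P @ Q) e D m k F \<and> computes (P @ Q) e' D' m' k G)"
proof -
  obtain k1 where k1: "\<forall>l\<ge>k1. (\<forall>a. D a \<longrightarrow> nodes (F a) \<le> m a ^ l) \<and>
     (\<forall>n. \<exists>Q e. \<forall>P. length P = n \<longrightarrow> computes (P @ Q) e D m l F)"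
    using feasibleD[OF assms(1)] by blast
  obtain k2 where k2: "\<forall>l\<ge>k2. (\<forall>a. D' a \<longrightarrow> nodes (G a) \<le> m' a ^ l) \<and>
     (\<forall>n. \<exists>Q e. \<forall>P. length P = n \<longrightarrow> computes (P @ Q) e D' m' l G)"
    using feasibleD[OF assms(2)] by blast
  let ?k = "k1 + k2"
  show ?thesis
  proof (rule exI[of _ ?k], intro allI impI conjI)
    fix n
    obtain Q1 e1 where 1: "\<forall>P. length P = n \<longrightarrow> computes (P @ Q1) e1 D m ?k F"
      using conjunct2[OF spec[OF k1, of ?k, THEN mp, OF le_add1]] by blast
    obtain Q2 e2 where 2: "\<forall>P. length P = n + length Q1 \<longrightarrow> computes (P @ Q2) e2 D' m' ?k G"
      using conjunct2[OF spec[OF k2, of ?k, THEN mp, OF le_add2]] by blast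
    have "computes (P @ Q1 @ Q2) e1 D m ?k F \<and> computes (P @ Q1 @ Q2) e2 D' m' ?k G"
      if "length P = n" for P
      using 1[rule_format, of P] 2[rule_format, of "P @ Q1"] that
        computes_append[of "P @ Q1" _ _ _ _ _ Q2] by simp
    then show "\<exists>Q e e'. \<forall>P. length P = n \<longrightarrow>
        computes (P @ Q) e D m ?k F \<and> computes (P @ Q) e' D' m' ?k G" by blast
  next
    fix a assume "D a" then show "nodes (F a) \<le> m a ^ ?k" using k1 le_add1 by simp
  next
    fix a assume "D' a" then show "nodes (G a) \<le> m' a ^ ?k" using k2 le_add2 by simp
  qed
qed

lemma feasible_id:
  assumes "\<And>a. D a \<Longrightarrow> 2 \<le> m a" "\<And>a. D a \<Longrightarrow> nodes a \<le> m a ^ k"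
  shows "feasible D m (\<lambda>a. a)"
proof (rule feasibleI)
  fix n
  have "computes (P @ []) (Param 0) D m k (\<lambda>a. a)" for P
    unfolding computes_def using order_trans[OF nodes_pos assms(2)] eval_Param0 by blast
  then show "\<exists>Q e. \<forall>P. length P = n \<longrightarrow> computes (P @ Q) e D m k (\<lambda>a. a)" by blast
qed (use assms in auto)

lemma feasible_Leaf:
  assumes "\<And>a. D a \<Longrightarrow> 2 \<le> m a"
  shows "feasible D m (\<lambda>a. Leaf)"
proof (rule feasibleI[where k = 0])
  fix n
  have "computes (P @ []) LeafE D m 0 (\<lambda>a. Leaf)" for P
    unfolding computes_def using eval_evals.eval_LeafE by fastforce
  then show "\<exists>Q e. \<forall>P. length P = n \<longrightarrow> computes (P @ Q) e D m 0 (\<lambda>a. Leaf)" by blast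
qed (use assms in auto)

lemma feasible_Node:
  assumes "feasible D m F" "feasible D m G"
  shows "feasible D m (\<lambda>a. Node (F a) (G a))"
proof -
  obtain k where k: "\<forall>a. D a \<longrightarrow> nodes (F a) \<le> m a ^ k" "\<forall>a. D a \<longrightarrow> nodes (G a) \<le> m a ^ k"
    "\<forall>n. \<exists>Q e e'. \<forall>P. length P = n \<longrightarrow>
        computes (P @ Q) e D m k F \<and> computes (P @ Q) e' D m k G"
    using feasible_two[OF assms] by blast
  have m2: "D a \<Longrightarrow> 2 \<le> m a" for a using feasible_ge2[OF assms(1)] .
  show ?thesis
  proof (rule feasibleI)
    fix n
    from k(3) obtain Q e e' where Q: "\<forall>P. length P = n \<longrightarrow>
        computes (P @ Q) e D m k F \<and> computes (P @ Q) e' D m k G" by blast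
    have "computes (P @ Q) (NodeE e e') D m (k + 2) (\<lambda>a. Node (F a) (G a))" if n: "length P = n" for P
      unfolding computes_def
    proof (intro allI impI)
      fix a assume "D a"
      obtain s t where "s \<le> m a ^ k" "eval (P @ Q) [a] e (F a) s"
        "t \<le> m a ^ k" "eval (P @ Q) [a] e' (G a) t"
        using Q[rule_format, OF n] \<open>D a\<close> unfolding computes_def by blast
      then show "\<exists>t\<le>m a ^ (k + 2). eval (P @ Q) [a] (NodeE e e') (Node (F a) (G a)) t"
        using eval_evals.eval_NodeE power_sum_le[OF m2[OF \<open>D a\<close>]] by blast
    qed
    then show "\<exists>Q e. \<forall>P. length P = n \<longrightarrow> computes (P @ Q) e D m (k + 2) (\<lambda>a. Node (F a) (G a))"
      by blast
  next
    fix a assume "D a"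
    then show "nodes (Node (F a) (G a)) \<le> m a ^ (k + 2)"
      using k(1,2) power_sum_le[OF m2] by simp
  qed (use m2 in auto)
qed

lemma feasible_unary:
  assumes "feasible D m F"
    and g: "\<And>t. nodes (g t) \<le> nodes t"
    and E: "\<And>P a e x t. eval P [a] e x t \<Longrightarrow> eval P [a] (E e) (g x) (t + 1)"
  shows "feasible D m (\<lambda>a. g (F a))"
proof -
  obtain k where k: "\<forall>a. D a \<longrightarrow> nodes (F a) \<le> m a ^ k"
    "\<forall>n. \<exists>Q e. \<forall>P. length P = n \<longrightarrow> computes (P @ Q) e D m k F"
    using feasibleD0[OF assms(1)] by blast
  have m2: "D a \<Longrightarrow> 2 \<le> m a" for a using feasible_ge2[OF assms(1)] .
  have le: "t + 1 \<le> m a ^ (k + 2)" if "t \<le> m a ^ k" "D a" for a t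
    using power_sum_le[OF m2[OF that(2)] that(1), of 0] by simp
  show ?thesis
  proof (rule feasibleI)
    fix n
    from k(2) obtain Q e where "\<forall>P. length P = n \<longrightarrow> computes (P @ Q) e D m k F" by blast
    then have "\<forall>P. length P = n \<longrightarrow> computes (P @ Q) (E e) D m (k + 2) (\<lambda>a. g (F a))"
      unfolding computes_def using E le by blast
    then show "\<exists>Q e. \<forall>P. length P = n \<longrightarrow> computes (P @ Q) e D m (k + 2) (\<lambda>a. g (F a))"
      by blast
  next
    fix a assume "D a"
    then have "nodes (g (F a)) \<le> m a ^ k" using order_trans[OF g] k(1) by blast
    then show "nodes (g (F a)) \<le> m a ^ (k + 2)" by (rule power_le[OF m2[OF \<open>D a\<close>]]) simp
  qed (use m2 in auto)
qed

lemma feasible_left: "feasible D m F \<Longrightarrow> feasible D m (\<lambda>a. left (F a))"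
  by (rule feasible_unary[where E = LeftE]) (assumption | rule nodes_left eval_evals.eval_LeftE)+

lemma feasible_right: "feasible D m F \<Longrightarrow> feasible D m (\<lambda>a. right (F a))"
  by (rule feasible_unary[where E = RightE]) (assumption | rule nodes_right eval_evals.eval_RightE)+

text \<open>The language has no local bindings, so the body computing \<open>F\<close> becomes a new
  function and the value of \<open>G\<close> its argument; call by value evaluates \<open>G\<close>
  once. The measure may change on the way as long as the new one is polynomial in the old one, which
  multiplies the exponents.\<close>

lemma feasible_comp:
  assumes "feasible D m G" "feasible D' m' F" "\<And>a. D a \<Longrightarrow> D' (G a)"
    and j: "\<And>a. D a \<Longrightarrow> m' (G a) \<le> m a ^ j"
  shows "feasible D m (\<lambda>a. F (G a))"
proof -
  obtain k where k: "\<forall>a. D' a \<longrightarrow> nodes (F a) \<le> m' a ^ k"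
    "\<forall>n. \<exists>Q e e'. \<forall>P. length P = n \<longrightarrow>
        computes (P @ Q) e D m k G \<and> computes (P @ Q) e' D' m' k F"
    using feasible_two[OF assms(1,2)] by blast
  have m2: "D a \<Longrightarrow> 2 \<le> m a" for a using feasible_ge2[OF assms(1)] .
  define l where "l = k + j * k"
  have mm: "m' (G a) ^ k \<le> m a ^ l" if "D a" for a
  proof -
    have "m' (G a) ^ k \<le> (m a ^ j) ^ k" using j that by (simp add: power_mono)
    then have "m' (G a) ^ k \<le> m a ^ (j * k)" by (simp add: power_mult)
    then show ?thesis by (rule power_le[OF m2[OF that]]) (simp add: l_def)
  qed
  show ?thesis
  proof (rule feasibleI)
    fix n
    from k(2) obtain Q e e' where Q: "\<forall>P. length P = n \<longrightarrow>
        computes (P @ Q) e D m k G \<and> computes (P @ Q) e' D' m' k F" by blast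
    have "computes (P @ Q @ [e']) (Call (n + length Q) [e]) D m (l + 2) (\<lambda>a. F (G a))"
      if n: "length P = n" for P
      unfolding computes_def
    proof (intro allI impI)
      fix a assume "D a"
      then obtain s t where s: "s \<le> m a ^ k" "eval (P @ Q) [a] e (G a) s"
        and t: "t \<le> m' (G a) ^ k" "eval (P @ Q) [G a] e' (F (G a)) t"
        using Q[rule_format, OF n] assms(3) unfolding computes_def by blast
      have s2: "s \<le> m a ^ l"
        using power_le[OF m2[OF \<open>D a\<close>] s(1), of l] by (simp add: l_def)
      have t2: "t \<le> m a ^ l" using t mm[OF \<open>D a\<close>] by simp
      have "eval ((P @ Q) @ [e']) [a] (Call (n + length Q) [e]) (F (G a)) (s + t + 1)"
        by (rule eval_Call1[where x = "G a"])
          (use n eval_append[OF s(2)] eval_append[OF t(2)] in \<open>auto simp: nth_append\<close>)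
      then show "\<exists>t \<le> m a ^ (l + 2). eval (P @ Q @ [e']) [a] (Call (n + length Q) [e]) (F (G a)) t"
        using power_sum_le[OF m2[OF \<open>D a\<close>] s2 t2] by auto
    qed
    then show "\<exists>Q e. \<forall>P. length P = n \<longrightarrow> computes (P @ Q) e D m (l + 2) (\<lambda>a. F (G a))"
      by blast
  next
    fix a assume "D a"
    then have "nodes (F (G a)) \<le> m' (G a) ^ k" using k assms by blast
    also have "\<dots> \<le> m a ^ l" using mm \<open>D a\<close> .
    also have "\<dots> \<le> m a ^ (l + 2)" using m2[OF \<open>D a\<close>] by (intro power_increasing) auto
    finally show "nodes (F (G a)) \<le> m a ^ (l + 2)" .
  qed (use m2 in auto)
qed

lemma feasible_if_tree:
  assumes "feasible D m C" "feasible (\<lambda>a. D a \<and> C a \<noteq> Leaf) m F"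
    "feasible (\<lambda>a. D a \<and> C a = Leaf) m G"
  shows "feasible D m (\<lambda>a. if C a \<noteq> Leaf then F a else G a)"
proof -
  obtain k where k: "\<forall>a. D a \<and> C a \<noteq> Leaf \<longrightarrow> nodes (F a) \<le> m a ^ k"
    "\<forall>a. D a \<and> C a = Leaf \<longrightarrow> nodes (G a) \<le> m a ^ k"
    "\<forall>n. \<exists>Q e e'. \<forall>P. length P = n \<longrightarrow>
        computes (P @ Q) e (\<lambda>a. D a \<and> C a \<noteq> Leaf) m k F \<and>
        computes (P @ Q) e' (\<lambda>a. D a \<and> C a = Leaf) m k G"
    using feasible_two[OF assms(2,3)] by blast
  obtain k' where k': "\<forall>l\<ge>k'. (\<forall>a. D a \<longrightarrow> nodes (C a) \<le> m a ^ l) \<and>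
     (\<forall>n. \<exists>Q e. \<forall>P. length P = n \<longrightarrow> computes (P @ Q) e D m l C)"
    using feasibleD[OF assms(1)] by blast
  have m2: "D a \<Longrightarrow> 2 \<le> m a" for a using feasible_ge2[OF assms(1)] .
  define l where "l = k + k'"
  have "k' \<le> l" "k \<le> l" by (simp_all add: l_def)
  let ?H = "\<lambda>a. if C a \<noteq> Leaf then F a else G a"
  show ?thesis
  proof (rule feasibleI)
    fix n
    from k(3) obtain Q e e' where Q: "\<forall>P. length P = n \<longrightarrow>
        computes (P @ Q) e (\<lambda>a. D a \<and> C a \<noteq> Leaf) m k F \<and>
        computes (P @ Q) e' (\<lambda>a. D a \<and> C a = Leaf) m k G" by blast
    from conjunct2[OF spec[OF k', of l, THEN mp, OF \<open>k' \<le> l\<close>]] obtain Q' c where Q': "\<forall>P. length P = n + length Q \<longrightarrow>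
        computes (P @ Q') c D m l C" by blast
    have "computes (P @ Q @ Q') (IfNode c e e') D m (l + 2) ?H" if n: "length P = n" for P
      unfolding computes_def
    proof (intro allI impI)
      fix a assume "D a"
      then obtain s where s: "s \<le> m a ^ l" "eval (P @ Q @ Q') [a] c (C a) s"
        using computesD[OF Q'[rule_format, of "P @ Q"]] n by auto
      have lift: "eval (P @ Q @ Q') [a] f y t" if "eval (P @ Q) [a] f y t" for f y t
        using eval_append[OF that, of Q'] by simp
      have le: "t \<le> m a ^ k \<Longrightarrow> s + t + 1 \<le> m a ^ (l + 2)" for t
        using power_sum_le[OF m2[OF \<open>D a\<close>] s(1)] power_le[OF m2[OF \<open>D a\<close>] _ \<open>k \<le> l\<close>] by blast
      show "\<exists>t \<le> m a ^ (l + 2). eval (P @ Q @ Q') [a] (IfNode c e e') (?H a) t"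
      proof (cases "C a = Leaf")
        case True
        then obtain t where t: "t \<le> m a ^ k" "eval (P @ Q) [a] e' (G a) t"
          using computesD[OF conjunct2[OF Q[rule_format, OF n]]] \<open>D a\<close> by auto
        from eval_evals.eval_IfNode_False[OF s(2) True lift[OF t(2)]] le[OF t(1)] True
        show ?thesis by auto
      next
        case False
        then obtain t where t: "t \<le> m a ^ k" "eval (P @ Q) [a] e (F a) t"
          using computesD[OF conjunct1[OF Q[rule_format, OF n]]] \<open>D a\<close> by auto
        from eval_evals.eval_IfNode_True[OF s(2) False lift[OF t(2)]] le[OF t(1)] False
        show ?thesis by auto
      qed
    qed
    then show "\<exists>Q e. \<forall>P. length P = n \<longrightarrow> computes (P @ Q) e D m (l + 2) ?H" by blast
  next
    fix a assume "D a"
    then have "nodes (?H a) \<le> m a ^ k" using k(1,2) by simp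
    then show "nodes (?H a) \<le> m a ^ (l + 2)"
      by (rule power_le[OF m2[OF \<open>D a\<close>]]) (use \<open>k \<le> l\<close> in simp)
  qed (use m2 in auto)
qed

lemma feasible_mono:
  assumes "feasible D' m' F" "\<And>a. D a \<Longrightarrow> D' a"
    and "\<And>a. D a \<Longrightarrow> 2 \<le> m a" "\<And>a. D a \<Longrightarrow> m' a \<le> m a ^ j"
  shows "feasible D m F"
proof -
  obtain k where k: "\<forall>a. D' a \<longrightarrow> nodes (F a) \<le> m' a ^ k"
    "\<forall>n. \<exists>Q e. \<forall>P. length P = n \<longrightarrow> computes (P @ Q) e D' m' k F"
    using feasibleD0[OF assms(1)] by blast
  have mm: "m' a ^ k \<le> m a ^ (j * k)" if "D a" for a
    using power_mono[OF assms(4)[OF that], of k] by (simp add: power_mult)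
  show ?thesis
  proof (rule feasibleI)
    fix n
    from k(2) obtain Q e where Q: "\<forall>P. length P = n \<longrightarrow> computes (P @ Q) e D' m' k F" by blast
    have "\<forall>P. length P = n \<longrightarrow> computes (P @ Q) e D m (j * k) F"
      using Q assms(2) order_trans[OF _ mm] unfolding computes_def by blast
    then show "\<exists>Q e. \<forall>P. length P = n \<longrightarrow> computes (P @ Q) e D m (j * k) F" by blast
  next
    fix a assume "D a"
    then have "nodes (F a) \<le> m' a ^ k" using k(1) assms(2) by blast
    then show "nodes (F a) \<le> m a ^ (j * k)" using mm[OF \<open>D a\<close>] by simp
  qed (use assms(3) in auto)
qed

lemma feasible_cong:
  assumes "feasible D m F" "\<And>a. D a \<Longrightarrow> G a = F a"
  shows "feasible D m G"
proof -
  have "(\<forall>a. D a \<longrightarrow> 2 \<le> m a \<and> nodes (G a) \<le> m a ^ k) = (\<forall>a. D a \<longrightarrow> 2 \<le> m a \<and> nodes (F a) \<le> m a ^ k)"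
    "computes P e D m k G = computes P e D m k F" for k P e
    unfolding computes_def using assms(2) by auto
  with assms(1) show ?thesis unfolding feasible_def by simp
qed

subsection \<open>Loops\<close>

text \<open>A loop becomes one self-recursive function \<open>W\<close>. Since fragments have a
  single parameter, it receives the state paired with the unchanging input \<open>a\<close>. The
  condition and the step are measured against \<open>a\<close> alone, so their cost does not
  compound from round to round; the invariant \<open>I\<close> keeps the state small and
  \<open>\<mu>\<close> bounds the number of rounds.\<close>

lemma feasible_while:
  assumes s0: "feasible D m s0" and id: "feasible D m (\<lambda>a. a)"
    and c: "feasible (\<lambda>z. D (right z) \<and> I (right z) (left z)) (\<lambda>z. m (right z))
        (\<lambda>z. c (left z) (right z))"
    and h: "feasible (\<lambda>z. (D (right z) \<and> I (right z) (left z)) \<and> c (left z) (right z) \<noteq> Leaf)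
        (\<lambda>z. m (right z)) (\<lambda>z. h (left z) (right z))"
    and init: "\<And>a. D a \<Longrightarrow> I a (s0 a)"
    and step: "\<And>a s. D a \<Longrightarrow> I a s \<Longrightarrow> c s a \<noteq> Leaf \<Longrightarrow> I a (h s a)"
    and decr: "\<And>a s. D a \<Longrightarrow> I a s \<Longrightarrow> c s a \<noteq> Leaf \<Longrightarrow> \<mu> a (h s a) < (\<mu> a s :: nat)"
    and sz: "\<And>a s. D a \<Longrightarrow> I a s \<Longrightarrow> nodes s \<le> m a ^ j"
    and meas: "\<And>a. D a \<Longrightarrow> \<mu> a (s0 a) \<le> m a ^ j"
  shows "feasible D m (\<lambda>a. while (\<lambda>s. c s a \<noteq> Leaf) (\<lambda>s. h s a) (s0 a))"
proof -
  let ?Dc = "\<lambda>z. D (right z) \<and> I (right z) (left z)"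
  let ?Dh = "\<lambda>z. (D (right z) \<and> I (right z) (left z)) \<and> c (left z) (right z) \<noteq> Leaf"
  let ?m = "\<lambda>z. m (right z)"
  have m2: "D a \<Longrightarrow> 2 \<le> m a" for a using feasible_ge2[OF s0] .
  obtain k where k: "\<forall>n. \<exists>Q e e'. \<forall>P. length P = n \<longrightarrow>
        computes (P @ Q) e ?Dc ?m k (\<lambda>z. c (left z) (right z)) \<and>
        computes (P @ Q) e' ?Dh ?m k (\<lambda>z. h (left z) (right z))"
    using feasible_two[OF c h] by blast
  obtain k' where k': "\<forall>n. \<exists>Q e. \<forall>P. length P = n \<longrightarrow>
        computes (P @ Q) e D m k' (\<lambda>a. Node (s0 a) a)"
    using feasibleD0[OF feasible_Node[OF s0 id]] by blast
  let ?w = "\<lambda>a. while (\<lambda>s. c s a \<noteq> Leaf) (\<lambda>s. h s a)"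
  have nodes_w: "nodes (?w a s) \<le> m a ^ j" if "D a" "I a s" for a s
    using that(2)
  proof (induction "\<mu> a s" arbitrary: s rule: less_induct)
    case less
    show ?case
      using less step[OF that(1)] decr[OF that(1)] sz[OF that(1)]
      by (subst while_unfold) auto
  qed
  define l where "l = k + k' + j + 12"
  show ?thesis
  proof (rule feasibleI)
    fix a assume "D a"
    show "nodes (?w a (s0 a)) \<le> m a ^ l"
      using nodes_w[OF \<open>D a\<close> init[OF \<open>D a\<close>]] by (rule power_le[OF m2[OF \<open>D a\<close>]]) (simp add: l_def)
  next
    fix n
    from k obtain Q ce he where Q: "\<forall>P. length P = n \<longrightarrow>
        computes (P @ Q) ce ?Dc ?m k (\<lambda>z. c (left z) (right z)) \<and>
        computes (P @ Q) he ?Dh ?m k (\<lambda>z. h (left z) (right z))" by blast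
    from k' obtain Q' se where Q': "\<forall>P. length P = n + length Q \<longrightarrow>
        computes (P @ Q') se D m k' (\<lambda>a. Node (s0 a) a)" by blast
    \<comment> \<open>The position of \<open>W\<close> in the final program; it must be known
      beforehand because \<open>W\<close> calls itself by index.\<close>
    define i where "i = n + length Q + length Q'"
    define W where "W = IfNode ce (Call i [NodeE he (RightE (Param 0))]) (LeftE (Param 0))"
    have "computes (P @ Q @ Q' @ [W]) (Call i [se]) D m l (\<lambda>a. ?w a (s0 a))"
      if n: "length P = n" for P
      unfolding computes_def
    proof (intro allI impI)
      fix a assume "D a"
      let ?P = "P @ Q @ Q' @ [W]"
      have PQ: "eval ?P env f y t" if "eval (P @ Q) env f y t" for env f y t
        using eval_append[OF that, of "Q' @ [W]"] by simp
      have i: "i < length ?P" "?P ! i = W" using n by (auto simp: i_def nth_append)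
      \<comment> \<open>One round evaluates the condition and the step, at most
        \<open>m a ^ k\<close> each; the constant covers the remaining constructs of
        \<open>W\<close>.\<close>
      let ?K = "2 * m a ^ k + 10"
      have loop: "\<exists>t \<le> Suc (\<mu> a s) * ?K. eval ?P [Node s a] W (?w a s) t" if "I a s" for s
        using that
      proof (induction "\<mu> a s" arbitrary: s rule: less_induct)
        case less
        obtain t1 where t1: "t1 \<le> m a ^ k" "eval ?P [Node s a] ce (c s a) t1"
          using computesD[OF conjunct1[OF Q[rule_format, OF n]], of "Node s a"] less.prems \<open>D a\<close> PQ
          by auto
        show ?case
        proof (cases "c s a = Leaf")
          case True
          then have "?w a s = s" by (simp add: while_unfold)
          moreover have l: "eval ?P [Node s a] (LeftE (Param 0)) (left (Node s a)) (1 + 1)"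
            by (intro eval_evals.eval_LeftE eval_Param0)
          ultimately have "eval ?P [Node s a] W (?w a s) (t1 + 2 + 1)"
            using eval_evals.eval_IfNode_False[OF t1(2) True l, of "Call i [NodeE he (RightE (Param 0))]"]
            unfolding W_def[symmetric] by simp
          moreover have "t1 + 2 + 1 \<le> Suc (\<mu> a s) * ?K" using t1 by simp
          ultimately show ?thesis by blast
        next
          case False
          obtain t2 where t2: "t2 \<le> m a ^ k" "eval ?P [Node s a] he (h s a) t2"
            using computesD[OF conjunct2[OF Q[rule_format, OF n]], of "Node s a"] less.prems \<open>D a\<close> PQ False
            by auto
          from less.hyps[of "h s a"] decr step less.prems \<open>D a\<close> False obtain t3 where
            t3: "t3 \<le> Suc (\<mu> a (h s a)) * ?K" "eval ?P [Node (h s a) a] W (?w a (h s a)) t3"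
            by blast
          have "Suc (\<mu> a (h s a)) * ?K \<le> \<mu> a s * ?K"
            using decr less.prems \<open>D a\<close> False by (intro mult_right_mono) (auto simp: Suc_le_eq)
          then have le3: "t3 \<le> \<mu> a s * ?K" using t3 by simp
          have r: "eval ?P [Node s a] (RightE (Param 0)) a (1 + 1)"
            using eval_evals.eval_RightE[OF eval_Param0, of ?P "Node s a"] by simp
          have call: "eval ?P [Node s a] (Call i [NodeE he (RightE (Param 0))]) (?w a (h s a))
              ((t2 + (1 + 1) + 1) + t3 + 1)"
            by (rule eval_Call1[OF i(1) eval_evals.eval_NodeE[OF t2(2) r]]) (simp add: i t3)
          have "?w a s = ?w a (h s a)" by (subst while_unfold) (simp add: False)
          then have "eval ?P [Node s a] W (?w a s) (t1 + ((t2 + (1 + 1) + 1) + t3 + 1) + 1)"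
            using eval_evals.eval_IfNode_True[OF t1(2) False call, of "LeftE (Param 0)"]
            unfolding W_def[symmetric] by simp
          moreover have "t1 + ((t2 + (1 + 1) + 1) + t3 + 1) + 1 \<le> Suc (\<mu> a s) * ?K"
            using t1 t2 le3 by simp
          ultimately show ?thesis by blast
        qed
      qed
      obtain t where t: "t \<le> Suc (\<mu> a (s0 a)) * ?K" "eval ?P [Node (s0 a) a] W (?w a (s0 a)) t"
        using loop init \<open>D a\<close> by blast
      obtain s where s: "s \<le> m a ^ k'" "eval ?P [a] se (Node (s0 a) a) s"
        using computesD[OF computes_append[OF Q'[rule_format, of "P @ Q"], of "[W]"]] n \<open>D a\<close> by fastforce
      have "eval ?P [a] (Call i [se]) (?w a (s0 a)) (s + t + 1)"
        using eval_Call1[OF i(1) s(2)] t i by simp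
      moreover have "s + t + 1 \<le> m a ^ l"
      proof -
        note m2 = m2[OF \<open>D a\<close>]
        have p: "1 \<le> m a ^ x" for x using m2 by simp
        have "Suc (\<mu> a (s0 a)) \<le> m a ^ (j + 2)"
          using power_sum_le[OF m2 meas[OF \<open>D a\<close>], of 0] by simp
        moreover have "?K \<le> m a ^ (k + 4)"
        proof -
          have "16 \<le> m a ^ 4" using power_mono[OF m2, of 4] by simp
          then have "m a ^ k * 16 \<le> m a ^ (k + 4)" unfolding power_add by (rule mult_left_mono) simp
          then show ?thesis using p[of k] by linarith
        qed
        ultimately have "Suc (\<mu> a (s0 a)) * ?K \<le> m a ^ (j + 2) * m a ^ (k + 4)"
          by (rule mult_mono) auto
        then have "t \<le> m a ^ (j + 2) * m a ^ (k + 4)" using t by linarith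
        then have "t \<le> m a ^ (j + 2 + (k + 4))" unfolding power_add .
        then show ?thesis
          using power_le[OF m2 power_sum_le[OF m2 power_le[OF m2 s(1)] power_le[OF m2]], of "k + k' + j + 8"]
          by (simp add: l_def)
      qed
      ultimately show "\<exists>t \<le> m a ^ l. eval ?P [a] (Call i [se]) (?w a (s0 a)) t" by blast
    qed
    then show "\<exists>Q e. \<forall>P. length P = n \<longrightarrow> computes (P @ Q) e D m l (\<lambda>a. ?w a (s0 a))" by blast
  qed (use m2 in auto)
qed

subsection \<open>Lists and truth values as trees\<close>

text \<open>Every tree is a list when read along its right spine, so \<open>tree_list\<close> is
  total and inverse to \<open>list_tree\<close> on both sides.\<close>

fun tree_list :: "tree \<Rightarrow> tree list" where
  "tree_list Leaf = []"
| "tree_list (Node x y) = x # tree_list y"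

abbreviation els :: "tree \<Rightarrow> tree set" where
  "els t \<equiv> set (tree_list t)"

lemma list_tree_inverse [simp]: "tree_list (list_tree xs) = xs"
  by (induction xs) auto

lemma tree_list_inverse [simp]: "list_tree (tree_list t) = t"
  by (induction t) auto

lemma tree_list_eq_Nil [simp]: "tree_list t = [] \<longleftrightarrow> t = Leaf"
  by (cases t) auto

lemma list_tree_eq_Leaf [simp]: "list_tree xs = Leaf \<longleftrightarrow> xs = []"
  by (cases xs) auto

lemma nodes_list_tree: "nodes (list_tree xs) = (\<Sum>x\<leftarrow>xs. nodes x + 1) + 1"
  by (induction xs) auto

lemma nodes_eq_tree_list: "nodes t = (\<Sum>x\<leftarrow>tree_list t. nodes x + 1) + 1"
  using nodes_list_tree[of "tree_list t"] by simp

lemma nodes_els: "x \<in> els t \<Longrightarrow> nodes x < nodes t"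
  by (induction t) auto

lemma length_tree_list: "length (tree_list t) < nodes t"
  by (induction t) auto

definition tt :: "bool \<Rightarrow> tree" where
  "tt b = (if b then Node Leaf Leaf else Leaf)"

lemma tt_Leaf [simp]: "tt b = Leaf \<longleftrightarrow> \<not> b"
  by (simp add: tt_def)

abbreviation decidable :: "(tree \<Rightarrow> bool) \<Rightarrow> (tree \<Rightarrow> nat) \<Rightarrow> (tree \<Rightarrow> bool) \<Rightarrow> bool" where
  "decidable D m B \<equiv> feasible D m (\<lambda>a. tt (B a))"

text \<open>A leaf has one node, so \<open>Suc\<close> lifts the measure to the required minimum of
  2.\<close>

abbreviation poly :: "(tree \<Rightarrow> tree) \<Rightarrow> bool" where
  "poly \<equiv> feasible (\<lambda>_. True) (\<lambda>a. Suc (nodes a))"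

abbreviation polyd :: "(tree \<Rightarrow> bool) \<Rightarrow> bool" where
  "polyd \<equiv> decidable (\<lambda>_. True) (\<lambda>a. Suc (nodes a))"

lemma Suc_nodes_ge2: "2 \<le> Suc (nodes a)"
  using nodes_pos[of a] by simp

lemma poly_id: "poly (\<lambda>a. a)"
  by (rule feasible_id[where k = 1]) (use Suc_nodes_ge2 in auto)

text \<open>Polynomial-time operations can be used under every measure: the argument
  \<open>G a\<close> has size at most a power of \<open>m a\<close>, so its size may replace
  \<open>m\<close> in the cost of \<open>F\<close>.\<close>

lemma feasible_poly:
  assumes "poly F" "feasible D m G"
  shows "feasible D m (\<lambda>a. F (G a))"
proof -
  obtain k where k: "\<forall>a. D a \<longrightarrow> nodes (G a) \<le> m a ^ k" using feasible_nodes[OF assms(2)] by blast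
  show ?thesis
  proof (rule feasible_comp[OF assms(2,1), where j = "k + 2"])
    fix a assume "D a"
    then show "Suc (nodes (G a)) \<le> m a ^ (k + 2)"
      using power_sum_le[of "m a" "nodes (G a)" k 0] k feasible_ge2[OF assms(2)] by simp
  qed simp
qed

lemma feasible_poly2:
  assumes "poly (\<lambda>a. f (left a) (right a))" "feasible D m F" "feasible D m G"
  shows "feasible D m (\<lambda>a. f (F a) (G a))"
  using feasible_poly[OF assms(1) feasible_Node[OF assms(2,3)]] by simp

lemma poly_left: "poly left" and poly_right: "poly right"
  using feasible_left[OF poly_id] feasible_right[OF poly_id] by simp_all

text \<open>Only leaves can be tested, so equality is decided by descending both trees in parallel.
  The recursion branches and is not an instance of a loop; it is therefore written as an explicit
  body \<open>B\<close> and costs time linear in the first tree.\<close>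

lemma poly_eq_base: "polyd (\<lambda>z. left z = right z)"
proof -
  define l r where "l = LeftE (Param 0)" and "r = RightE (Param 0)"
  define B where "B i = IfNode l (IfNode r (IfNode (Call i [NodeE (LeftE l) (LeftE r)])
      (Call i [NodeE (RightE l) (RightE r)]) LeafE) LeafE) (IfNode r LeafE (NodeE LeafE LeafE))" for i
  \<comment> \<open>The factor 40 is generous: it exceeds the number of constructs evaluated in one
    activation of \<open>B\<close>, and each activation is charged to a node of
    \<open>left z\<close>.\<close>
  have B: "\<exists>t \<le> 40 * nodes (left z). eval P [z] (B i) (tt (left z = right z)) t"
    if i: "i < length P" "P ! i = B i" for i P z
  proof (induction "left z" arbitrary: z)
    case Leaf
    have l: "eval P [z] l Leaf (1 + 1)" and r: "eval P [z] r (right z) (1 + 1)"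
      using eval_evals.eval_LeftE[OF eval_Param0, of P z] eval_evals.eval_RightE[OF eval_Param0, of P z] Leaf
      by (simp_all add: l_def r_def)
    show ?case
    proof (cases "right z = Leaf")
      case True
      have "eval P [z] (B i) (Node Leaf Leaf) (1 + 1 + (1 + 1 + (1 + 1 + 1) + 1) + 1)"
        unfolding B_def
        by (rule eval_evals.eval_IfNode_False[OF l _ eval_evals.eval_IfNode_False[OF r True
                eval_evals.eval_NodeE[OF eval_evals.eval_LeafE eval_evals.eval_LeafE]]]) simp
      then show ?thesis using True Leaf by (intro exI conjI) (auto simp: tt_def)
    next
      case False
      have "eval P [z] (B i) Leaf (1 + 1 + (1 + 1 + 1 + 1) + 1)"
        unfolding B_def
        by (rule eval_evals.eval_IfNode_False[OF l _ eval_evals.eval_IfNode_True[OF r False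
                eval_evals.eval_LeafE]]) simp
      then have e: "eval P [z] (B i) Leaf 7" by (simp add: numeral_eq_Suc)
      have eq: "tt (left z = right z) = Leaf" using False Leaf by auto
      show ?thesis unfolding eq using nodes_pos[of "left z"] by (intro exI[of _ 7] conjI e) simp
    qed
  next
    case (Node x1 x2)
    have lz: "left z = Node x1 x2" using Node.hyps(3) by simp
    then have ne: "left z \<noteq> Leaf" by simp
    have l: "eval P [z] l (left z) (1 + 1)" and r: "eval P [z] r (right z) (1 + 1)"
      using eval_evals.eval_LeftE[OF eval_Param0, of P z] eval_evals.eval_RightE[OF eval_Param0, of P z]
      by (simp_all add: l_def r_def)
    show ?case
    proof (cases "right z = Leaf")
      case True
      then have "eval P [z] (B i) Leaf (1 + 1 + (1 + 1 + 1 + 1) + 1)"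
        unfolding B_def
        using eval_evals.eval_IfNode_True[OF l ne eval_evals.eval_IfNode_False[OF r True
              eval_evals.eval_LeafE]] by blast
      then show ?thesis using True ne nodes_pos[of "left z"]
        by (intro exI[of _ "1 + 1 + (1 + 1 + 1 + 1) + 1"]) (auto simp: tt_def)
    next
      case False
      let ?z1 = "Node (left (left z)) (left (right z))" and ?z2 = "Node (right (left z)) (right (right z))"
      obtain t1 where t1: "t1 \<le> 40 * nodes x1" "eval P [?z1] (B i) (tt (left (left z) = left (right z))) t1"
        using Node.hyps(1)[of ?z1] lz by auto
      obtain t2 where t2: "t2 \<le> 40 * nodes x2" "eval P [?z2] (B i) (tt (right (left z) = right (right z))) t2"
        using Node.hyps(2)[of ?z2] lz by auto
      have c1: "eval P [z] (Call i [NodeE (LeftE l) (LeftE r)]) (tt (left (left z) = left (right z)))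
          (1 + 1 + 1 + (1 + 1 + 1) + 1 + t1 + 1)"
        by (rule eval_Call1[OF i(1) eval_evals.eval_NodeE[OF eval_evals.eval_LeftE[OF l]
                eval_evals.eval_LeftE[OF r]]]) (simp add: i t1)
      have c2: "eval P [z] (Call i [NodeE (RightE l) (RightE r)]) (tt (right (left z) = right (right z)))
          (1 + 1 + 1 + (1 + 1 + 1) + 1 + t2 + 1)"
        by (rule eval_Call1[OF i(1) eval_evals.eval_NodeE[OF eval_evals.eval_RightE[OF l]
                eval_evals.eval_RightE[OF r]]]) (simp add: i t2)
      have split: "left z = right z \<longleftrightarrow> left (left z) = left (right z) \<and> right (left z) = right (right z)"
        using lz False by (cases "right z") auto
      have nodes: "nodes (left z) = nodes x1 + nodes x2 + 1" using lz by simp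
      show ?thesis
      proof (cases "left (left z) = left (right z)")
        case True
        have "eval P [z] (B i) (tt (right (left z) = right (right z)))
            (1 + 1 + (1 + 1 + (1 + 1 + 1 + (1 + 1 + 1) + 1 + t1 + 1 + (1 + 1 + 1 + (1 + 1 + 1) + 1 + t2 + 1) + 1) + 1) + 1)"
          unfolding B_def
          by (rule eval_evals.eval_IfNode_True[OF l ne eval_evals.eval_IfNode_True[OF r False
                  eval_evals.eval_IfNode_True[OF c1 _ c2]]]) (simp add: True)
        then show ?thesis using True t1 t2 nodes by (intro exI conjI) (auto simp: split)
      next
        case neq: False
        have "eval P [z] (B i) Leaf
            (1 + 1 + (1 + 1 + (1 + 1 + 1 + (1 + 1 + 1) + 1 + t1 + 1 + 1 + 1) + 1) + 1)"
          unfolding B_def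
          by (rule eval_evals.eval_IfNode_True[OF l ne eval_evals.eval_IfNode_True[OF r False
                  eval_evals.eval_IfNode_False[OF c1 _ eval_evals.eval_LeafE]]]) (simp add: neq)
        moreover have eq: "tt (left z = right z) = Leaf" using neq split by simp
        ultimately show ?thesis unfolding eq using t1 nodes by (intro exI conjI) auto
      qed
    qed
  qed
  show ?thesis
  proof (rule feasibleI[where k = 7])
    fix n
    have "computes (P @ [B n]) (Call n [Param 0]) (\<lambda>_. True) (\<lambda>a. Suc (nodes a)) 7
        (\<lambda>z. tt (left z = right z))" if n: "length P = n" for P
      unfolding computes_def
    proof (intro allI impI)
      fix z
      obtain t where t: "t \<le> 40 * nodes (left z)" "eval (P @ [B n]) [z] (B n) (tt (left z = right z)) t"
        using B[of n "P @ [B n]" z] n by auto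
      have "eval (P @ [B n]) [z] (Call n [Param 0]) (tt (left z = right z)) (1 + t + 1)"
        by (rule eval_Call1[OF _ eval_Param0]) (use n t in auto)
      moreover have "1 + t + 1 \<le> Suc (nodes z) ^ 7"
      proof -
        have "Suc (nodes z) ^ 6 * Suc (nodes z) \<ge> 2 ^ 6 * Suc (nodes z)"
          using power_mono[OF Suc_nodes_ge2[of z], of 6] by (intro mult_right_mono) auto
        moreover have "Suc (nodes z) ^ 7 = Suc (nodes z) ^ 6 * Suc (nodes z)"
          using power_Suc2[of "Suc (nodes z)" 6] by simp
        ultimately show ?thesis using t(1) nodes_left[of z] by simp
      qed
      ultimately show "\<exists>t\<le>Suc (nodes z) ^ 7. eval (P @ [B n]) [z] (Call n [Param 0]) (tt (left z = right z)) t"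
        by blast
    qed
    then show "\<exists>Q e. \<forall>P. length P = n \<longrightarrow> computes (P @ Q) e (\<lambda>_. True) (\<lambda>a. Suc (nodes a)) 7
        (\<lambda>z. tt (left z = right z))" by blast
  next
    fix z
    have "(2::nat) ^ 7 \<le> Suc (nodes z) ^ 7" by (rule power_mono[OF Suc_nodes_ge2]) simp
    then show "nodes (tt (left z = right z)) \<le> Suc (nodes z) ^ 7" by (simp add: tt_def)
  qed (use Suc_nodes_ge2 in auto)
qed

lemma decidable_eq:
  "feasible D m F \<Longrightarrow> feasible D m G \<Longrightarrow> decidable D m (\<lambda>a. F a = G a)"
  by (rule feasible_poly2[OF poly_eq_base])

lemma feasible_Leaf': "feasible D m F \<Longrightarrow> feasible D m (\<lambda>a. Leaf)"
  by (rule feasible_Leaf) (rule feasible_ge2)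

lemma feasible_restrict: "feasible D m F \<Longrightarrow> feasible (\<lambda>a. D a \<and> R a) m F"
  by (rule feasible_mono[where D' = D and m' = m and j = 1]) (use feasible_ge2[of D m F] in auto)

lemma feasible_if:
  assumes "decidable D m B" "feasible D m F" "feasible D m G"
  shows "feasible D m (\<lambda>a. if B a then F a else G a)"
  using feasible_if_tree[OF assms(1) feasible_restrict[OF assms(2)] feasible_restrict[OF assms(3)]] by simp

lemma decidable_const:
  assumes "feasible D m F"
  shows "decidable D m (\<lambda>a. b)"
  unfolding tt_def using feasible_Node[OF feasible_Leaf' feasible_Leaf', OF assms assms]
  by (cases b) (simp_all add: feasible_Leaf'[OF assms])

lemma decidable_not:
  assumes "decidable D m B"
  shows "decidable D m (\<lambda>a. \<not> B a)"
  by (rule feasible_cong[OF feasible_if[OF assms decidable_const[OF assms, of False]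
          decidable_const[OF assms, of True]]]) (simp add: tt_def)

lemma decidable_conj:
  assumes "decidable D m B" "decidable D m C"
  shows "decidable D m (\<lambda>a. B a \<and> C a)"
  by (rule feasible_cong[OF feasible_if[OF assms decidable_const[OF assms(1), of False]]])
    (simp add: tt_def)

lemma decidable_disj:
  assumes "decidable D m B" "decidable D m C"
  shows "decidable D m (\<lambda>a. B a \<or> C a)"
  by (rule feasible_cong[OF feasible_if[OF assms(1) decidable_const[OF assms(1), of True] assms(2)]])
    (simp add: tt_def)

subsection \<open>List operations\<close>

text \<open>The arguments a fold passes to its body, read as \<open>Node (Node x s) a\<close>:
  current element, accumulator, fixed input. The processed prefix \<open>ys\<close> is exposed so
  that the invariant \<open>J\<close> can say what has been accumulated so far.\<close>

definition fold_dom ::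
    "(tree \<Rightarrow> bool) \<Rightarrow> (tree \<Rightarrow> tree) \<Rightarrow> (tree \<Rightarrow> tree list \<Rightarrow> tree \<Rightarrow> bool) \<Rightarrow> tree \<Rightarrow> bool" where
  "fold_dom D L J z \<longleftrightarrow> D (right z) \<and>
     (\<exists>ys zs. tree_list (L (right z)) = ys @ left (left z) # zs \<and> J (right z) ys (right (left z)))"

definition elem_dom :: "(tree \<Rightarrow> bool) \<Rightarrow> (tree \<Rightarrow> tree) \<Rightarrow> tree \<Rightarrow> bool" where
  "elem_dom D L z \<longleftrightarrow> D (right z) \<and> left z \<in> els (L (right z))"

lemma nodes_le_parts: "nodes z \<le> nodes (left z) + nodes (right z) + 1"
  by (cases z) auto

lemma feasible_fold_id:
  assumes "feasible D m (\<lambda>a. a)" "feasible D m L"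
    and bd: "\<And>a ys s. D a \<Longrightarrow> J a ys s \<Longrightarrow> nodes s \<le> m a ^ j"
  shows "feasible (fold_dom D L J) (\<lambda>z. m (right z)) (\<lambda>z. z)"
proof -
  obtain k where k: "\<forall>a. D a \<longrightarrow> nodes a \<le> m a ^ k" using feasible_nodes[OF assms(1)] by blast
  obtain l where l: "\<forall>a. D a \<longrightarrow> nodes (L a) \<le> m a ^ l" using feasible_nodes[OF assms(2)] by blast
  let ?h = "k + l + j"
  show ?thesis
  proof (rule feasible_id)
    fix z assume z: "fold_dom D L J z"
    then obtain ys zs where yz: "D (right z)" "tree_list (L (right z)) = ys @ left (left z) # zs"
      "J (right z) ys (right (left z))" unfolding fold_dom_def by blast
    show m2: "2 \<le> m (right z)" using feasible_ge2[OF assms(1)] yz(1) .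
    have "left (left z) \<in> els (L (right z))" using yz(2) by simp
    then have "nodes (left (left z)) \<le> m (right z) ^ l"
      using nodes_els l yz(1) by (meson less_imp_le order_trans)
    then have 1: "nodes (left (left z)) \<le> m (right z) ^ ?h" by (rule power_le[OF m2]) simp
    have 2: "nodes (right (left z)) \<le> m (right z) ^ ?h" by (rule power_le[OF m2 bd[OF yz(1,3)]]) simp
    have 3: "nodes (right z) \<le> m (right z) ^ (?h + 2)"
      by (rule power_le[OF m2 k[rule_format, OF yz(1)]]) simp
    have "nodes (left z) \<le> m (right z) ^ (?h + 2)"
      using power_sum_le[OF m2 1 2] nodes_le_parts[of "left z"] by linarith
    from power_sum_le[OF m2 this 3] nodes_le_parts[of z]
    show "nodes z \<le> m (right z) ^ (?h + 2 + 2)" by linarith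
  qed
qed

lemma feasible_pair_id:
  assumes id: "feasible D m (\<lambda>a. a)" and sz: "\<And>a s. D a \<Longrightarrow> I a s \<Longrightarrow> nodes s \<le> m a ^ j"
  shows "feasible (\<lambda>z. D (right z) \<and> I (right z) (left z)) (\<lambda>z. m (right z)) (\<lambda>z. z)"
proof -
  obtain k where k: "\<forall>a. D a \<longrightarrow> nodes a \<le> m a ^ k" using feasible_nodes[OF id] by blast
  show ?thesis
  proof (rule feasible_id)
    fix z assume z: "D (right z) \<and> I (right z) (left z)"
    show m2: "2 \<le> m (right z)" using z feasible_ge2[OF id] by blast
    have 1: "nodes (left z) \<le> m (right z) ^ (j + k)"
      by (rule power_le[OF m2 sz]) (use z in auto)
    have 2: "nodes (right z) \<le> m (right z) ^ (j + k)"
      by (rule power_le[OF m2 k[rule_format]]) (use z in auto)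
    show "nodes z \<le> m (right z) ^ (j + k + 2)"
      using power_sum_le[OF m2 1 2] nodes_le_parts[of z] by linarith
  qed
qed

text \<open>A loop whose state pairs the unread rest of the list with the accumulator; the length of
  the rest decreases. As \<open>f\<close> is measured against the fixed input only, the accumulator
  has to be known to stay small, which \<open>J\<close> and its size bound provide.\<close>

lemma feasible_fold:
  assumes L: "feasible D m L" and A: "feasible D m A" and id: "feasible D m (\<lambda>a. a)"
    and f: "feasible (fold_dom D L J) (\<lambda>z. m (right z))
        (\<lambda>z. f (left (left z)) (right (left z)) (right z))"
    and J0: "\<And>a. D a \<Longrightarrow> J a [] (A a)"
    and JS: "\<And>a ys x zs s. D a \<Longrightarrow> tree_list (L a) = ys @ x # zs \<Longrightarrow> J a ys s \<Longrightarrow> J a (ys @ [x]) (f x s a)"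
    and bd: "\<And>a ys s. D a \<Longrightarrow> J a ys s \<Longrightarrow> nodes s \<le> m a ^ j"
  shows "feasible D m (\<lambda>a. fold (\<lambda>x s. f x s a) (tree_list (L a)) (A a))"
proof -
  define I where "I a s \<longleftrightarrow> (\<exists>ys. tree_list (L a) = ys @ tree_list (left s) \<and> J a ys (right s))" for a s
  define h where "h s a = Node (right (left s)) (f (left (left s)) (right s) a)" for s a
  let ?w = "\<lambda>a. while (\<lambda>s. left s \<noteq> Leaf) (\<lambda>s. h s a)"
  have w: "right (?w a (Node t s)) = fold (\<lambda>x s. f x s a) (tree_list t) s" for a t s
  proof (induction "tree_list t" arbitrary: t s)
    case Nil
    then have "t = Leaf" by (cases t) auto
    then show ?case by (subst while_unfold) simp
  next
    case (Cons x xs)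
    then obtain t' where "t = Node x t'" "xs = tree_list t'" by (cases t) auto
    then show ?case using Cons(1) by (subst while_unfold) (simp add: h_def)
  qed
  obtain l where l: "\<forall>a. D a \<longrightarrow> nodes (L a) \<le> m a ^ l" using feasible_nodes[OF L] by blast
  have m2: "D a \<Longrightarrow> 2 \<le> m a" for a using feasible_ge2[OF id] .
  have sz: "nodes s \<le> m a ^ (l + j + 2)" if Da: "D a" and Ias: "I a s" for a s
  proof -
    obtain ys where ys: "tree_list (L a) = ys @ tree_list (left s)" "J a ys (right s)"
      using Ias unfolding I_def by blast
    have "nodes (left s) \<le> nodes (L a)"
      unfolding nodes_eq_tree_list[of "left s"] nodes_eq_tree_list[of "L a"] ys(1) by simp
    then have "nodes (left s) \<le> m a ^ l" using l Da order_trans by blast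
    then have 1: "nodes (left s) \<le> m a ^ (l + j)" by (rule power_le[OF m2[OF Da]]) simp
    have 2: "nodes (right s) \<le> m a ^ (l + j)"
      by (rule power_le[OF m2[OF Da] bd[OF Da ys(2)]]) simp
    show ?thesis using power_sum_le[OF m2[OF Da] 1 2] nodes_le_parts[of s] by linarith
  qed
  have idw: "feasible (\<lambda>z. D (right z) \<and> I (right z) (left z)) (\<lambda>z. m (right z)) (\<lambda>z. z)"
    by (rule feasible_pair_id[OF id sz])
  have "feasible D m (\<lambda>a. ?w a (Node (L a) (A a)))"
  proof (rule feasible_while[where c = "\<lambda>s a. left s" and I = I and
        \<mu> = "\<lambda>a s. length (tree_list (left s))" and j = "l + j + 2"])
    show "feasible D m (\<lambda>a. Node (L a) (A a))" by (rule feasible_Node[OF L A])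
    show "feasible D m (\<lambda>a. a)" by (rule id)
    show "feasible (\<lambda>z. D (right z) \<and> I (right z) (left z)) (\<lambda>z. m (right z)) (\<lambda>z. left (left z))"
      by (intro feasible_left idw)
    let ?D = "\<lambda>z. (D (right z) \<and> I (right z) (left z)) \<and> left (left z) \<noteq> Leaf"
    have idh: "feasible ?D (\<lambda>z. m (right z)) (\<lambda>z. z)" by (rule feasible_restrict[OF idw])
    have "feasible ?D (\<lambda>z. m (right z))
        (\<lambda>z. (\<lambda>z. f (left (left z)) (right (left z)) (right z))
          (Node (Node (left (left (left z))) (right (left z))) (right z)))"
    proof (rule feasible_comp[OF _ f, where j = 1])
      fix z assume z: "?D z"
      then obtain ys where ys: "tree_list (L (right z)) = ys @ tree_list (left (left z))"
        "J (right z) ys (right (left z))" unfolding I_def by blast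
      moreover obtain x t where "left (left z) = Node x t" using z by (cases "left (left z)") auto
      ultimately show "fold_dom D L J (Node (Node (left (left (left z))) (right (left z))) (right z))"
        unfolding fold_dom_def using z by auto
    qed (use idh in \<open>auto intro!: feasible_Node feasible_left feasible_right\<close>)
    then show "feasible ?D (\<lambda>z. m (right z)) (\<lambda>z. h (left z) (right z))"
      unfolding h_def left.simps right.simps
      by (intro feasible_Node feasible_left feasible_right idh)
  next
    fix a assume "D a"
    then show "I a (Node (L a) (A a))" unfolding I_def using J0 by auto
    show "length (tree_list (left (Node (L a) (A a)))) \<le> m a ^ (l + j + 2)"
      using length_tree_list[of "L a"] power_le[OF m2[OF \<open>D a\<close>] l[rule_format, OF \<open>D a\<close>], of "l + j + 2"]
      by simp
  next
    fix a s assume a: "D a" "I a s" "left s \<noteq> Leaf"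
    then obtain ys where ys: "tree_list (L a) = ys @ tree_list (left s)" "J a ys (right s)"
      unfolding I_def by blast
    obtain x t where xt: "left s = Node x t" using a(3) by (cases "left s") auto
    then have "J a (ys @ [x]) (f x (right s) a)" using JS[OF a(1) _ ys(2)] ys(1) by simp
    then show "I a (h s a)" unfolding I_def h_def using ys xt by auto
    show "length (tree_list (left (h s a))) < length (tree_list (left s))"
      using xt by (simp add: h_def)
  qed (use sz in auto)
  then show ?thesis using feasible_right by (fastforce simp: w)
qed

lemma feasible_elem_id:
  assumes "feasible D m (\<lambda>a. a)" "feasible D m L"
  shows "feasible (elem_dom D L) (\<lambda>z. m (right z)) (\<lambda>z. z)"
proof -
  obtain l where l: "\<forall>a. D a \<longrightarrow> nodes (L a) \<le> m a ^ l" using feasible_nodes[OF assms(2)] by blast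
  have "feasible (\<lambda>z. D (right z) \<and> left z \<in> els (L (right z))) (\<lambda>z. m (right z)) (\<lambda>z. z)"
  proof (rule feasible_pair_id[OF assms(1), where I = "\<lambda>a s. s \<in> els (L a)"])
    fix a s assume "D a" "s \<in> els (L a)"
    then show "nodes s \<le> m a ^ l" using nodes_els[of s "L a"] l by (meson less_imp_le order_trans)
  qed
  then show ?thesis unfolding elem_dom_def .
qed

lemma feasible_elem_proj:
  assumes "feasible (elem_dom D L) (\<lambda>z. m (right z)) (\<lambda>z. f (left z) (right z))"
    and "feasible (fold_dom D L J) (\<lambda>z. m (right z)) (\<lambda>z. z)"
  shows "feasible (fold_dom D L J) (\<lambda>z. m (right z)) (\<lambda>z. f (left (left z)) (right z))"
proof -
  have "feasible (fold_dom D L J) (\<lambda>z. m (right z))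
      (\<lambda>z. (\<lambda>z. f (left z) (right z)) (Node (left (left z)) (right z)))"
    by (rule feasible_comp[OF _ assms(1), where j = 1])
      (use assms(2) in \<open>auto simp: fold_dom_def elem_dom_def intro!: feasible_Node feasible_left feasible_right\<close>)
  then show ?thesis by simp
qed

lemma feasible_m2: "feasible D m F \<Longrightarrow> D a \<Longrightarrow> n \<le> 2 ^ k \<Longrightarrow> n \<le> m a ^ k"
  using power_mono[OF feasible_ge2[of D m F a], of k] by force

lemma decidable_ex_dom:
  assumes L: "feasible D m L" and id: "feasible D m (\<lambda>a. a)"
    and B: "decidable (elem_dom D L) (\<lambda>z. m (right z)) (\<lambda>z. B (left z) (right z))"
  shows "decidable D m (\<lambda>a. \<exists>x\<in>els (L a). B x a)"
proof -
  \<comment> \<open>A truth value is a tree of at most 3 nodes.\<close>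
  let ?J = "\<lambda>(a::tree) (ys::tree list) s. nodes s \<le> 3"
  have bd: "\<And>a ys s. D a \<Longrightarrow> ?J a ys s \<Longrightarrow> nodes s \<le> m a ^ 2"
    using feasible_m2[OF id, of _ 3 2] by force
  have idf: "feasible (fold_dom D L ?J) (\<lambda>z. m (right z)) (\<lambda>z. z)"
    by (rule feasible_fold_id[OF id L bd])
  have fd: "fold (\<lambda>x s. tt (B x a \<or> s \<noteq> Leaf)) xs (tt b) = tt ((\<exists>x\<in>set xs. B x a) \<or> b)" for a xs b
    by (induction xs arbitrary: b) (auto intro!: arg_cong[of _ _ tt])
  have "feasible D m (\<lambda>a. fold (\<lambda>x s. tt (B x a \<or> s \<noteq> Leaf)) (tree_list (L a)) (tt False))"
  proof (rule feasible_fold[where J = ?J and j = 2, OF L _ id])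
    show "feasible (fold_dom D L ?J) (\<lambda>z. m (right z))
        (\<lambda>z. tt (B (left (left z)) (right z) \<or> right (left z) \<noteq> Leaf))"
      by (intro decidable_disj decidable_not decidable_eq feasible_left feasible_right
          feasible_Leaf'[OF idf] idf feasible_elem_proj[of D L m "\<lambda>x e. tt (B x e)", OF B])
  next
    show "feasible D m (\<lambda>a. tt False)" by (rule decidable_const[OF id])
  qed (use bd in \<open>auto simp: tt_def\<close>)
  then show ?thesis unfolding fd by simp
qed

text \<open>The reversal is what a fold that puts elements in front of its accumulator yields. Here
  and in \<open>app\<close> and \<open>cmap\<close> the order is left as it comes, since lists are
  used as finite sets or counted.\<close>

definition filt :: "(tree \<Rightarrow> bool) \<Rightarrow> tree \<Rightarrow> tree" where
  "filt B t = list_tree (rev (filter B (tree_list t)))"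

definition app :: "tree \<Rightarrow> tree \<Rightarrow> tree" where
  "app s t = list_tree (rev (tree_list s) @ tree_list t)"

definition cmap :: "(tree \<Rightarrow> tree) \<Rightarrow> tree \<Rightarrow> tree" where
  "cmap f t = list_tree (rev (concat (map (\<lambda>x. tree_list (f x)) (tree_list t))))"

lemma els_filt [simp]: "els (filt B t) = {x \<in> els t. B x}"
  by (simp add: filt_def)

lemma els_app [simp]: "els (app s t) = els s \<union> els t"
  by (simp add: app_def)

lemma els_cmap [simp]: "els (cmap f t) = (\<Union>x\<in>els t. els (f x))"
  by (simp add: cmap_def)

lemma length_cmap: "length (tree_list (cmap f t)) = (\<Sum>x\<leftarrow>tree_list t. length (tree_list (f x)))"
  by (simp add: cmap_def length_concat comp_def)

lemma nodes_filt_le: "nodes (filt B t) \<le> nodes t"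
proof -
  have "(\<Sum>x\<leftarrow>filter B xs. nodes x + 1) \<le> (\<Sum>x\<leftarrow>xs. nodes x + 1)" for xs
    by (induction xs) auto
  then show ?thesis
    unfolding filt_def nodes_list_tree nodes_eq_tree_list[of t] by (simp add: rev_map[symmetric])
qed

text \<open>Each \<open>f x\<close> ends in a leaf of its own, whereas the concatenation has only
  one; the length on the left compensates.\<close>

lemma nodes_cmap: "nodes (cmap f t) + length (tree_list t) = (\<Sum>x\<leftarrow>tree_list t. nodes (f x)) + 1"
proof -
  have "(\<Sum>y\<leftarrow>concat (map (\<lambda>x. tree_list (f x)) xs). nodes y + 1) + length xs = (\<Sum>x\<leftarrow>xs. nodes (f x))" for xs
    by (induction xs) (auto simp: nodes_eq_tree_list[of "f _"])
  from this[of "tree_list t"] show ?thesis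
    unfolding cmap_def nodes_list_tree by (simp add: rev_map[symmetric])
qed

lemma feasible_filt_dom:
  assumes L: "feasible D m L" and id: "feasible D m (\<lambda>a. a)"
    and B: "decidable (elem_dom D L) (\<lambda>z. m (right z)) (\<lambda>z. B (left z) (right z))"
  shows "feasible D m (\<lambda>a. filt (\<lambda>x. B x a) (L a))"
proof -
  let ?J = "\<lambda>(a::tree) (ys::tree list) s. (\<exists>zs. tree_list (L a) = ys @ zs) \<and> s = filt (\<lambda>x. B x a) (list_tree ys)"
  obtain l where l: "\<forall>a. D a \<longrightarrow> nodes (L a) \<le> m a ^ l" using feasible_nodes[OF L] by blast
  have bd: "nodes s \<le> m a ^ l" if "D a" and J: "?J a ys s" for a ys s
  proof -
    from J obtain zs where zs: "tree_list (L a) = ys @ zs" by blast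
    have "nodes s \<le> nodes (list_tree ys)" using J nodes_filt_le by simp
    also have "\<dots> \<le> nodes (L a)"
      unfolding nodes_list_tree nodes_eq_tree_list[of "L a"] zs by simp
    finally show ?thesis using l that by (meson order_trans)
  qed
  have idf: "feasible (fold_dom D L ?J) (\<lambda>z. m (right z)) (\<lambda>z. z)"
    by (rule feasible_fold_id[OF id L bd])
  have fd: "fold (\<lambda>x s. if B x a then Node x s else s) xs (filt (\<lambda>x. B x a) (list_tree ys))
      = filt (\<lambda>x. B x a) (list_tree (ys @ xs))" for a xs ys
  proof (induction xs arbitrary: ys)
    case (Cons x xs)
    then show ?case using Cons[of "ys @ [x]"] by (auto simp: filt_def)
  qed simp
  have "feasible D m (\<lambda>a. fold (\<lambda>x s. if B x a then Node x s else s) (tree_list (L a)) Leaf)"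
  proof (rule feasible_fold[where J = ?J and j = l, OF L _ id])
    show "feasible (fold_dom D L ?J) (\<lambda>z. m (right z))
        (\<lambda>z. if B (left (left z)) (right z) then Node (left (left z)) (right (left z)) else right (left z))"
      by (intro feasible_if feasible_left feasible_right feasible_Node idf
          feasible_elem_proj[of D L m "\<lambda>x e. tt (B x e)", OF B])
  qed (use bd feasible_Leaf'[OF id] in \<open>auto simp: filt_def\<close>)
  then show ?thesis using fd[of _ _ "[]"] by (simp add: filt_def)
qed

lemma poly_app: "poly (\<lambda>z. app (left z) (right z))"
proof -
  \<comment> \<open>What the accumulator gains is taken from the list still to be moved, so the two
    together never exceed the input.\<close>
  let ?J = "\<lambda>a ys s. nodes s + (\<Sum>x\<leftarrow>drop (length ys) (tree_list (left a)). nodes x + 1) \<le> nodes a"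
  let ?m = "\<lambda>z. Suc (nodes (right z))"
  have idf: "feasible (fold_dom (\<lambda>_. True) left ?J) ?m (\<lambda>z. z)"
    by (rule feasible_fold_id[OF poly_id poly_left, where j = 1]) simp
  have fd: "fold (\<lambda>x s. Node x s) xs t = app (list_tree xs) t" for xs t
    by (induction xs arbitrary: t) (auto simp: app_def)
  have "poly (\<lambda>a. fold (\<lambda>x s. Node x s) (tree_list (left a)) (right a))"
  proof (rule feasible_fold[where J = ?J and j = 1, OF poly_left poly_right poly_id])
    show "feasible (fold_dom (\<lambda>_. True) left ?J) ?m (\<lambda>z. Node (left (left z)) (right (left z)))"
      by (intro feasible_left feasible_right feasible_Node idf)
    show "?J a [] (right a)" for a
      using nodes_eq_tree_list[of "left a"] by (cases a) auto
  qed auto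
  then show ?thesis unfolding fd by simp
qed

lemma feasible_app: "feasible D m F \<Longrightarrow> feasible D m G \<Longrightarrow> feasible D m (\<lambda>a. app (F a) (G a))"
  by (rule feasible_poly2[OF poly_app])

lemma feasible_cmap_dom:
  assumes L: "feasible D m L" and id: "feasible D m (\<lambda>a. a)"
    and f: "feasible (elem_dom D L) (\<lambda>z. m (right z)) (\<lambda>z. f (left z) (right z))"
  shows "feasible D m (\<lambda>a. cmap (\<lambda>x. f x a) (L a))"
proof -
  let ?J = "\<lambda>(a::tree) (ys::tree list) s. (\<exists>zs. tree_list (L a) = ys @ zs) \<and> s = cmap (\<lambda>x. f x a) (list_tree ys)"
  obtain l where l: "\<forall>a. D a \<longrightarrow> nodes (L a) \<le> m a ^ l" using feasible_nodes[OF L] by blast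
  obtain k where k: "\<forall>z. elem_dom D L z \<longrightarrow> nodes (f (left z) (right z)) \<le> m (right z) ^ k"
    using feasible_nodes[OF f] by blast
  have bd: "nodes s \<le> m a ^ (l + k + 2)" if "D a" and J: "?J a ys s" for a ys s
  proof -
    note m2 = feasible_ge2[OF id \<open>D a\<close>]
    from J obtain zs where zs: "tree_list (L a) = ys @ zs" by blast
    have "nodes (f x a) \<le> m a ^ k" if "x \<in> set ys" for x
      using k[rule_format, of "Node x a"] that zs \<open>D a\<close> by (simp add: elem_dom_def)
    then have "(\<Sum>x\<leftarrow>ys. nodes (f x a)) \<le> (\<Sum>x\<leftarrow>ys. m a ^ k)"
      by (intro sum_list_mono) auto
    also have "\<dots> = length ys * m a ^ k" by (simp add: sum_list_triv)
    also have "\<dots> \<le> m a ^ l * m a ^ k"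
      using zs length_tree_list[of "L a"] l[rule_format, OF \<open>D a\<close>] by (intro mult_right_mono) auto
    finally have "(\<Sum>x\<leftarrow>ys. nodes (f x a)) \<le> m a ^ (l + k)" by (simp add: power_add)
    then show ?thesis
      using power_sum_le[OF m2, of _ "l + k" 0] nodes_cmap[of "\<lambda>x. f x a" "list_tree ys"] J by fastforce
  qed
  have idf: "feasible (fold_dom D L ?J) (\<lambda>z. m (right z)) (\<lambda>z. z)"
    by (rule feasible_fold_id[OF id L bd])
  have fd: "fold (\<lambda>x s. app (f x a) s) xs (cmap (\<lambda>x. f x a) (list_tree ys))
      = cmap (\<lambda>x. f x a) (list_tree (ys @ xs))" for a xs ys
  proof (induction xs arbitrary: ys)
    case (Cons x xs)
    then show ?case using Cons[of "ys @ [x]"] by (auto simp: cmap_def app_def)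
  qed simp
  have "feasible D m (\<lambda>a. fold (\<lambda>x s. app (f x a) s) (tree_list (L a)) Leaf)"
  proof (rule feasible_fold[where J = ?J and j = "l + k + 2", OF L _ id])
    show "feasible (fold_dom D L ?J) (\<lambda>z. m (right z))
        (\<lambda>z. app (f (left (left z)) (right z)) (right (left z)))"
      by (intro feasible_app feasible_left feasible_right idf feasible_elem_proj[OF f])
  qed (use bd feasible_Leaf'[OF id] in \<open>auto simp: cmap_def app_def\<close>)
  then show ?thesis using fd[of _ _ "[]"] by (simp add: cmap_def)
qed

lemma decidable_ex:
  assumes "feasible D m L" "feasible D m (\<lambda>a. a)" "polyd (\<lambda>z. B (left z) (right z))"
  shows "decidable D m (\<lambda>a. \<exists>x\<in>els (L a). B x a)"
  by (rule decidable_ex_dom[OF assms(1,2) feasible_poly[OF assms(3) feasible_elem_id[OF assms(2,1)]]])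

lemma decidable_all:
  assumes "feasible D m L" "feasible D m (\<lambda>a. a)" "polyd (\<lambda>z. B (left z) (right z))"
  shows "decidable D m (\<lambda>a. \<forall>x\<in>els (L a). B x a)"
  using decidable_not[OF decidable_ex[OF assms(1,2) decidable_not[OF assms(3)]]] by simp

lemma feasible_filt:
  assumes "feasible D m L" "feasible D m (\<lambda>a. a)" "polyd (\<lambda>z. B (left z) (right z))"
  shows "feasible D m (\<lambda>a. filt (\<lambda>x. B x a) (L a))"
  by (rule feasible_filt_dom[OF assms(1,2) feasible_poly[OF assms(3) feasible_elem_id[OF assms(2,1)]]])

lemma feasible_cmap:
  assumes "feasible D m L" "feasible D m (\<lambda>a. a)" "poly (\<lambda>z. f (left z) (right z))"
  shows "feasible D m (\<lambda>a. cmap (\<lambda>x. f x a) (L a))"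
  by (rule feasible_cmap_dom[OF assms(1,2) feasible_poly[OF assms(3) feasible_elem_id[OF assms(2,1)]]])

lemma decidable_mem:
  assumes "feasible D m F" "feasible D m L"
  shows "decidable D m (\<lambda>a. F a \<in> els (L a))"
proof -
  have "polyd (\<lambda>z. \<exists>x\<in>els (right z). x = left z)"
    by (intro decidable_ex decidable_eq feasible_left feasible_right poly_id)
  then have "polyd (\<lambda>z. left z \<in> els (right z))"
    by (rule feasible_cong) (auto intro!: arg_cong[of _ _ tt])
  from feasible_poly2[of "\<lambda>x y. tt (x \<in> els y)", OF this assms] show ?thesis .
qed

lemmas poly_intros = poly_id feasible_Leaf'[OF poly_id] feasible_left feasible_right feasible_Node
  feasible_if decidable_not decidable_conj decidable_disj decidable_eq decidable_mem
  decidable_ex[OF _ poly_id] decidable_all[OF _ poly_id] feasible_filt[OF _ poly_id]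
  feasible_cmap[OF _ poly_id] feasible_app

lemma feasible_poly3:
  assumes "poly (\<lambda>a. f (left a) (left (right a)) (right (right a)))"
    "feasible D m F" "feasible D m G" "feasible D m H"
  shows "feasible D m (\<lambda>a. f (F a) (G a) (H a))"
  using feasible_poly[OF assms(1) feasible_Node[OF assms(2) feasible_Node[OF assms(3,4)]]] by simp

definition shorter :: "tree \<Rightarrow> tree \<Rightarrow> bool" where
  "shorter s t \<longleftrightarrow> length (tree_list s) \<le> length (tree_list t)"

text \<open>Lengths are compared in unary: strip from the first list one element for every element
  of the second and test whether anything remains.\<close>

lemma poly_shorter: "polyd (\<lambda>z. shorter (left z) (right z))"
proof -
  let ?J = "\<lambda>a (ys::tree list) s. nodes s \<le> nodes a"
  have idf: "feasible (fold_dom (\<lambda>_. True) right ?J) (\<lambda>z. Suc (nodes (right z))) (\<lambda>z. z)"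
    by (rule feasible_fold_id[OF poly_id poly_right, where j = 1]) simp
  have fd: "tree_list (fold (\<lambda>x s. right s) xs t) = drop (length xs) (tree_list t)" for xs t
  proof (induction xs arbitrary: t)
    case (Cons x xs)
    then show ?case by (cases t) auto
  qed simp
  have "poly (\<lambda>a. fold (\<lambda>x s. right s) (tree_list (right a)) (left a))"
    by (rule feasible_fold[where J = ?J and j = 1, OF poly_right poly_left poly_id])
      (auto intro!: feasible_right feasible_left idf nodes_left nodes_right order_trans[OF nodes_right])
  then have "polyd (\<lambda>a. fold (\<lambda>x s. right s) (tree_list (right a)) (left a) = Leaf)"
    by (intro decidable_eq feasible_Leaf'[OF poly_id])
  then show ?thesis
    by (rule feasible_cong)
      (auto simp: shorter_def tree_list_eq_Nil[symmetric] fd simp del: tree_list_eq_Nil intro!: arg_cong[of _ _ tt])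
qed

lemma decidable_shorter:
  "feasible D m F \<Longrightarrow> feasible D m G \<Longrightarrow> decidable D m (\<lambda>a. shorter (F a) (G a))"
  by (rule feasible_poly2[of "\<lambda>x y. tt (shorter x y)", OF poly_shorter])

subsection \<open>Minimal transversals\<close>

text \<open>For a transversal, having a private hyperedge for each vertex is the same as being
  minimal under inclusion; this form is the one shared with the condition on complements of
  meet-irreducible elements.\<close>

definition mintrans :: "'a set set \<Rightarrow> 'a set set" where
  "mintrans H = {X. (\<forall>E\<in>H. E \<inter> X \<noteq> {}) \<and> (\<forall>x\<in>X. \<exists>E\<in>H. E \<inter> X = {x})}"

lemma mintrans_antichain:
  assumes "X \<in> mintrans H" "Y \<in> mintrans H" "Y \<subseteq> X"
  shows "X = Y"
proof (rule ccontr)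
  assume "X \<noteq> Y"
  then obtain x where x: "x \<in> X" "x \<notin> Y" using assms(3) by blast
  then obtain E where "E \<in> H" "E \<inter> X = {x}" using assms(1) unfolding mintrans_def by blast
  moreover have "E \<inter> Y \<noteq> {}" using assms(2) \<open>E \<in> H\<close> unfolding mintrans_def by blast
  ultimately show False using assms(3) x by auto
qed

lemma mintrans_subset: "X \<in> mintrans H \<Longrightarrow> X \<subseteq> \<Union>H"
  unfolding mintrans_def by blast

definition hits :: "tree \<Rightarrow> tree \<Rightarrow> bool" where
  "hits S E \<longleftrightarrow> (\<exists>x\<in>els E. x \<in> els S)"

definition incl :: "tree \<Rightarrow> tree \<Rightarrow> bool" where
  "incl Y S \<longleftrightarrow> (\<forall>x\<in>els Y. x \<in> els S)"

lemma hits_iff: "hits S E \<longleftrightarrow> els E \<inter> els S \<noteq> {}"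
  by (auto simp: hits_def)

lemma incl_iff: "incl Y S \<longleftrightarrow> els Y \<subseteq> els S"
  by (auto simp: incl_def)

lemma poly_hits: "polyd (\<lambda>z. hits (left z) (right z))"
  unfolding hits_def by (intro poly_intros)

lemma poly_incl: "polyd (\<lambda>z. incl (left z) (right z))"
  unfolding incl_def by (intro poly_intros)

lemmas decidable_hits = feasible_poly2[of "\<lambda>x y. tt (hits x y)", OF poly_hits]
lemmas decidable_incl = feasible_poly2[of "\<lambda>x y. tt (incl x y)", OF poly_incl]

text \<open>
  The search for a transversal inside \<open>S\<close> that contains none of the known minimal ones in \<open>G\<close>
  follows Boros and Makino: the known ones inside \<open>S\<close> vote on every vertex, and whenever the set
  of majority vertices is not an answer it exhibits a reason to branch such that each branch
  retains at most half of them.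
\<close>

definition majority :: "tree \<Rightarrow> tree \<Rightarrow> tree" where
  "majority G S = filt (\<lambda>x. shorter (filt (\<lambda>Y. incl Y S \<and> x \<notin> els Y) G)
      (filt (\<lambda>Y. incl Y S \<and> x \<in> els Y) G)) S"

definition missed :: "tree \<Rightarrow> tree \<Rightarrow> tree" where
  "missed H S = filt (\<lambda>E. \<not> hits S E) H"

definition contained :: "tree \<Rightarrow> tree \<Rightarrow> tree" where
  "contained G S = filt (\<lambda>Y. incl Y S) G"

definition solved :: "tree \<Rightarrow> tree \<Rightarrow> tree \<Rightarrow> bool" where
  "solved G H S \<longleftrightarrow> missed H (majority G S) = Leaf \<and> contained G (majority G S) = Leaf"

text \<open>Guess where the wanted transversal meets the missed hyperedge \<open>E0\<close>, and a
  hyperedge \<open>E\<close> that is private to this vertex \<open>i\<close>: the other vertices of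
  \<open>E\<close> can then be deleted.\<close>

definition branch_missed :: "tree \<Rightarrow> tree \<Rightarrow> tree \<Rightarrow> tree" where
  "branch_missed H S E0 = cmap (\<lambda>i. cmap (\<lambda>E. if i \<in> els E
      then Node (filt (\<lambda>x. x \<notin> els E \<or> x = i) S) Leaf else Leaf) H) (filt (\<lambda>i. i \<in> els S) E0)"

text \<open>Guess a vertex of the known set \<open>Y\<close> that the wanted transversal
  avoids.\<close>

definition branch_contained :: "tree \<Rightarrow> tree \<Rightarrow> tree" where
  "branch_contained S Y = cmap (\<lambda>i. Node (filt (\<lambda>x. x \<noteq> i) S) Leaf) Y"

definition branches :: "tree \<Rightarrow> tree \<Rightarrow> tree \<Rightarrow> tree" where
  "branches G H S = (if missed H (majority G S) \<noteq> Leaf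
     then branch_missed H S (left (missed H (majority G S)))
     else branch_contained S (left (contained G (majority G S))))"

text \<open>Depth-first search with an explicit stack of candidate sets. The final stack is the
  result: empty if every branch has failed, and otherwise topped by a set whose majority vertices
  form the transversal sought.\<close>

definition search :: "tree \<Rightarrow> tree \<Rightarrow> tree \<Rightarrow> tree" where
  "search G H V = while (\<lambda>st. tt (st \<noteq> Leaf \<and> \<not> solved G H (left st)) \<noteq> Leaf)
     (\<lambda>st. app (branches G H (left st)) (right st)) (Node V Leaf)"

lemma poly_majority: "poly (\<lambda>z. majority (left z) (right z))"
  unfolding majority_def by (intro poly_intros decidable_shorter decidable_incl)

lemmas feasible_majority = feasible_poly2[OF poly_majority]

lemma poly_missed: "poly (\<lambda>z. missed (left z) (right z))"
  unfolding missed_def by (intro poly_intros decidable_hits)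

lemmas feasible_missed = feasible_poly2[OF poly_missed]

lemma poly_contained: "poly (\<lambda>z. contained (left z) (right z))"
  unfolding contained_def by (intro poly_intros decidable_incl)

lemmas feasible_contained = feasible_poly2[OF poly_contained]

lemma poly_branch_missed: "poly (\<lambda>a. branch_missed (left a) (left (right a)) (right (right a)))"
  unfolding branch_missed_def by (intro poly_intros)

lemmas feasible_branch_missed = feasible_poly3[OF poly_branch_missed]

lemma poly_branch_contained: "poly (\<lambda>a. branch_contained (left a) (right a))"
  unfolding branch_contained_def by (intro poly_intros)

lemmas feasible_branch_contained = feasible_poly2[OF poly_branch_contained]

lemma poly_solved: "polyd (\<lambda>a. solved (left a) (left (right a)) (right (right a)))"
  unfolding solved_def by (intro poly_intros feasible_missed feasible_contained feasible_majority)

lemmas decidable_solved = feasible_poly3[of "\<lambda>x y z. tt (solved x y z)", OF poly_solved]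

lemma poly_branches: "poly (\<lambda>a. branches (left a) (left (right a)) (right (right a)))"
  unfolding branches_def
  by (intro poly_intros feasible_missed feasible_contained feasible_majority
      feasible_branch_missed feasible_branch_contained)

lemmas feasible_branches = feasible_poly3[OF poly_branches]

section \<open>Correctness and size of the search tree\<close>

definition part :: "tree \<Rightarrow> tree \<Rightarrow> bool" where
  "part S V \<longleftrightarrow> els S \<subseteq> els V \<and> nodes S \<le> nodes V \<and>
     (distinct (tree_list V) \<longrightarrow> distinct (tree_list S))"

lemma part_refl: "part S S"
  by (simp add: part_def)

lemma part_trans: "part S T \<Longrightarrow> part T V \<Longrightarrow> part S V"
  by (auto simp: part_def)

lemma part_filt: "part (filt B S) S"
  using nodes_filt_le by (auto simp: part_def filt_def)

definition known :: "tree \<Rightarrow> tree \<Rightarrow> nat" where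
  "known G S = length (filter (\<lambda>Y. incl Y S) (tree_list G))"

lemma length_filt [simp]: "length (tree_list (filt B t)) = length (filter B (tree_list t))"
  by (simp add: filt_def)

lemma filt_eq_Leaf: "filt B t = Leaf \<longleftrightarrow> (\<forall>x\<in>els t. \<not> B x)"
  by (auto simp: filt_def filter_empty_conv)

lemma left_in_els: "t \<noteq> Leaf \<Longrightarrow> left t \<in> els t"
  by (cases t) auto

lemma part_majority: "part (majority G S) S"
  unfolding majority_def by (rule part_filt)

lemma majority_subset: "els (majority G S) \<subseteq> els S"
  by (auto simp: majority_def)

lemma known_split:
  "length (filter (\<lambda>Y. incl Y S \<and> x \<notin> els Y) (tree_list G)) +
   length (filter (\<lambda>Y. incl Y S \<and> x \<in> els Y) (tree_list G)) = known G S"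
proof -
  have "length (filter (\<lambda>y. P y \<and> x \<notin> els y) xs) + length (filter (\<lambda>y. P y \<and> x \<in> els y) xs) =
      length (filter P xs)" for P xs
    by (induction xs) auto
  then show ?thesis by (simp add: known_def)
qed

lemma length_filter_mono:
  "(\<And>x. x \<in> set xs \<Longrightarrow> P x \<Longrightarrow> Q x) \<Longrightarrow> length (filter P xs) \<le> length (filter Q xs)"
  by (induction xs) auto

lemma els_branch_missed:
  "els (branch_missed H S E0) =
    {filt (\<lambda>x. x \<notin> els E \<or> x = i) S | i E. i \<in> els E0 \<and> i \<in> els S \<and> E \<in> els H \<and> i \<in> els E}"
  unfolding branch_missed_def by (auto split: if_splits; blast)

lemma els_branch_contained:
  "els (branch_contained S Y) = {filt (\<lambda>x. x \<noteq> i) S | i. i \<in> els Y}"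
  unfolding branch_contained_def by auto

text \<open>If \<open>E0\<close> is missed, its vertex \<open>i\<close> is outside the majority set,
  so fewer than half of the known sets in \<open>S\<close> contain \<open>i\<close>; yet every known
  set surviving in the branch must meet \<open>E\<close> and can do so only in \<open>i\<close>. If
  a known set is contained, its vertex \<open>i\<close> is a majority vertex, and the survivors are
  among those, at most half, that avoid \<open>i\<close>. The count is positive by strictness in the
  first case and by the contained set itself in the second.\<close>

lemma branch_halves:
  assumes tr: "\<And>Y E. Y \<in> els G \<Longrightarrow> E \<in> els H \<Longrightarrow> hits Y E"
    and ns: "\<not> solved G H S" and c: "C \<in> els (branches G H S)"
  shows "2 * known G C \<le> known G S" "0 < known G S"
proof -
  let ?I = "majority G S"
  have "2 * known G C \<le> known G S \<and> 0 < known G S"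
  proof (cases "missed H ?I = Leaf")
    case False
    let ?E0 = "left (missed H ?I)"
    have E0: "?E0 \<in> els H" "els ?E0 \<inter> els ?I = {}"
      using left_in_els[OF False] by (auto simp: missed_def hits_iff)
    obtain i E where i: "i \<in> els ?E0" "i \<in> els S" "E \<in> els H" "i \<in> els E"
      and C: "C = filt (\<lambda>x. x \<notin> els E \<or> x = i) S"
      using c False unfolding branches_def by (auto simp: els_branch_missed)
    have "\<not> shorter (filt (\<lambda>Y. incl Y S \<and> i \<notin> els Y) G) (filt (\<lambda>Y. incl Y S \<and> i \<in> els Y) G)"
      using i E0 by (auto simp: majority_def)
    then have less: "length (filter (\<lambda>Y. incl Y S \<and> i \<in> els Y) (tree_list G))
      < length (filter (\<lambda>Y. incl Y S \<and> i \<notin> els Y) (tree_list G))" by (simp add: shorter_def)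
    have "known G C \<le> length (filter (\<lambda>Y. incl Y S \<and> i \<in> els Y) (tree_list G))"
      unfolding known_def
    proof (rule length_filter_mono)
      fix Y assume Y: "Y \<in> els G" "incl Y C"
      from tr[OF Y(1) i(3)] obtain y where "y \<in> els E" "y \<in> els Y" by (auto simp: hits_iff)
      then show "incl Y S \<and> i \<in> els Y" using Y(2) unfolding C incl_iff by auto
    qed
    with less known_split[of S i G] show ?thesis by linarith
  next
    case True
    then have ne: "contained G ?I \<noteq> Leaf" using ns by (simp add: solved_def)
    let ?Y0 = "left (contained G ?I)"
    have Y0: "?Y0 \<in> els G" "els ?Y0 \<subseteq> els ?I"
      using left_in_els[OF ne] by (auto simp: contained_def incl_iff)
    obtain i where i: "i \<in> els ?Y0" and C: "C = filt (\<lambda>x. x \<noteq> i) S"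
      using c True unfolding branches_def by (auto simp: els_branch_contained)
    have "shorter (filt (\<lambda>Y. incl Y S \<and> i \<notin> els Y) G) (filt (\<lambda>Y. incl Y S \<and> i \<in> els Y) G)"
      using i Y0 by (auto simp: majority_def)
    then have le: "length (filter (\<lambda>Y. incl Y S \<and> i \<notin> els Y) (tree_list G))
      \<le> length (filter (\<lambda>Y. incl Y S \<and> i \<in> els Y) (tree_list G))" by (simp add: shorter_def)
    have "known G C \<le> length (filter (\<lambda>Y. incl Y S \<and> i \<notin> els Y) (tree_list G))"
      unfolding known_def by (rule length_filter_mono) (auto simp: C incl_iff)
    moreover have "incl ?Y0 S" using Y0 majority_subset by (fastforce simp: incl_iff)
    then have "0 < known G S" using Y0(1) unfolding known_def by (auto simp: filter_empty_conv)
    ultimately show ?thesis using le known_split[of S i G] by linarith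
  qed
  then show "2 * known G C \<le> known G S" "0 < known G S" by auto
qed

text \<open>With no known set inside \<open>S\<close> every vote is a tie, and ties count as
  majority, so the majority set is all of \<open>S\<close>. Being unsolved then means that
  \<open>S\<close> itself misses a hyperedge, which leaves no vertex to branch on.\<close>

lemma branches_unknown:
  assumes "\<not> solved G H S" "known G S = 0"
  shows "branches G H S = Leaf"
proof -
  let ?I = "majority G S"
  have no: "\<forall>Y\<in>els G. \<not> incl Y S" using assms(2) by (simp add: known_def filter_empty_conv)
  then have e: "filter (\<lambda>Y. incl Y S \<and> x \<notin> els Y) (tree_list G) = []" for x
    by (simp add: filter_empty_conv)
  have I: "els ?I = els S" by (auto simp: majority_def shorter_def e)
  then have "contained G ?I = Leaf" using no by (auto simp: contained_def filt_eq_Leaf incl_iff)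
  then have ne: "missed H ?I \<noteq> Leaf" using assms(1) by (simp add: solved_def)
  have "els (left (missed H ?I)) \<inter> els S = {}"
    using left_in_els[OF ne] I by (auto simp: missed_def hits_iff)
  then have "els (branches G H S) = {}" using ne by (auto simp: branches_def els_branch_missed)
  then show ?thesis by simp
qed

lemma length_branches:
  "length (tree_list (branches G H S)) \<le> (nodes G + nodes H) * (nodes G + nodes H)"
proof (cases "missed H (majority G S) = Leaf")
  case False
  let ?E0 = "left (missed H (majority G S))"
  have E0: "?E0 \<in> els H" using left_in_els[OF False] by (auto simp: missed_def)
  have le1: "(\<Sum>x\<leftarrow>xs. f x) \<le> n * length xs" if "\<And>x. f x \<le> n" for f :: "tree \<Rightarrow> nat" and xs n
    using that by (induction xs) (auto simp: add_mono)
  have "length (tree_list (branches G H S)) \<le> length (tree_list H) * length (filter (\<lambda>i. i \<in> els S) (tree_list ?E0))"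
    using False unfolding branches_def branch_missed_def
    by (auto simp: length_cmap comp_def simp flip: length_filt intro!: le1 order_trans[OF le1[of _ 1]])
  also have "\<dots> \<le> nodes H * nodes H"
    using length_tree_list[of H] length_tree_list[of ?E0] nodes_els[OF E0]
    by (intro mult_mono order_trans[OF length_filter_le]) linarith+
  also have "\<dots> \<le> (nodes G + nodes H) * (nodes G + nodes H)" by (intro mult_mono) auto
  finally show ?thesis .
next
  case True
  let ?c = "contained G (majority G S)"
  have "length (tree_list (left ?c)) \<le> nodes G"
  proof (cases "?c = Leaf")
    case False
    then have "left ?c \<in> els G" using left_in_els[of ?c] by (simp add: contained_def)
    then show ?thesis using nodes_els[of "left ?c" G] length_tree_list[of "left ?c"] by simp
  qed simp
  moreover have "length (tree_list (branches G H S)) = length (tree_list (left ?c))"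
    using True unfolding branches_def branch_contained_def by (simp add: length_cmap sum_list_triv)
  moreover have "nodes G * 1 \<le> (nodes G + nodes H) * (nodes G + nodes H)"
    using nodes_pos[of G] by (intro mult_mono) auto
  ultimately show ?thesis by simp
qed

lemma part_branches: "C \<in> els (branches G H S) \<Longrightarrow> part C S"
  unfolding branches_def by (auto simp: els_branch_missed els_branch_contained part_filt split: if_splits)

text \<open>A transversal \<open>X\<close> meets the missed hyperedge in a vertex that has a private
  hyperedge, and the corresponding branch keeps \<open>X\<close>. In the other case the antichain
  property prevents \<open>X\<close> from containing the known set, so \<open>X\<close> avoids one
  of its vertices.\<close>

lemma branches_complete:
  assumes G: "\<And>Y. Y \<in> els G \<Longrightarrow> els Y \<in> mintrans (els ` els H)"
    and X: "X \<in> mintrans (els ` els H)" "X \<notin> els ` els G" "X \<subseteq> els S"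
    and ns: "\<not> solved G H S"
  shows "\<exists>C\<in>els (branches G H S). X \<subseteq> els C"
proof (cases "missed H (majority G S) = Leaf")
  case False
  let ?E0 = "left (missed H (majority G S))"
  have "?E0 \<in> els H" using left_in_els[OF False] by (auto simp: missed_def)
  then obtain i where i: "i \<in> els ?E0" "i \<in> X" using X(1) unfolding mintrans_def by blast
  then obtain E where E: "E \<in> els H" "els E \<inter> X = {i}" using X(1) unfolding mintrans_def by blast
  then have "filt (\<lambda>x. x \<notin> els E \<or> x = i) S \<in> els (branches G H S)"
    using i X(3) False unfolding branches_def by (auto simp: els_branch_missed)
  moreover have "X \<subseteq> els (filt (\<lambda>x. x \<notin> els E \<or> x = i) S)" using E X(3) by auto
  ultimately show ?thesis by blast
next
  case True
  let ?c = "contained G (majority G S)"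
  have "?c \<noteq> Leaf" using True ns by (simp add: solved_def)
  then have Y: "left ?c \<in> els G" using left_in_els[of ?c] by (simp add: contained_def)
  then have "\<not> els (left ?c) \<subseteq> X" using mintrans_antichain[OF X(1) G] X(2) by blast
  then obtain i where i: "i \<in> els (left ?c)" "i \<notin> X" by blast
  then have "filt (\<lambda>x. x \<noteq> i) S \<in> els (branches G H S)"
    using True unfolding branches_def by (auto simp: els_branch_contained)
  moreover have "X \<subseteq> els (filt (\<lambda>x. x \<noteq> i) S)" using i X(3) by auto
  ultimately show ?thesis by blast
qed

lemma while_inv:
  assumes "I s" and step: "\<And>s. I s \<Longrightarrow> c s \<Longrightarrow> I (h s) \<and> \<mu> (h s) < (\<mu> s :: nat)"
  shows "I (while c h s) \<and> \<not> c (while c h s)"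
  by (rule while_rule[where P = I and r = "measure \<mu>"]) (use assms in auto)

text \<open>An upper bound for the search rounds spent on \<open>S\<close> and its descendants when
  there are at most \<open>b\<close> branches each time; the exponent counts the halvings until no
  known set is left. The case distinction separates 0 from 1, which have the same
  \<open>floor_log\<close>.\<close>

definition weight :: "nat \<Rightarrow> tree \<Rightarrow> tree \<Rightarrow> nat" where
  "weight b G S = (b + 1) ^ (if known G S = 0 then 0 else Suc (floor_log (known G S)))"

definition work :: "nat \<Rightarrow> tree \<Rightarrow> tree \<Rightarrow> nat" where
  "work b G st = (\<Sum>S\<leftarrow>tree_list st. weight b G S)"

lemma work_app: "work b G (app s t) = work b G s + work b G t"
  by (simp add: work_def app_def flip: rev_map)

lemma length_le_work: "length (tree_list st) \<le> work b G st"
proof -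
  have "(\<Sum>S\<leftarrow>tree_list st. 1) \<le> work b G st"
    unfolding work_def by (rule sum_list_mono) (simp add: weight_def)
  then show ?thesis by (simp add: sum_list_triv)
qed

text \<open>Each of the at most \<open>b\<close> branches has lost one halving, so each weighs at
  most a \<open>b + 1\<close>-th of \<open>S\<close>. With no known set inside \<open>S\<close>
  there are no branches, while \<open>S\<close> still weighs 1.\<close>

lemma work_branches:
  assumes tr: "\<And>Y E. Y \<in> els G \<Longrightarrow> E \<in> els H \<Longrightarrow> hits Y E" and ns: "\<not> solved G H S"
    and b: "length (tree_list (branches G H S)) \<le> b"
  shows "work b G (branches G H S) < weight b G S"
proof (cases "known G S = 0")
  case True
  then show ?thesis using branches_unknown[OF ns] by (simp add: work_def weight_def)
next
  case False
  let ?l = "floor_log (known G S)"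
  have "weight b G C \<le> (b + 1) ^ ?l" if "C \<in> els (branches G H S)" for C
  proof (cases "known G C = 0")
    case False
    have "known G C \<le> known G S div 2" using branch_halves(1)[OF tr ns that] by simp
    then have "floor_log (known G C) \<le> floor_log (known G S div 2)" by (rule monoD[OF floor_log_mono])
    moreover have "1 \<le> ?l" using branch_halves(1)[OF tr ns that] False
      floor_log_rec[of "known G S"] by simp
    ultimately have "Suc (floor_log (known G C)) \<le> ?l" by simp
    then have "(b + 1) ^ Suc (floor_log (known G C)) \<le> (b + 1) ^ ?l" by (rule power_increasing) simp
    then show ?thesis using False by (simp add: weight_def)
  qed (simp add: weight_def)
  then have "work b G (branches G H S) \<le> (\<Sum>S\<leftarrow>tree_list (branches G H S). (b + 1) ^ ?l)"
    unfolding work_def by (rule sum_list_mono)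
  also have "\<dots> \<le> b * (b + 1) ^ ?l" using b by (simp add: sum_list_triv)
  also have "\<dots> < (b + 1) ^ Suc ?l" by simp
  also have "\<dots> = weight b G S" using False by (simp add: weight_def)
  finally show ?thesis .
qed

text \<open>Invariant: every minimal transversal that is still unknown lies inside some set on the
  stack. An empty stack thus certifies that none is missing. A nonempty one stops at a solved top,
  whose majority set is a transversal containing no known set.\<close>

lemma search_spec:
  assumes G: "\<And>Y. Y \<in> els G \<Longrightarrow> els Y \<in> mintrans (els ` els H)"
    and V: "\<And>E. E \<in> els H \<Longrightarrow> els E \<subseteq> els V"
  shows "search G H V = Leaf \<Longrightarrow> mintrans (els ` els H) \<subseteq> els ` els G"
    and "search G H V \<noteq> Leaf \<Longrightarrow> (\<forall>E\<in>els H. hits (majority G (left (search G H V))) E) \<and>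
      (\<forall>Y\<in>els G. \<not> els Y \<subseteq> els (majority G (left (search G H V)))) \<and>
      part (majority G (left (search G H V))) V"
proof -
  have tr: "hits Y E" if "Y \<in> els G" "E \<in> els H" for Y E
    using G[OF that(1)] that(2) unfolding mintrans_def hits_iff by blast
  define b where "b = (nodes G + nodes H) * (nodes G + nodes H)"
  define I where "I st \<longleftrightarrow> (\<forall>S\<in>els st. part S V) \<and>
    (\<forall>X\<in>mintrans (els ` els H). X \<notin> els ` els G \<longrightarrow> (\<exists>S\<in>els st. X \<subseteq> els S))" for st
  let ?c = "\<lambda>st. tt (st \<noteq> Leaf \<and> \<not> solved G H (left st)) \<noteq> Leaf"
  let ?h = "\<lambda>st. app (branches G H (left st)) (right st)"
  have "I (search G H V) \<and> \<not> ?c (search G H V)"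
    unfolding search_def
  proof (rule while_inv[where \<mu> = "work b G"])
    show "I (Node V Leaf)"
      unfolding I_def using mintrans_subset V part_refl by (fastforce simp: image_iff)
  next
    fix st assume st: "I st" "?c st"
    then obtain S t where S: "st = Node S t" "\<not> solved G H S" by (cases st) auto
    have "I (?h st)"
      unfolding I_def
    proof (intro conjI ballI impI)
      fix C assume "C \<in> els (?h st)"
      then show "part C V"
        using st(1) S part_branches[of C G H S] part_trans unfolding I_def by auto
    next
      fix X assume X: "X \<in> mintrans (els ` els H)" "X \<notin> els ` els G"
      then obtain S' where S': "S' \<in> els st" "X \<subseteq> els S'" using st(1) unfolding I_def by blast
      then show "\<exists>S\<in>els (?h st). X \<subseteq> els S"
        using branches_complete[OF G X _ S(2)] S(1) by auto
    qed
    moreover have "work b G (?h st) < work b G st"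
      using work_branches[OF tr S(2), of b] length_branches[of G H S] S(1)
      by (simp add: work_app) (simp add: work_def b_def)
    ultimately show "I (?h st) \<and> work b G (?h st) < work b G st" by blast
  qed
  then have st: "I (search G H V)" "search G H V \<noteq> Leaf \<Longrightarrow> solved G H (left (search G H V))" by auto
  show "mintrans (els ` els H) \<subseteq> els ` els G" if "search G H V = Leaf"
    using st(1) that unfolding I_def by auto
  assume ne: "search G H V \<noteq> Leaf"
  let ?S = "left (search G H V)"
  have "part ?S V" using st(1) left_in_els[OF ne] unfolding I_def by blast
  then have "part (majority G ?S) V" by (rule part_trans[OF part_majority])
  then show "(\<forall>E\<in>els H. hits (majority G ?S) E) \<and> (\<forall>Y\<in>els G. \<not> els Y \<subseteq> els (majority G ?S)) \<and>
      part (majority G ?S) V"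
    using st(2)[OF ne]
    unfolding solved_def missed_def contained_def filt_eq_Leaf incl_iff by blast
qed

section \<open>Quasipolynomial bounds\<close>

definition qpoly :: "nat \<Rightarrow> nat" where
  "qpoly n = n ^ Suc (floor_log n)"

lemma qpoly_ge: "1 \<le> n \<Longrightarrow> n \<le> qpoly n"
  unfolding qpoly_def by simp

lemma qpoly_mono:
  assumes "1 \<le> m" "m \<le> n"
  shows "qpoly m \<le> qpoly n"
proof -
  have "m ^ Suc (floor_log m) \<le> n ^ Suc (floor_log m)" using assms(2) by (rule power_mono) simp
  also have "\<dots> \<le> n ^ Suc (floor_log n)"
    using assms monoD[OF floor_log_mono assms(2)] by (intro power_increasing) auto
  finally show ?thesis unfolding qpoly_def .
qed

text \<open>Passing from \<open>y\<close> to at most \<open>y ^ c\<close> multiplies the logarithm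
  by about \<open>c\<close>, whence the factor \<open>c + 1\<close> in the exponent; the base
  contributes the other factor \<open>c\<close>. This closure property lets quasipolynomial
  subroutines be called on polynomially larger arguments.\<close>

lemma qpoly_power:
  assumes "1 \<le> z" "z \<le> y ^ c" "2 \<le> y"
  shows "qpoly z \<le> qpoly y ^ (c * (c + 1))"
proof -
  let ?L = "Suc (floor_log y)"
  have "y < 2 ^ ?L" using floor_log_exp2_gt[of y] by simp
  then have "y ^ c \<le> 2 ^ (?L * c)" unfolding power_mult by (intro power_mono) auto
  then have "floor_log z \<le> ?L * c"
    using monoD[OF floor_log_mono, of z "2 ^ (?L * c)"] assms(2) by (simp del: mult_Suc)
  then have "Suc (floor_log z) \<le> ?L * (c + 1)" by simp
  then have "z ^ Suc (floor_log z) \<le> z ^ (?L * (c + 1))"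
    using assms(1) by (intro power_increasing) auto
  also have "\<dots> \<le> (y ^ c) ^ (?L * (c + 1))" using assms(2) by (rule power_mono) simp
  also have "\<dots> = (y ^ ?L) ^ (c * (c + 1))" unfolding power_mult[symmetric] by (simp only: ac_simps)
  finally show ?thesis unfolding qpoly_def .
qed

lemma nodes_list_le:
  assumes "\<And>S. S \<in> els t \<Longrightarrow> nodes S \<le> n"
  shows "nodes t \<le> length (tree_list t) * Suc n + 1"
proof -
  have "(\<Sum>S\<leftarrow>tree_list t. nodes S + 1) \<le> (\<Sum>S\<leftarrow>tree_list t. Suc n)"
    using assms by (intro sum_list_mono) auto
  then show ?thesis unfolding nodes_eq_tree_list[of t] by (simp add: sum_list_triv)
qed

text \<open>The number of rounds is at most the weight of the initial set. With \<open>n\<close> the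
  measure of the input size, its base is at most \<open>n ^ 4\<close> and its exponent at most
  \<open>Suc (floor_log n)\<close>, because no more than \<open>n\<close> sets are known; this gives
  \<open>qpoly n ^ 4\<close>.\<close>

lemma feasible_search:
  "feasible (\<lambda>a. \<forall>Y\<in>els (left a). \<forall>E\<in>els (left (right a)). hits Y E) (\<lambda>a. qpoly (Suc (nodes a)))
     (\<lambda>a. search (left a) (left (right a)) (right (right a)))"
proof -
  let ?D = "\<lambda>a. \<forall>Y\<in>els (left a). \<forall>E\<in>els (left (right a)). hits Y E"
  let ?m = "\<lambda>a. qpoly (Suc (nodes a))"
  define b where "b a = (nodes (left a) + nodes (left (right a))) * (nodes (left a) + nodes (left (right a)))" for a
  \<comment> \<open>Every entry of the stack weighs at least 1, so bounding the work also bounds the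
    length of the stack and, with the bound on entries, its size.\<close>
  define I where "I a st \<longleftrightarrow> (\<forall>S\<in>els st. nodes S \<le> nodes a) \<and>
    work (b a) (left a) st \<le> work (b a) (left a) (Node (right (right a)) Leaf)" for a st
  have m: "Suc (nodes a) \<le> ?m a" "2 \<le> ?m a" for a
    using qpoly_ge[of "Suc (nodes a)"] Suc_nodes_ge2[of a] by auto
  have id: "feasible ?D ?m (\<lambda>a. a)"
    by (rule feasible_id[where k = 1]) (use m in \<open>auto simp: Suc_le_eq intro: less_imp_le\<close>)
  have init: "work (b a) (left a) (Node (right (right a)) Leaf) \<le> ?m a ^ 4" for a
  proof -
    have le: "nodes (left a) + nodes (left (right a)) \<le> Suc (nodes a)"
      using nodes_left[of "right a"] by (cases a) auto
    have "b a \<le> Suc (nodes a) * Suc (nodes a)" unfolding b_def using le by (intro mult_mono) auto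
    then have b1: "b a + 1 \<le> Suc (nodes a) ^ 4"
      using power_sum_le[OF Suc_nodes_ge2, of "b a" a 2 0] by (simp add: power2_eq_square)
    have "known (left a) S \<le> Suc (nodes a)" for S
      using length_tree_list[of "left a"] le length_filter_le[of "\<lambda>Y. incl Y S" "tree_list (left a)"]
      unfolding known_def by linarith
    then have "floor_log (known (left a) (right (right a))) \<le> floor_log (Suc (nodes a))"
      by (intro monoD[OF floor_log_mono])
    then have "weight (b a) (left a) (right (right a)) \<le> (b a + 1) ^ Suc (floor_log (Suc (nodes a)))"
      unfolding weight_def by (intro power_increasing) auto
    also have "\<dots> \<le> (Suc (nodes a) ^ 4) ^ Suc (floor_log (Suc (nodes a)))"
      using b1 by (rule power_mono) simp
    also have "\<dots> = ?m a ^ 4" unfolding qpoly_def power_mult[symmetric] by (simp only: mult.commute)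
    finally show ?thesis by (simp add: work_def)
  qed
  have sz: "nodes st \<le> ?m a ^ 7" if "I a st" for a st
  proof -
    have "nodes st \<le> length (tree_list st) * Suc (nodes a) + 1"
      using that by (intro nodes_list_le) (auto simp: I_def)
    also have "\<dots> \<le> ?m a ^ 4 * ?m a ^ 1 + 1"
      using that init[of a] length_le_work[of st "b a" "left a"] m(1)[of a]
      unfolding I_def by (intro add_mono mult_mono) auto
    also have "\<dots> \<le> ?m a ^ 7"
      using power_sum_le[OF m(2)[of a], of "?m a ^ 4 * ?m a ^ 1" 5 0] unfolding power_add[symmetric] by simp
    finally show ?thesis .
  qed
  have idw: "feasible (\<lambda>z. ?D (right z) \<and> I (right z) (left z)) (\<lambda>z. ?m (right z)) (\<lambda>z. z)"
    by (rule feasible_pair_id[OF id sz])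
  have "feasible ?D ?m (\<lambda>a. while
      (\<lambda>st. tt (st \<noteq> Leaf \<and> \<not> solved (left a) (left (right a)) (left st)) \<noteq> Leaf)
      (\<lambda>st. app (branches (left a) (left (right a)) (left st)) (right st)) (Node (right (right a)) Leaf))"
  proof (rule feasible_while[where I = I and \<mu> = "\<lambda>a. work (b a) (left a)" and j = 7])
    show "feasible ?D ?m (\<lambda>a. Node (right (right a)) Leaf)"
      by (intro feasible_Node feasible_right feasible_Leaf'[OF id] id)
    show "feasible (\<lambda>z. ?D (right z) \<and> I (right z) (left z)) (\<lambda>z. ?m (right z))
        (\<lambda>z. tt (left z \<noteq> Leaf \<and> \<not> solved (left (right z)) (left (right (right z))) (left (left z))))"
      by (intro decidable_conj decidable_not decidable_eq decidable_solved feasible_left feasible_right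
          feasible_Leaf'[OF idw] idw)
    show "feasible (\<lambda>z. (?D (right z) \<and> I (right z) (left z)) \<and>
        tt (left z \<noteq> Leaf \<and> \<not> solved (left (right z)) (left (right (right z))) (left (left z))) \<noteq> Leaf)
        (\<lambda>z. ?m (right z))
        (\<lambda>z. app (branches (left (right z)) (left (right (right z))) (left (left z))) (right (left z)))"
      by (rule feasible_restrict) (intro feasible_app feasible_branches feasible_left feasible_right idw)
  next
    fix a
    show "I a (Node (right (right a)) Leaf)"
      using nodes_right[of a] nodes_right[of "right a"] by (simp add: I_def)
    show "work (b a) (left a) (Node (right (right a)) Leaf) \<le> ?m a ^ 7"
      by (rule power_le[OF m(2) init]) simp
  next
    fix a st
    assume D: "?D a" and st: "I a st"
      "tt (st \<noteq> Leaf \<and> \<not> solved (left a) (left (right a)) (left st)) \<noteq> Leaf"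
    then obtain S t where S: "st = Node S t" "\<not> solved (left a) (left (right a)) S" by (cases st) auto
    let ?st = "app (branches (left a) (left (right a)) (left st)) (right st)"
    show less: "work (b a) (left a) ?st < work (b a) (left a) st"
      using work_branches[OF _ S(2), of "b a"] D length_branches[of "left a" "left (right a)" S] S(1)
      by (simp add: work_app) (simp add: work_def b_def)
    have "nodes C \<le> nodes a" if "C \<in> els ?st" for C
      using that st(1) S(1) part_branches[of C "left a" "left (right a)" S] unfolding I_def part_def by auto
    with less st(1) show "I a ?st" unfolding I_def by auto
  qed (use sz id in auto)
  then show ?thesis unfolding search_def .
qed

section \<open>Enumeration of all minimal transversals\<close>

definition drop_redundant :: "tree \<Rightarrow> tree \<Rightarrow> tree \<Rightarrow> tree" where
  "drop_redundant H x S = (if \<forall>E\<in>els H. hits (filt (\<lambda>y. y \<noteq> x) S) E then filt (\<lambda>y. y \<noteq> x) S else S)"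

definition minimize :: "tree \<Rightarrow> tree \<Rightarrow> tree" where
  "minimize H S = fold (\<lambda>x s. drop_redundant H x s) (tree_list S) S"

lemma nodes_drop_redundant: "nodes (drop_redundant H x S) \<le> nodes S"
  using nodes_filt_le by (simp add: drop_redundant_def)

lemma poly_minimize: "poly (\<lambda>a. minimize (left a) (right a))"
  unfolding minimize_def
proof (rule feasible_fold[where J = "\<lambda>a ys s. nodes s \<le> nodes a" and j = 1, OF poly_right poly_right poly_id])
  let ?J = "\<lambda>a (ys :: tree list) s. nodes s \<le> nodes a"
  have idf: "feasible (fold_dom (\<lambda>_. True) right ?J) (\<lambda>z. Suc (nodes (right z))) (\<lambda>z. z)"
    by (rule feasible_fold_id[OF poly_id poly_right, where j = 1]) simp
  have "poly (\<lambda>a. drop_redundant (left a) (left (right a)) (right (right a)))"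
    unfolding drop_redundant_def by (intro poly_intros decidable_hits)
  then show "feasible (fold_dom (\<lambda>_. True) right ?J) (\<lambda>z. Suc (nodes (right z)))
      (\<lambda>z. drop_redundant (left (right z)) (left (left z)) (right (left z)))"
    by (rule feasible_poly3) (intro feasible_left feasible_right idf)+
qed (auto intro: nodes_right order_trans[OF nodes_drop_redundant])

text \<open>One pass suffices: a vertex kept when it is tried has a private hyperedge at that
  moment, and the hyperedge stays private while the set shrinks, as long as the vertex is present
  and the set remains a transversal. In the induction \<open>A\<close> collects the vertices already
  tried.\<close>

lemma minimize_spec:
  assumes "\<And>E. E \<in> els H \<Longrightarrow> hits S E"
  shows "els (minimize H S) \<in> mintrans (els ` els H)" "part (minimize H S) S"
proof -
  let ?priv = "\<lambda>s x. \<exists>E\<in>els H. els E \<inter> els s = {x}"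
  have main: "(\<forall>E\<in>els H. hits r E) \<and> part r s \<and> (\<forall>x\<in>(A \<union> set xs) \<inter> els r. ?priv r x)"
    if "\<forall>E\<in>els H. hits s E" "\<forall>x\<in>A \<inter> els s. ?priv s x" "r = fold (drop_redundant H) xs s"
    for r s A xs
    using that
  proof (induction xs arbitrary: s A)
    case Nil
    then show ?case by (simp add: part_refl)
  next
    case (Cons y xs)
    define s' where "s' = drop_redundant H y s"
    have hit: "\<forall>E\<in>els H. hits s' E" using Cons.prems(1) by (simp add: s'_def drop_redundant_def)
    have part: "part s' s" by (auto simp: s'_def drop_redundant_def part_refl part_filt)
    then have sub: "els s' \<subseteq> els s" by (simp add: part_def)
    have priv: "?priv s' x" if "x \<in> els s'" "?priv s x" for x using that sub by blast
    have y: "?priv s' y" if "y \<in> els s'"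
    proof -
      have "s' = s" "\<not> (\<forall>E\<in>els H. hits (filt (\<lambda>z. z \<noteq> y) s) E)"
        using that by (auto simp: s'_def drop_redundant_def split: if_splits)
      then obtain E where E: "E \<in> els H" "els E \<inter> (els s - {y}) = {}" by (auto simp: hits_iff)
      moreover have "els E \<inter> els s \<noteq> {}" using Cons.prems(1) E(1) hits_iff by blast
      ultimately show ?thesis using \<open>s' = s\<close> by blast
    qed
    have "\<forall>x\<in>insert y A \<inter> els s'. ?priv s' x"
    proof
      fix x assume x: "x \<in> insert y A \<inter> els s'"
      show "?priv s' x"
      proof (cases "x = y")
        case True
        then show ?thesis using y x by auto
      next
        case False
        then have "x \<in> A \<inter> els s" using x sub by auto
        then have "?priv s x" using Cons.prems(2) by blast
        then show ?thesis using priv x by simp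
      qed
    qed
    from Cons.IH[OF hit this] Cons.prems(3)
    have "(\<forall>E\<in>els H. hits r E) \<and> part r s' \<and> (\<forall>x\<in>(insert y A \<union> set xs) \<inter> els r. ?priv r x)"
      by (simp add: s'_def)
    then show ?case using part_trans[OF _ part] by auto
  qed
  have r: "(\<forall>E\<in>els H. hits (minimize H S) E) \<and> part (minimize H S) S \<and>
      (\<forall>x\<in>({} \<union> els S) \<inter> els (minimize H S). ?priv (minimize H S) x)"
    by (rule main) (use assms in \<open>auto simp: minimize_def\<close>)
  then show "els (minimize H S) \<in> mintrans (els ` els H)"
    unfolding mintrans_def hits_iff part_def by auto
  show "part (minimize H S) S" using r by blast
qed

definition mtrans :: "tree \<Rightarrow> tree \<Rightarrow> tree" where
  "mtrans H V = while (\<lambda>G. search G H V \<noteq> Leaf)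
     (\<lambda>G. Node (minimize H (majority G (left (search G H V)))) G) Leaf"

definition found :: "tree \<Rightarrow> tree \<Rightarrow> tree \<Rightarrow> bool" where
  "found H V G \<longleftrightarrow> (\<forall>Y\<in>els G. els Y \<in> mintrans (els ` els H) \<and> part Y V) \<and>
     distinct (map els (tree_list G))"

lemma finite_mintrans:
  assumes "finite (\<Union>H)"
  shows "finite (mintrans H)"
proof (rule finite_subset)
  show "mintrans H \<subseteq> Pow (\<Union>H)" using mintrans_subset by blast
qed (use assms in auto)

lemma length_found:
  assumes "found H V G"
  shows "length (tree_list G) \<le> card (mintrans (els ` els H))"
proof -
  have "length (tree_list G) = card (els ` els G)"
    using assms distinct_card[of "map els (tree_list G)"] by (simp add: found_def)
  also have "\<dots> \<le> card (mintrans (els ` els H))"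
    using assms by (intro card_mono finite_mintrans) (auto simp: found_def)
  finally show ?thesis .
qed

text \<open>The reduced set lies inside the majority set, which contains none of the known sets;
  hence it is new.\<close>

lemma found_step:
  assumes V: "\<And>E. E \<in> els H \<Longrightarrow> els E \<subseteq> els V" and G: "found H V G" and ne: "search G H V \<noteq> Leaf"
  shows "found H V (Node (minimize H (majority G (left (search G H V)))) G)"
proof -
  let ?I = "majority G (left (search G H V))"
  have "\<And>Y. Y \<in> els G \<Longrightarrow> els Y \<in> mintrans (els ` els H)" using G by (simp add: found_def)
  from search_spec(2)[OF this V ne]
  have I: "\<And>E. E \<in> els H \<Longrightarrow> hits ?I E" "\<forall>Y\<in>els G. \<not> els Y \<subseteq> els ?I" "part ?I V" by auto
  note m = minimize_spec[OF I(1)]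
  have "els (minimize H ?I) \<notin> els ` els G" using I(2) m(2) by (auto simp: part_def)
  then show ?thesis using G m part_trans[OF m(2) I(3)] by (simp add: found_def)
qed

lemma mtrans_spec:
  assumes V: "\<And>E. E \<in> els H \<Longrightarrow> els E \<subseteq> els V"
  shows "els ` els (mtrans H V) = mintrans (els ` els H)" "found H V (mtrans H V)"
proof -
  have "found H V (mtrans H V) \<and> \<not> search (mtrans H V) H V \<noteq> Leaf"
    unfolding mtrans_def
  proof (rule while_inv[where \<mu> = "\<lambda>G. card (mintrans (els ` els H)) - length (tree_list G)"])
    show "found H V Leaf" by (simp add: found_def)
    fix G assume G: "found H V G" "search G H V \<noteq> Leaf"
    show "found H V (Node (minimize H (majority G (left (search G H V)))) G) \<and>
       card (mintrans (els ` els H)) - length (tree_list (Node (minimize H (majority G (left (search G H V)))) G))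
       < card (mintrans (els ` els H)) - length (tree_list G)"
      using found_step[OF V G] length_found[OF found_step[OF V G]] by simp
  qed
  then show f: "found H V (mtrans H V)" and "els ` els (mtrans H V) = mintrans (els ` els H)"
    using search_spec(1)[of "mtrans H V" H V, OF _ V] by (auto simp: found_def)
qed

text \<open>The list found so far is part of the argument of each search, so the measure has to grow
  with the number of minimal transversals. The product of input size and that number dominates every
  such list; the search argument is then at most its fourth power, which \<open>qpoly_power\<close>
  absorbs.\<close>

lemma feasible_mtrans:
  "feasible (\<lambda>a. \<forall>E\<in>els (left a). els E \<subseteq> els (right a))
     (\<lambda>a. qpoly (Suc (nodes a) * Suc (card (mintrans (els ` els (left a))))))
     (\<lambda>a. mtrans (left a) (right a))"
proof -
  let ?D = "\<lambda>a. \<forall>E\<in>els (left a). els E \<subseteq> els (right a)"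
  define M where "M a = card (mintrans (els ` els (left a)))" for a
  define Z where "Z a = Suc (nodes a) * Suc (M a)" for a
  let ?m = "\<lambda>a. qpoly (Z a)"
  have Z: "Suc (nodes a) \<le> Z a" "2 \<le> Z a" "M a \<le> Z a" for a
    using Suc_nodes_ge2[of a] by (auto simp: Z_def)
  have Zm: "Z a \<le> ?m a" for a using qpoly_ge Z(2)[of a] by simp
  have m2: "2 \<le> ?m a" for a using Zm[of a] Z(2)[of a] by simp
  have id: "feasible ?D ?m (\<lambda>a. a)"
  proof (rule feasible_id[where k = 1])
    fix a show "nodes a \<le> ?m a ^ 1" using Z(1)[of a] Zm[of a] by simp
  qed (rule m2)
  have szZ: "nodes G \<le> Z a" if "found (left a) (right a) G" for a G
  proof -
    have "nodes G \<le> length (tree_list G) * Suc (nodes (right a)) + 1"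
      using that by (intro nodes_list_le) (auto simp: found_def part_def)
    also have "\<dots> \<le> M a * Suc (nodes a) + 1"
      using length_found[OF that] nodes_right[of a] unfolding M_def by (intro add_mono mult_mono) auto
    also have "\<dots> \<le> Z a" by (simp add: Z_def)
    finally show ?thesis .
  qed
  have sz: "nodes G \<le> ?m a ^ 1" if "found (left a) (right a) G" for a G
    using szZ[OF that] Zm[of a] by simp
  let ?E = "\<lambda>z. ?D (right z) \<and> found (left (right z)) (right (right z)) (left z)"
  have idw: "feasible ?E (\<lambda>z. ?m (right z)) (\<lambda>z. z)"
    by (rule feasible_pair_id[OF id sz])
  have "feasible ?E (\<lambda>z. ?m (right z))
     (\<lambda>z. (\<lambda>a. search (left a) (left (right a)) (right (right a)))
        (Node (left z) (Node (left (right z)) (right (right z)))))"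
  proof (rule feasible_comp[OF _ feasible_search])
    fix z assume z: "?E z"
    let ?y = "Node (left z) (Node (left (right z)) (right (right z)))"
    show "\<forall>Y\<in>els (left ?y). \<forall>E\<in>els (left (right ?y)). hits Y E"
      using z unfolding found_def mintrans_def hits_iff by fastforce
    have "Suc (nodes ?y) \<le> Z (right z) ^ 4"
    proof -
      let ?a = "right z"
      have a: "nodes (left ?a) \<le> Z ?a ^ 1" "nodes (right ?a) \<le> Z ?a ^ 1"
        using nodes_left[of ?a] nodes_right[of ?a] Z(1)[of ?a] by simp_all
      have G: "nodes (left z) \<le> Z ?a ^ 1" using szZ z by simp
      have "nodes (Node (left ?a) (right ?a)) + 1 \<le> Z ?a ^ 3" "nodes (left z) \<le> Z ?a ^ 2"
      proof -
        obtain y where y: "Z ?a = y" "2 \<le> y" using Z(2) by blast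
        have "nodes (left ?a) + nodes (right ?a) + 2 \<le> 3 * y" using a y by simp
        also have "\<dots> \<le> y * y * y" using mult_mono[OF y(2) y(2)] y(2) by simp
        finally show "nodes (Node (left ?a) (right ?a)) + 1 \<le> Z ?a ^ 3"
          by (simp add: y(1) power3_eq_cube)
        show "nodes (left z) \<le> Z ?a ^ 2" by (rule power_le[OF Z(2) G]) simp
      qed
      then have "Suc (nodes ?y) \<le> Z ?a ^ 2 + Z ?a ^ 3 + 1" by simp
      also have "\<dots> \<le> Z ?a ^ 4"
      proof -
        obtain y where y: "Z ?a = y" "2 \<le> y" using Z(2) by blast
        have "y ^ 2 + y ^ 3 + 1 \<le> 2 * y ^ 3"
        proof -
          have "2 * y ^ 2 \<le> y * y ^ 2" using y(2) by (rule mult_right_mono) simp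
          moreover have "1 \<le> y ^ 2" using y(2) by simp
          moreover have "y ^ 3 = y * y ^ 2" by (simp add: eval_nat_numeral)
          ultimately show ?thesis by linarith
        qed
        also have "\<dots> \<le> y * y ^ 3" using y(2) by (rule mult_right_mono) simp
        also have "\<dots> = y ^ 4" by (simp add: eval_nat_numeral)
        finally show ?thesis unfolding y(1) .
      qed
      finally show ?thesis .
    qed
    then show "qpoly (Suc (nodes ?y)) \<le> ?m (right z) ^ (4 * (4 + 1))"
      by (intro qpoly_power Z(2)) simp_all
  qed (intro feasible_Node feasible_left feasible_right idw)
  then have s: "feasible ?E (\<lambda>z. ?m (right z))
     (\<lambda>z. search (left z) (left (right z)) (right (right z)))" by simp
  have "feasible ?D ?m (\<lambda>a. while (\<lambda>G. search G (left a) (right a) \<noteq> Leaf)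
     (\<lambda>G. Node (minimize (left a) (majority G (left (search G (left a) (right a))))) G) Leaf)"
  proof (rule feasible_while[where I = "\<lambda>a G. found (left a) (right a) G" and j = 1 and
        \<mu> = "\<lambda>a G. M a - length (tree_list G)"])
    show "feasible (\<lambda>z. ?E z \<and> search (left z) (left (right z)) (right (right z)) \<noteq> Leaf) (\<lambda>z. ?m (right z))
        (\<lambda>z. Node (minimize (left (right z))
          (majority (left z) (left (search (left z) (left (right z)) (right (right z)))))) (left z))"
      by (rule feasible_restrict)
        (intro feasible_Node feasible_poly2[OF poly_minimize] feasible_majority feasible_left feasible_right idw s)
  next
    fix a G assume D: "?D a" and G: "found (left a) (right a) G" "search G (left a) (right a) \<noteq> Leaf"
    have V: "\<And>E. E \<in> els (left a) \<Longrightarrow> els E \<subseteq> els (right a)" using D by blast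
    show "found (left a) (right a) (Node (minimize (left a) (majority G (left (search G (left a) (right a))))) G)"
      by (rule found_step[OF V G])
    from length_found[OF this]
    show "M a - length (tree_list (Node (minimize (left a) (majority G (left (search G (left a) (right a))))) G))
       < M a - length (tree_list G)" by (simp add: M_def)
  next
    fix a show "M a - length (tree_list Leaf) \<le> ?m a ^ 1" using Z(3)[of a] Zm[of a] by simp
  qed (use s sz in \<open>auto simp: found_def intro: feasible_Leaf'[OF id] id\<close>)
  then show ?thesis unfolding mtrans_def Z_def M_def .
qed

subsection \<open>Meet-irreducible elements of a layered base\<close>

text \<open>The union of all hyperedges is a transversal, so by finiteness there is one minimal
  under inclusion; a vertex without a private hyperedge could be removed from it.\<close>

lemma mintrans_nonempty:
  assumes "finite (\<Union>H)" "{} \<notin> H"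
  shows "mintrans H \<noteq> {}"
proof -
  let ?T = "{X. X \<subseteq> \<Union>H \<and> (\<forall>E\<in>H. E \<inter> X \<noteq> {})}"
  have "finite ?T" using assms(1) by simp
  moreover have "E \<inter> \<Union>H \<noteq> {}" if "E \<in> H" for E
    using that assms(2) Union_upper[OF that] by (cases "E = {}") auto
  then have "\<Union>H \<in> ?T" by blast
  ultimately have "\<exists>X\<in>?T. \<forall>Y\<in>?T. Y \<le> X \<longrightarrow> X = Y" by (intro finite_has_minimal) auto
  then obtain X where "X \<in> ?T" and min: "\<forall>Y\<in>?T. Y \<le> X \<longrightarrow> X = Y" by (rule bexE)
  then have X: "X \<subseteq> \<Union>H" "\<forall>E\<in>H. E \<inter> X \<noteq> {}" by simp_all
  have "\<exists>E\<in>H. E \<inter> X = {x}" if "x \<in> X" for x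
  proof -
    have "X - {x} \<notin> ?T"
    proof
      assume "X - {x} \<in> ?T"
      from bspec[OF min this] have "X = X - {x}" by auto
      then show False using that by blast
    qed
    then obtain E where "E \<in> H" "E \<inter> (X - {x}) = {}" using X(1) by auto
    moreover have "E \<inter> X \<noteq> {}" using X(2) \<open>E \<in> H\<close> by simp
    ultimately show ?thesis by blast
  qed
  then have "X \<in> mintrans H" using X(2) unfolding mintrans_def by simp
  then show ?thesis by blast
qed

text \<open>
  The complement \<open>T\<close> of a meet-irreducible element is built from the last layer backwards, i.e. by
  increasing \<open>lev\<close>, starting from the only element \<open>a\<close> of \<open>T\<close> of least level.
\<close>

locale layered =
  fixes U :: "'a set" and \<Sigma> :: "'a implication set" and lev :: "'a \<Rightarrow> nat"
  assumes finite_U: "finite U"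
    and base: "implicational_base U \<Sigma>"
    and lev_same: "(A, b) \<in> \<Sigma> \<Longrightarrow> x \<in> A \<Longrightarrow> y \<in> A \<Longrightarrow> lev x = lev y"
    and lev_less: "(A, b) \<in> \<Sigma> \<Longrightarrow> x \<in> A \<Longrightarrow> lev b < lev x"
    and lev_pos: "x \<in> U \<Longrightarrow> 1 \<le> lev x"
    and lev_le: "x \<in> U \<Longrightarrow> lev x \<le> card U"
begin

text \<open>The apex \<open>a\<close> belongs to \<open>T\<close> from the start, whatever its
  level; until \<open>n\<close> reaches that level \<open>T\<close> is just \<open>{a}\<close>. The
  second condition concerns only premises whose level has been decided, and for
  \<open>n = card U\<close> it covers all premises.\<close>

definition good :: "nat \<Rightarrow> 'a \<Rightarrow> 'a set \<Rightarrow> bool" where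
  "good n a T \<longleftrightarrow> a \<in> T \<and> a \<in> U \<and> T \<subseteq> insert a {x \<in> U. lev x \<le> n} \<and>
     (\<forall>(A, b)\<in>\<Sigma>. b \<in> T \<longrightarrow> (\<forall>x\<in>A. lev x \<le> n) \<longrightarrow> A \<inter> T \<noteq> {}) \<and>
     (\<forall>x\<in>T - {a}. \<exists>(A, b)\<in>\<Sigma>. b \<in> T \<and> A \<inter> T = {x})"

definition hyp :: "nat \<Rightarrow> 'a set \<Rightarrow> 'a set set" where
  "hyp n P = {A. \<exists>b. (A, b) \<in> \<Sigma> \<and> b \<in> P \<and> (\<forall>x\<in>A. lev x = Suc n)}"

definition goods :: "nat \<Rightarrow> 'a set set" where
  "goods n = {T. \<exists>a. good n a T}"

lemma baseD: "(A, b) \<in> \<Sigma> \<Longrightarrow> A \<noteq> {} \<and> A \<subseteq> U \<and> b \<in> U"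
  using base unfolding implicational_base_def by blast

lemma good_hits: "good n a T \<Longrightarrow> (A, b) \<in> \<Sigma> \<Longrightarrow> b \<in> T \<Longrightarrow> (\<And>x. x \<in> A \<Longrightarrow> lev x \<le> n) \<Longrightarrow> A \<inter> T \<noteq> {}"
  unfolding good_def by blast

lemma good_private:
  assumes "good n a T" "x \<in> T" "x \<noteq> a"
  obtains A b where "(A, b) \<in> \<Sigma>" "b \<in> T" "A \<inter> T = {x}"
  using assms unfolding good_def by blast

lemma good_subset: "good n a T \<Longrightarrow> x \<in> T \<Longrightarrow> x = a \<or> lev x \<le> n"
  unfolding good_def by blast

lemma good_in_U: "good n a T \<Longrightarrow> T \<subseteq> U"
  unfolding good_def by blast

lemma good_apex: "good n a T \<Longrightarrow> a \<in> T"
  unfolding good_def by blast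

text \<open>The private premise of \<open>x\<close> has its conclusion in \<open>T\<close> and on a
  smaller level. Repeating this descends strictly and can stop only at the apex, which is therefore
  determined by \<open>T\<close>.\<close>

lemma good_lev:
  assumes "good n a T" "x \<in> T" "x \<noteq> a"
  shows "lev a < lev x"
  using assms(2,3)
proof (induction "lev x" arbitrary: x rule: less_induct)
  case less
  obtain A b where A: "(A, b) \<in> \<Sigma>" "b \<in> T" "A \<inter> T = {x}"
    using good_private[OF assms(1) less.prems] .
  then have "lev b < lev x" using lev_less by blast
  then show ?case using less.hyps[of b] A(2) by (cases "b = a") auto
qed

lemma good_unique:
  assumes "good n a T" "good m a' T"
  shows "a = a'"
  using good_lev[OF assms(1) good_apex[OF assms(2)]] good_lev[OF assms(2) good_apex[OF assms(1)]]
  by (cases "a = a'") auto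

lemma hyp_lev:
  assumes "good n a P" "X \<in> mintrans (hyp n P)" "x \<in> X"
  shows "lev x = Suc n" "x \<in> U" "lev a < lev x"
proof -
  obtain A b where A: "(A, b) \<in> \<Sigma>" "b \<in> P" "\<forall>x\<in>A. lev x = Suc n" "x \<in> A"
    using mintrans_subset[OF assms(2)] assms(3) unfolding hyp_def by blast
  then show "lev x = Suc n" "x \<in> U" using baseD by blast+
  have "lev a \<le> lev b" using good_lev[OF assms(1) A(2)] by (cases "b = a") auto
  then show "lev a < lev x" using lev_less[OF A(1,4)] by simp
qed

lemma hyp_disjoint:
  assumes "good n a P" "X \<in> mintrans (hyp n P)"
  shows "X \<inter> insert a {x. lev x \<le> n} = {}"
  using hyp_lev(1,3)[OF assms] by (auto simp: disjoint_iff)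

text \<open>Layers do not interfere. A premise lies in a single level, so the new elements do not
  affect private premises of the old ones. A new element brings no demand at levels up to
  \<open>Suc n\<close>, since premises concluding it lie on higher levels.\<close>

lemma good_extend:
  assumes P: "good n a P" and X: "X \<in> mintrans (hyp n P)"
  shows "good (Suc n) a (P \<union> X)"
  unfolding good_def
proof (intro conjI)
  show "a \<in> P \<union> X" "a \<in> U" using P unfolding good_def by auto
  show "P \<union> X \<subseteq> insert a {x \<in> U. lev x \<le> Suc n}"
    using hyp_lev[OF P X] good_subset[OF P] good_in_U[OF P] by fastforce
  show "\<forall>(A, b)\<in>\<Sigma>. b \<in> P \<union> X \<longrightarrow> (\<forall>x\<in>A. lev x \<le> Suc n) \<longrightarrow> A \<inter> (P \<union> X) \<noteq> {}"
  proof clarify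
    fix A b assume A: "(A, b) \<in> \<Sigma>" "b \<in> P \<union> X" "\<forall>x\<in>A. lev x \<le> Suc n" "A \<inter> (P \<union> X) = {}"
    obtain y where y: "y \<in> A" using baseD[OF A(1)] by blast
    have "lev b \<le> n" using lev_less[OF A(1) y] A(3) y by fastforce
    then have b: "b \<in> P" using A(2) hyp_lev(1)[OF P X] by fastforce
    show False
    proof (cases "lev y \<le> n")
      case True
      then have "lev x \<le> n" if "x \<in> A" for x using lev_same[OF A(1) y that] by simp
      then have "A \<inter> P \<noteq> {}" by (rule good_hits[OF P A(1) b])
      then show ?thesis using A(4) by blast
    next
      case False
      then have "lev y = Suc n" using A(3) y by fastforce
      then have "A \<in> hyp n P" unfolding hyp_def using A(1) b lev_same[OF A(1) y] by auto
      then show ?thesis using X A(4) unfolding mintrans_def by blast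
    qed
  qed
  show "\<forall>x\<in>P \<union> X - {a}. \<exists>(A, b)\<in>\<Sigma>. b \<in> P \<union> X \<and> A \<inter> (P \<union> X) = {x}"
  proof
    fix x assume x: "x \<in> P \<union> X - {a}"
    show "\<exists>(A, b)\<in>\<Sigma>. b \<in> P \<union> X \<and> A \<inter> (P \<union> X) = {x}"
    proof (cases "x \<in> P")
      case True
      then obtain A b where A: "(A, b) \<in> \<Sigma>" "b \<in> P" "A \<inter> P = {x}" using good_private[OF P] x by blast
      have "lev x \<le> n" using good_subset[OF P True] x by blast
      then have "A \<inter> X = {}" using lev_same[OF A(1)] A(3) hyp_lev(1)[OF P X] by fastforce
      then have "A \<inter> (P \<union> X) = {x}" using A(3) by blast
      then show ?thesis using A by blast
    next
      case False
      then have "x \<in> X" using x by blast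
      then obtain A b where A: "(A, b) \<in> \<Sigma>" "b \<in> P" "\<forall>y\<in>A. lev y = Suc n" "A \<inter> X = {x}"
        using X unfolding mintrans_def hyp_def by blast
      \<comment> \<open>The apex is the one element of \<open>P\<close> that may have level above
        \<open>n\<close>, so it has to be kept out of \<open>A\<close> separately: its level is at
        most that of the conclusion \<open>b\<close>.\<close>
      have "lev a \<le> lev b" using good_lev[OF P A(2)] by (cases "b = a") auto
      then have "a \<notin> A" using lev_less[OF A(1)] by fastforce
      then have "A \<inter> P = {}" using A(3) good_subset[OF P] by fastforce
      then have "A \<inter> (P \<union> X) = {x}" using A(4) by blast
      then show ?thesis using A by blast
    qed
  qed
qed

text \<open>Truncation loses nothing relevant to the lower levels: the conclusion of a private
  premise lies below the element it justifies, so it survives whenever the element does. For an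
  element of level \<open>Suc n\<close> it lies in \<open>P\<close>, which makes the premise a
  hyperedge of \<open>hyp n P\<close>.\<close>

lemma good_restrict:
  assumes T: "good (Suc n) a T"
  defines "P \<equiv> T \<inter> insert a {x. lev x \<le> n}"
  shows "good n a P" "T - P \<in> mintrans (hyp n P)"
proof -
  have PT: "P \<subseteq> T" "a \<in> P" using good_apex[OF T] by (auto simp: P_def)
  show "good n a P"
    unfolding good_def
  proof (intro conjI)
    show "a \<in> P" "a \<in> U" using PT T unfolding good_def by auto
    show "P \<subseteq> insert a {x \<in> U. lev x \<le> n}" using good_in_U[OF T] by (auto simp: P_def)
    show "\<forall>(A, b)\<in>\<Sigma>. b \<in> P \<longrightarrow> (\<forall>x\<in>A. lev x \<le> n) \<longrightarrow> A \<inter> P \<noteq> {}"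
    proof clarify
      fix A b assume A: "(A, b) \<in> \<Sigma>" "b \<in> P" "\<forall>x\<in>A. lev x \<le> n" "A \<inter> P = {}"
      then have "A \<inter> T \<noteq> {}" using good_hits[OF T A(1)] PT by fastforce
      then show False using A(3,4) by (auto simp: P_def)
    qed
    show "\<forall>x\<in>P - {a}. \<exists>(A, b)\<in>\<Sigma>. b \<in> P \<and> A \<inter> P = {x}"
    proof
      fix x assume x: "x \<in> P - {a}"
      then obtain A b where A: "(A, b) \<in> \<Sigma>" "b \<in> T" "A \<inter> T = {x}" using good_private[OF T] PT by blast
      have "lev b < lev x" "lev x \<le> n" using lev_less[OF A(1)] A(3) x by (auto simp: P_def)
      then have "b \<in> P" using A(2) by (simp add: P_def)
      moreover have "A \<inter> P = {x}" using A(3) PT x by blast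
      ultimately show "\<exists>(A, b)\<in>\<Sigma>. b \<in> P \<and> A \<inter> P = {x}" using A(1) by blast
    qed
  qed
  have lv: "lev x = Suc n" if "x \<in> T - P" for x
    using that good_subset[OF T] by (fastforce simp: P_def)
  show "T - P \<in> mintrans (hyp n P)"
    unfolding mintrans_def
  proof (intro CollectI conjI ballI)
    fix A assume "A \<in> hyp n P"
    then obtain b where A: "(A, b) \<in> \<Sigma>" "b \<in> P" "\<forall>x\<in>A. lev x = Suc n" unfolding hyp_def by blast
    then obtain y where y: "y \<in> A" "y \<in> T" using good_hits[OF T A(1)] PT by fastforce
    have "lev a \<le> lev b" using good_lev[OF T, of b] A(2) PT by (cases "b = a") auto
    then have "y \<noteq> a" using lev_less[OF A(1) y(1)] by auto
    then show "A \<inter> (T - P) \<noteq> {}" using y A(3) by (auto simp: P_def)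
  next
    fix x assume x: "x \<in> T - P"
    then obtain A b where A: "(A, b) \<in> \<Sigma>" "b \<in> T" "A \<inter> T = {x}" using good_private[OF T, of x] PT by blast
    have l: "\<forall>y\<in>A. lev y = Suc n" 
    proof
      fix y assume "y \<in> A"
      moreover have "x \<in> A" using A(3) by blast
      ultimately show "lev y = Suc n" using lev_same[OF A(1), of y x] lv[OF x] by simp
    qed
    have "lev b < lev x" using lev_less[OF A(1)] A(3) by blast
    then have "b \<in> P" using A(2) lv[OF x] by (simp add: P_def)
    then have "A \<in> hyp n P" using A(1) l unfolding hyp_def by blast
    moreover have "A \<inter> (T - P) = {x}" using A(3) x by blast
    ultimately show "\<exists>A\<in>hyp n P. A \<inter> (T - P) = {x}" by blast
  qed
qed

lemma goods_Suc: "goods (Suc n) = {P \<union> X | P X. P \<in> goods n \<and> X \<in> mintrans (hyp n P)}"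
proof (intro equalityI subsetI)
  fix T assume "T \<in> goods (Suc n)"
  then obtain a where a: "good (Suc n) a T" unfolding goods_def by blast
  let ?P = "T \<inter> insert a {x. lev x \<le> n}"
  have "T = ?P \<union> (T - ?P)" by blast
  then show "T \<in> {P \<union> X | P X. P \<in> goods n \<and> X \<in> mintrans (hyp n P)}"
    using good_restrict[OF a] unfolding goods_def by blast
qed (auto simp: goods_def intro: good_extend)

lemma goods_0: "goods 0 = {{a} | a. a \<in> U}"
proof -
  have "good 0 a T \<longleftrightarrow> T = {a} \<and> a \<in> U" for a T
  proof
    assume g: "good 0 a T"
    have "x = a" if "x \<in> T" for x
      using good_subset[OF g that] lev_pos[of x] good_in_U[OF g] that by auto
    then show "T = {a} \<and> a \<in> U" using g unfolding good_def by blast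
  next
    assume "T = {a} \<and> a \<in> U"
    moreover have False if "(A, b) \<in> \<Sigma>" "\<forall>x\<in>A. lev x \<le> 0" for A b
      using baseD[OF that(1)] that(2) lev_pos by fastforce
    ultimately show "good 0 a T" unfolding good_def by blast
  qed
  then show ?thesis unfolding goods_def by blast
qed

text \<open>The union determines the apex, and then \<open>P\<close> as its part of level at most
  \<open>n\<close> together with the apex. So no set is produced twice, neither from different
  partial sets nor from different transversals.\<close>

lemma good_union_inject:
  assumes "P \<in> goods n" "X \<in> mintrans (hyp n P)" "P' \<in> goods n" "X' \<in> mintrans (hyp n P')"
    and eq: "P \<union> X = P' \<union> X'"
  shows "P = P'" "X = X'"
proof -
  obtain a a' where a: "good n a P" "good n a' P'" using assms(1,3) unfolding goods_def by blast
  have "a = a'" using good_unique[OF good_extend[OF a(1) assms(2)]] good_extend[OF a(2) assms(4)] eq by simp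
  moreover have "P = (P \<union> X) \<inter> insert a {x. lev x \<le> n}"
    using hyp_disjoint[OF a(1) assms(2)] good_subset[OF a(1)] by blast
  moreover have "P' = (P' \<union> X') \<inter> insert a' {x. lev x \<le> n}"
    using hyp_disjoint[OF a(2) assms(4)] good_subset[OF a(2)] by blast
  ultimately show "P = P'" using eq by simp
  moreover have "P \<inter> X = {}" "P' \<inter> X' = {}"
    using hyp_disjoint[OF a(1) assms(2)] hyp_disjoint[OF a(2) assms(4)]
      good_subset[OF a(1)] good_subset[OF a(2)] by blast+
  ultimately show "X = X'" using eq by blast
qed

lemma finite_goods: "finite (goods n)"
  by (rule finite_subset[of _ "Pow U"]) (use good_in_U finite_U in \<open>auto simp: goods_def\<close>)

text \<open>No partial choice is a dead end: premises are nonempty, so a minimal transversal exists.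
  The monotone growth of the families depends on this.\<close>

lemma hyp_nonempty: "mintrans (hyp n P) \<noteq> {}"
proof (rule mintrans_nonempty)
  show "finite (\<Union>(hyp n P))"
    by (rule finite_subset[OF _ finite_U]) (use baseD in \<open>auto simp: hyp_def\<close>)
  show "{} \<notin> hyp n P" using baseD by (auto simp: hyp_def)
qed

lemma card_goods_Suc: "card (goods n) \<le> card (goods (Suc n))"
proof -
  define e where "e P = (SOME X. X \<in> mintrans (hyp n P))" for P
  have e: "e P \<in> mintrans (hyp n P)" for P
  proof -
    have "\<exists>X. X \<in> mintrans (hyp n P)" using hyp_nonempty by blast
    then show ?thesis unfolding e_def by (rule someI_ex)
  qed
  show ?thesis
  proof (rule card_inj_on_le[where f = "\<lambda>P. P \<union> e P"])
    show "inj_on (\<lambda>P. P \<union> e P) (goods n)"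
      by (rule inj_onI) (rule good_union_inject(1)[OF _ e _ e])
    show "(\<lambda>P. P \<union> e P) ` goods n \<subseteq> goods (Suc n)" using e unfolding goods_Suc by blast
  qed (rule finite_goods)
qed

lemma card_goods_mono: "n \<le> m \<Longrightarrow> card (goods n) \<le> card (goods m)"
  by (rule lift_Suc_mono_le[of "\<lambda>n. card (goods n)"]) (rule card_goods_Suc)

text \<open>Bounds the number of transversals in a single extension step, and so the measure in
  \<open>feasible_mtrans\<close>, by the next family and finally by the output.\<close>

lemma card_mintrans_le:
  assumes "P \<in> goods n"
  shows "card (mintrans (hyp n P)) \<le> card (goods (Suc n))"
proof (rule card_inj_on_le[where f = "\<lambda>X. P \<union> X"])
  show "inj_on (\<lambda>X. P \<union> X) (mintrans (hyp n P))"
    by (rule inj_onI) (rule good_union_inject(2)[OF assms _ assms])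
  show "(\<lambda>X. P \<union> X) ` mintrans (hyp n P) \<subseteq> goods (Suc n)" using assms unfolding goods_Suc by blast
qed (rule finite_goods)

text \<open>All elements of a private premise of \<open>x\<close> other than \<open>x\<close> are in
  \<open>U - T\<close>, so a closed set containing \<open>U - T\<close> and \<open>x\<close>
  contains its conclusion, an element of \<open>T\<close> on a smaller level.\<close>

lemma good_closed_apex:
  assumes T: "good (card U) a T" and C: "C \<in> closure_system U \<Sigma>" "U - T \<subseteq> C" "x \<in> C" "x \<in> T"
  shows "a \<in> C"
  using C(3,4)
proof (induction "lev x" arbitrary: x rule: less_induct)
  case less
  show ?case
  proof (cases "x = a")
    case False
    then obtain A b where A: "(A, b) \<in> \<Sigma>" "b \<in> T" "A \<inter> T = {x}"
      using good_private[OF T less.prems(2)] by blast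
    have "A \<subseteq> insert x (U - T)" using baseD[OF A(1)] A(3) by blast
    then have "A \<subseteq> C" using C(2) less.prems(1) by blast
    then have "b \<in> C" using C(1) A(1) unfolding closure_system_def satisfies_def by blast
    moreover have "lev b < lev x" using lev_less[OF A(1)] A(3) by blast
    ultimately show ?thesis using less.hyps A(2) by blast
  qed (use less in simp)
qed

text \<open>For a meet-irreducible \<open>M\<close>, let \<open>a\<close> be of least level outside
  \<open>M\<close>. Then \<open>insert a M\<close> is closed: an implication fired by
  \<open>a\<close> would have a conclusion outside \<open>M\<close> on a still smaller level. If
  \<open>insert x M\<close> were closed for another \<open>x\<close>, the two would intersect in
  \<open>M\<close>; hence an implication fails there, and its premise is private to
  \<open>x\<close>. Conversely, closed proper supersets of \<open>M\<close> all contain the apex, so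
  two of them cannot intersect in \<open>M\<close>.\<close>

lemma meet_irreducibles_goods: "meet_irreducibles U \<Sigma> = (\<lambda>T. U - T) ` goods (card U)"
proof (intro equalityI subsetI)
  fix M assume "M \<in> meet_irreducibles U \<Sigma>"
  then have M: "M \<subseteq> U" "M \<noteq> U" "\<And>A b. (A, b) \<in> \<Sigma> \<Longrightarrow> A \<subseteq> M \<Longrightarrow> b \<in> M"
    and irr: "\<And>C C'. C \<in> closure_system U \<Sigma> \<Longrightarrow> C' \<in> closure_system U \<Sigma> \<Longrightarrow> M = C \<inter> C' \<Longrightarrow> M = C \<or> M = C'"
    unfolding meet_irreducibles_def closure_system_def satisfies_def by auto
  define T where "T = U - M"
  have "T \<noteq> {}" "finite T" using M finite_U by (auto simp: T_def)
  then obtain a where a: "a \<in> T" "\<And>x. x \<in> T \<Longrightarrow> lev a \<le> lev x"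
    using arg_min_if_finite[of T lev] linorder_not_less by blast
  have "good (card U) a T"
    unfolding good_def
  proof (intro conjI)
    show "a \<in> T" "a \<in> U" using a by (auto simp: T_def)
    show "T \<subseteq> insert a {x \<in> U. lev x \<le> card U}" using lev_le by (auto simp: T_def)
    show "\<forall>(A, b)\<in>\<Sigma>. b \<in> T \<longrightarrow> (\<forall>x\<in>A. lev x \<le> card U) \<longrightarrow> A \<inter> T \<noteq> {}"
      using M(3) baseD by (fastforce simp: T_def)
    show "\<forall>x\<in>T - {a}. \<exists>(A, b)\<in>\<Sigma>. b \<in> T \<and> A \<inter> T = {x}"
    proof
      fix x assume x: "x \<in> T - {a}"
      have "insert a M \<in> closure_system U \<Sigma>"
      proof -
        have "b \<in> insert a M" if A: "(A, b) \<in> \<Sigma>" "A \<subseteq> insert a M" for A b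
        proof (rule ccontr)
          assume b: "b \<notin> insert a M"
          then have "a \<in> A" using M(3)[OF A(1)] A(2) by blast
          then have "lev b < lev a" using lev_less A(1) by blast
          moreover have "b \<in> T" using b baseD[OF A(1)] by (simp add: T_def)
          ultimately show False using a(2) by fastforce
        qed
        then show ?thesis using M(1) a(1) unfolding closure_system_def satisfies_def T_def by auto
      qed
      moreover have "M = insert a M \<inter> insert x M" using x by blast
      moreover have "M \<noteq> insert a M" "M \<noteq> insert x M" using a(1) x by (auto simp: T_def)
      ultimately have "insert x M \<notin> closure_system U \<Sigma>" using irr by blast
      then obtain A b where A: "(A, b) \<in> \<Sigma>" "A \<subseteq> insert x M" "b \<notin> insert x M"
        using M(1) x unfolding closure_system_def satisfies_def T_def by auto
      then have "x \<in> A" using M(3) by blast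
      then have "A \<inter> T = {x}" "b \<in> T" using A x baseD[OF A(1)] by (auto simp: T_def)
      then show "\<exists>(A, b)\<in>\<Sigma>. b \<in> T \<and> A \<inter> T = {x}" using A(1) by blast
    qed
  qed
  moreover have "M = U - T" using M(1) by (auto simp: T_def)
  ultimately show "M \<in> (\<lambda>T. U - T) ` goods (card U)" unfolding goods_def by blast
next
  fix M assume "M \<in> (\<lambda>T. U - T) ` goods (card U)"
  then obtain a T where T: "good (card U) a T" and M: "M = U - T" unfolding goods_def by blast
  have cl: "M \<in> closure_system U \<Sigma>"
  proof -
    have "b \<in> M" if A: "(A, b) \<in> \<Sigma>" "A \<subseteq> M" for A b
    proof (rule ccontr)
      assume "b \<notin> M"
      then have "b \<in> T" using baseD[OF A(1)] M by blast
      then have "A \<inter> T \<noteq> {}" using good_hits[OF T A(1)] lev_le baseD[OF A(1)] by blast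
      then show False using A(2) M by blast
    qed
    then show ?thesis unfolding closure_system_def satisfies_def M by blast
  qed
  have "a \<in> U" "a \<notin> M" using good_apex[OF T] good_in_U[OF T] M by auto
  moreover have "a \<in> C" if "C \<in> closure_system U \<Sigma>" "M \<subseteq> C" "M \<noteq> C" for C
  proof -
    have "C \<inter> T \<noteq> {}" using that M unfolding closure_system_def by blast
    then show ?thesis using good_closed_apex[OF T that(1)] that(2) M by blast
  qed
  ultimately show "M \<in> meet_irreducibles U \<Sigma>"
    unfolding meet_irreducibles_def using cl by blast
qed

lemma inj_on_complement: "inj_on (\<lambda>T. U - T) (goods n)"
proof (rule inj_onI)
  fix T T' assume "T \<in> goods n" "T' \<in> goods n" and eq: "U - T = U - T'"
  then have "T \<subseteq> U" "T' \<subseteq> U" unfolding goods_def using good_in_U by blast+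
  then show "T = T'" using eq by blast
qed

lemma card_goods_le:
  assumes "n \<le> card U"
  shows "card (goods n) \<le> card (meet_irreducibles U \<Sigma>)"
  unfolding meet_irreducibles_goods card_image[OF inj_on_complement] by (rule card_goods_mono[OF assms])

end

subsection \<open>Levels\<close>

text \<open>Elements of a common premise are linked in both directions, and each is linked to the
  conclusion; reachability can thus detect both conditions on levels.\<close>

definition arcs :: "'a implication set \<Rightarrow> ('a \<times> 'a) set" where
  "arcs \<Sigma> = {(x, y). \<exists>(A, b)\<in>\<Sigma>. x \<in> A \<and> (y \<in> A \<or> y = b)}"

definition height :: "'a implication set \<Rightarrow> 'a \<Rightarrow> nat" where
  "height \<Sigma> x = card ((arcs \<Sigma>)\<^sup>* `` {x})"

text \<open>What the layering provides, as a numbering. It increases along implications, opposite to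
  the levels used by the enumeration, and it passes easily to a renamed ground set.\<close>

definition ranked :: "'a implication set \<Rightarrow> bool" where
  "ranked \<Sigma> \<longleftrightarrow> (\<exists>r :: 'a \<Rightarrow> nat. \<forall>(A, b)\<in>\<Sigma>. \<forall>x\<in>A. (\<forall>y\<in>A. r x = r y) \<and> r x < r b)"

lemma has_layering_ranked:
  assumes "has_layering U \<Sigma>"
  shows "ranked \<Sigma>"
proof -
  obtain k and L :: "nat \<Rightarrow> 'a set" where L: "partition_on U (L ` {1..k})" "inj_on L {1..k}"
    and imp: "\<forall>(A, b)\<in>\<Sigma>. \<exists>i j. 1 \<le> i \<and> i < j \<and> j \<le> k \<and> A \<subseteq> L i \<and> b \<in> L j"
    using assms unfolding has_layering_def by blast
  define r where "r x = (THE i. i \<in> {1..k} \<and> x \<in> L i)" for x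
  have r: "r x = i" if i: "i \<in> {1..k}" "x \<in> L i" for x i
    unfolding r_def
  proof (rule the_equality)
    fix j assume j: "j \<in> {1..k} \<and> x \<in> L j"
    show "j = i"
    proof (rule ccontr)
      assume "j \<noteq> i"
      then have "L j \<noteq> L i" using L(2) i j by (auto dest: inj_onD)
      then have "L j \<inter> L i = {}"
        using disjointD[OF partition_onD2[OF L(1)], of "L j" "L i"] i j by auto
      then show False using i j by blast
    qed
  qed (use i in simp)
  have "\<forall>(A, b)\<in>\<Sigma>. \<forall>x\<in>A. (\<forall>y\<in>A. r x = r y) \<and> r x < r b"
  proof clarify
    fix A b x assume "(A, b) \<in> \<Sigma>" "x \<in> A"
    then obtain i j where ij: "1 \<le> i" "i < j" "j \<le> k" "A \<subseteq> L i" "b \<in> L j" using imp by blast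
    have "r y = i" if "y \<in> A" for y by (rule r) (use ij that in auto)
    moreover have "r b = j" by (rule r) (use ij in auto)
    ultimately show "(\<forall>y\<in>A. r x = r y) \<and> r x < r b" using \<open>x \<in> A\<close> ij(2) by simp
  qed
  then show ?thesis unfolding ranked_def by blast
qed

lemma arcs_Image_subset:
  assumes "implicational_base U \<Sigma>" "x \<in> U"
  shows "(arcs \<Sigma>)\<^sup>* `` {x} \<subseteq> U"
proof
  fix y assume "y \<in> (arcs \<Sigma>)\<^sup>* `` {x}"
  then have "(x, y) \<in> (arcs \<Sigma>)\<^sup>*" by simp
  then show "y \<in> U"
    by induction (use assms in \<open>auto simp: arcs_def implicational_base_def\<close>)
qed

text \<open>Elements of a common premise reach each other and hence the same set. A conclusion
  reaches no more than its premise elements do, and cannot reach back to them because the rank never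
  decreases along arcs but is larger at the conclusion; so it reaches strictly less.\<close>

lemma layered_height:
  assumes fin: "finite U" and base: "implicational_base U \<Sigma>" and "ranked \<Sigma>"
  shows "layered U \<Sigma> (height \<Sigma>)"
proof -
  let ?R = "\<lambda>x. (arcs \<Sigma>)\<^sup>* `` {x}"
  obtain r :: "'a \<Rightarrow> nat" where r: "\<And>A b x y. (A, b) \<in> \<Sigma> \<Longrightarrow> x \<in> A \<Longrightarrow> y \<in> A \<Longrightarrow> r x = r y"
    "\<And>A b x. (A, b) \<in> \<Sigma> \<Longrightarrow> x \<in> A \<Longrightarrow> r x < r b"
    using assms(3) unfolding ranked_def by blast
  have mono: "r x \<le> r y" if "(x, y) \<in> (arcs \<Sigma>)\<^sup>*" for x y
    using that
  proof induction
    case (step y z)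
    then obtain A b where A: "(A, b) \<in> \<Sigma>" "y \<in> A" "z \<in> A \<or> z = b" by (auto simp: arcs_def)
    have "r y \<le> r z" using A(3) r(1)[OF A(1,2), of z] r(2)[OF A(1,2)] by auto
    then show ?case using step.IH by simp
  qed simp
  have finR: "finite (?R x)" if "x \<in> U" for x
    using arcs_Image_subset[OF base that] fin finite_subset by blast
  show ?thesis
  proof
    fix A b x y assume A: "(A, b) \<in> \<Sigma>" "x \<in> A" "y \<in> A"
    have "(x, y) \<in> arcs \<Sigma>" "(y, x) \<in> arcs \<Sigma>" using A by (auto simp: arcs_def)
    then have "?R x = ?R y" by (auto intro: converse_rtrancl_into_rtrancl)
    then show "height \<Sigma> x = height \<Sigma> y" by (simp add: height_def)
  next
    fix A b x assume A: "(A, b) \<in> \<Sigma>" "x \<in> A"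
    have "(x, b) \<in> arcs \<Sigma>" using A by (auto simp: arcs_def)
    then have "?R b \<subseteq> ?R x" by (auto intro: converse_rtrancl_into_rtrancl)
    moreover have "x \<notin> ?R b" using mono[of b x] r(2)[OF A] by auto
    moreover have "x \<in> ?R x" by simp
    ultimately have "?R b \<subset> ?R x" by blast
    moreover have "x \<in> U" using base A unfolding implicational_base_def by blast
    ultimately show "height \<Sigma> b < height \<Sigma> x"
      unfolding height_def using psubset_card_mono[OF finR] by blast
  next
    fix x assume x: "x \<in> U"
    have "?R x \<noteq> {}" by blast
    then show "1 \<le> height \<Sigma> x" unfolding height_def using finR[OF x] by (simp add: Suc_le_eq card_gt_0_iff)
    show "height \<Sigma> x \<le> card U"
      unfolding height_def by (rule card_mono[OF fin arcs_Image_subset[OF base x]])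
  qed (use fin base in auto)
qed

text \<open>As long as the iteration has not stabilised, every step adds an element.\<close>

lemma reach_iterate:
  assumes fin: "finite U" and sub: "R\<^sup>* `` {x} \<subseteq> U" and n: "card U \<le> n"
  shows "((\<lambda>S. S \<union> R `` S) ^^ n) {x} = R\<^sup>* `` {x}"
proof -
  define f where "f S = S \<union> R `` S" for S
  have le: "(f ^^ i) {x} \<subseteq> R\<^sup>* `` {x}" for i
    by (induction i) (auto simp: f_def intro: rtrancl_into_rtrancl)
  have x: "x \<in> (f ^^ i) {x}" for i
    by (induction i) (auto simp: f_def)
  have fini: "finite ((f ^^ i) {x})" for i
    using le sub fin by (meson finite_subset)
  have grow: "f ((f ^^ i) {x}) = (f ^^ i) {x} \<or> Suc i \<le> card ((f ^^ i) {x})" for i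
  proof (induction i)
    case (Suc i)
    show ?case
    proof (cases "f ((f ^^ i) {x}) = (f ^^ i) {x}")
      case False
      then have "(f ^^ i) {x} \<subset> (f ^^ Suc i) {x}" by (auto simp: f_def)
      then have "card ((f ^^ i) {x}) < card ((f ^^ Suc i) {x})" by (rule psubset_card_mono[OF fini])
      then show ?thesis using Suc False by simp
    qed simp
  qed simp
  have "card ((f ^^ n) {x}) \<le> card U" using le sub fin by (meson card_mono order_trans)
  then have "f ((f ^^ n) {x}) = (f ^^ n) {x}" using grow[of n] n by linarith
  then have "R `` ((f ^^ n) {x}) \<subseteq> (f ^^ n) {x}" by (auto simp: f_def)
  from Image_closed_trancl[OF this] have "R\<^sup>* `` {x} \<subseteq> (f ^^ n) {x}" using x[of n] by blast
  then show ?thesis using le[of n] unfolding f_def by blast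
qed

subsection \<open>The enumeration program\<close>

text \<open>The program works on the names themselves: the ground set consists of trees, and
  injectivity of \<open>nat_tree\<close> transfers the result to numbers at the end.\<close>

definition base_of :: "tree \<Rightarrow> tree implication set" where
  "base_of v = (\<lambda>i. (els (left i), right i)) ` els (right v)"

definition spread :: "tree \<Rightarrow> tree \<Rightarrow> tree" where
  "spread v R = filt (\<lambda>y. y \<in> els R \<or>
     (\<exists>i\<in>els (right v). hits R (left i) \<and> (y \<in> els (left i) \<or> y = right i))) (left v)"

text \<open>The ground list acts as a loop counter: as many rounds as there are elements reach a
  fixed point.\<close>

definition reach :: "tree \<Rightarrow> tree \<Rightarrow> tree" where
  "reach v x = fold (\<lambda>_ R. spread v R) (tree_list (left v)) (Node x Leaf)"

definition layer :: "tree \<Rightarrow> tree \<Rightarrow> tree" where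
  "layer v c = filt (\<lambda>x. shorter (reach v x) c \<and> shorter c (reach v x)) (left v)"

definition edges :: "tree \<Rightarrow> tree \<Rightarrow> tree \<Rightarrow> tree" where
  "edges v Q P = cmap (\<lambda>i. if right i \<in> els P \<and> incl (left i) Q then Node (left i) Leaf else Leaf) (right v)"

definition extend :: "tree \<Rightarrow> tree \<Rightarrow> tree \<Rightarrow> tree" where
  "extend v Q P = cmap (\<lambda>X. Node (app X P) Leaf) (mtrans (edges v Q P) Q)"

text \<open>The state pairs the level reached, in unary as a list of leaves, with the list of
  partial complements. Unary suits comparison with \<open>reach\<close>, whose length is the
  height.\<close>

definition advance :: "tree \<Rightarrow> tree \<Rightarrow> tree" where
  "advance v s = Node (Node Leaf (left s)) (cmap (\<lambda>P. extend v (layer v (Node Leaf (left s))) P) (right s))"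

definition partials :: "tree \<Rightarrow> tree" where
  "partials v = fold (\<lambda>_ s. advance v s) (tree_list (left v))
     (Node Leaf (cmap (\<lambda>a. Node (Node a Leaf) Leaf) (left v)))"

definition enumerate_mi :: "tree \<Rightarrow> tree" where
  "enumerate_mi v = cmap (\<lambda>T. Node (filt (\<lambda>x. x \<notin> els T) (left v)) Leaf) (right (partials v))"

definition valid :: "tree \<Rightarrow> bool" where
  "valid v \<longleftrightarrow> distinct (tree_list (left v)) \<and> layered (els (left v)) (base_of v) (height (base_of v))"

lemma els_spread:
  assumes "implicational_base (els (left v)) (base_of v)" "els R \<subseteq> els (left v)"
  shows "els (spread v R) = els R \<union> arcs (base_of v) `` els R"
proof -
  have "els (left i) \<subseteq> els (left v) \<and> right i \<in> els (left v)" if "i \<in> els (right v)" for i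
    using assms(1) that unfolding implicational_base_def base_of_def by auto
  then show ?thesis
    using assms(2) unfolding spread_def by (auto simp: base_of_def arcs_def hits_iff)
qed

lemma reach_spec:
  assumes base: "implicational_base (els (left v)) (base_of v)" and d: "distinct (tree_list (left v))"
    and x: "x \<in> els (left v)"
  shows "length (tree_list (reach v x)) = height (base_of v) x"
proof -
  let ?f = "\<lambda>S. S \<union> arcs (base_of v) `` S"
  have sub: "(arcs (base_of v))\<^sup>* `` {x} \<subseteq> els (left v)" by (rule arcs_Image_subset[OF base x])
  have fold: "fold (\<lambda>_ R. g R) xs s = (g ^^ length xs) s" for g :: "tree \<Rightarrow> tree" and xs :: "tree list" and s
    by (induction xs arbitrary: s) (auto simp: funpow_swap1)
  have it: "els ((spread v ^^ n) (Node x Leaf)) = (?f ^^ n) {x} \<and>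
      els ((spread v ^^ n) (Node x Leaf)) \<subseteq> els (left v) \<and>
      distinct (tree_list ((spread v ^^ n) (Node x Leaf)))" for n
  proof (induction n)
    case (Suc n)
    let ?R = "(spread v ^^ n) (Node x Leaf)"
    have "els (spread v ?R) = els ?R \<union> arcs (base_of v) `` els ?R"
      by (rule els_spread[OF base conjunct1[OF conjunct2[OF Suc]]])
    moreover have "els (spread v ?R) \<subseteq> els (left v)" "distinct (tree_list (spread v ?R))"
      using d by (auto simp: spread_def filt_def)
    ultimately show ?case using conjunct1[OF Suc] by simp
  qed (use x in simp)
  let ?n = "length (tree_list (left v))"
  have "els (reach v x) = (?f ^^ ?n) {x}" "distinct (tree_list (reach v x))"
    using it[of ?n] unfolding reach_def fold by auto
  moreover have "(?f ^^ ?n) {x} = (arcs (base_of v))\<^sup>* `` {x}"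
    by (rule reach_iterate[OF _ sub]) (simp_all add: card_length)
  ultimately show ?thesis unfolding height_def using distinct_card[of "tree_list (reach v x)"] by simp
qed

lemma poly_reach: "poly (\<lambda>a. reach (left a) (right a))"
proof -
  let ?J = "\<lambda>a (ys :: tree list) s. nodes s \<le> nodes a + 2"
  have L: "poly (\<lambda>a. left (left a))" by (intro poly_intros)
  have bd: "nodes s \<le> Suc (nodes a) ^ (1 + 2)" if "?J a ys s" for a ys s
  proof -
    have "Suc (nodes a) + 0 + 1 \<le> Suc (nodes a) ^ (1 + 2)"
      by (rule power_sum_le[OF Suc_nodes_ge2]) simp_all
    then show ?thesis using that by linarith
  qed
  have idf: "feasible (fold_dom (\<lambda>_. True) (\<lambda>a. left (left a)) ?J) (\<lambda>z. Suc (nodes (right z))) (\<lambda>z. z)"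
    by (rule feasible_fold_id[OF poly_id L bd])
  have sp: "poly (\<lambda>a. spread (left a) (right a))"
    unfolding spread_def by (intro poly_intros decidable_hits)
  have spn: "nodes (spread (left a) R) \<le> nodes a" for a R
    unfolding spread_def using nodes_filt_le nodes_left order_trans by meson
  have init: "nodes (Node (right a) Leaf) \<le> nodes a + 2" for a using nodes_right[of a] by simp
  show ?thesis
    unfolding reach_def
  proof (rule feasible_fold[where J = ?J and j = "1 + 2", OF L _ poly_id])
    show "feasible (fold_dom (\<lambda>_. True) (\<lambda>a. left (left a)) ?J) (\<lambda>z. Suc (nodes (right z)))
        (\<lambda>z. spread (left (right z)) (right (left z)))"
      by (intro feasible_poly2[OF sp] feasible_left feasible_right idf)
    show "poly (\<lambda>a. Node (right a) Leaf)" by (intro poly_intros)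
  qed (use bd init spn trans_le_add1 in blast)+
qed

lemmas feasible_reach = feasible_poly2[of reach, OF poly_reach]

lemma poly_layer: "poly (\<lambda>a. layer (left a) (right a))"
  unfolding layer_def by (intro poly_intros decidable_shorter feasible_reach)

lemma poly_edges: "poly (\<lambda>a. edges (left a) (left (right a)) (right (right a)))"
  unfolding edges_def by (intro poly_intros decidable_incl)

lemma els_cmap_if: "els (cmap (\<lambda>i. if B i then Node (f i) Leaf else Leaf) t) = f ` {i \<in> els t. B i}"
  by (auto split: if_splits)

lemma els_edges: "els ` els (edges v Q P) = {A. \<exists>b. (A, b) \<in> base_of v \<and> b \<in> els P \<and> A \<subseteq> els Q}"
  unfolding edges_def base_of_def els_cmap_if by (auto simp: incl_iff)

lemma els_edges_subset: "E \<in> els (edges v Q P) \<Longrightarrow> els E \<subseteq> els Q"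
  by (auto simp: edges_def incl_iff split: if_splits)

text \<open>Lists are compared through keys, usually \<open>els\<close>, because different lists may
  stand for the same set. Blocks cannot overlap if the key of any member determines the key
  \<open>\<psi>\<close> of the index that produced it.\<close>

lemma distinct_cmap:
  assumes "\<And>x. x \<in> els t \<Longrightarrow> distinct (map \<phi> (tree_list (f x)))" "distinct (map \<psi> (tree_list t))"
    and "\<And>x y u w. x \<in> els t \<Longrightarrow> y \<in> els t \<Longrightarrow> u \<in> els (f x) \<Longrightarrow> w \<in> els (f y) \<Longrightarrow> \<phi> u = \<phi> w \<Longrightarrow> \<psi> x = \<psi> y"
  shows "distinct (map \<phi> (tree_list (cmap f t)))"
proof -
  have main: "distinct (map \<phi> (concat (map (\<lambda>x. tree_list (f x)) xs)))"
    if "\<And>x. x \<in> set xs \<Longrightarrow> distinct (map \<phi> (tree_list (f x)))" "distinct (map \<psi> xs)"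
      "\<And>x y u w. x \<in> set xs \<Longrightarrow> y \<in> set xs \<Longrightarrow> u \<in> els (f x) \<Longrightarrow> w \<in> els (f y) \<Longrightarrow> \<phi> u = \<phi> w \<Longrightarrow> \<psi> x = \<psi> y"
    for xs
    using that
  proof (induction xs)
    case (Cons x xs)
    have "\<phi> u \<noteq> \<phi> w" if "u \<in> els (f x)" "y \<in> set xs" "w \<in> els (f y)" for u y w
    proof
      assume "\<phi> u = \<phi> w"
      then have "\<psi> x = \<psi> y" using Cons.prems(3)[of x y u w] that by simp
      then show False using Cons.prems(2) that(2) by (auto simp: image_iff)
    qed
    moreover have "distinct (map \<phi> (concat (map (\<lambda>x. tree_list (f x)) xs)))"
      using Cons.prems by (intro Cons.IH) auto
    ultimately show ?case using Cons.prems(1)[of x] by (auto; blast)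
  qed simp
  have "distinct (map \<phi> (concat (map (\<lambda>x. tree_list (f x)) (tree_list t))))"
    by (rule main[OF assms]; assumption)
  then show ?thesis unfolding cmap_def list_tree_inverse rev_map[symmetric] distinct_rev .
qed

section \<open>Correctness of the layer-by-layer construction\<close>

definition stage :: "tree \<Rightarrow> nat \<Rightarrow> tree \<Rightarrow> bool" where
  "stage v n s \<longleftrightarrow> left s = list_tree (replicate n Leaf) \<and>
     els ` els (right s) = layered.goods (els (left v)) (base_of v) (height (base_of v)) n \<and>
     distinct (map els (tree_list (right s))) \<and> (\<forall>T\<in>els (right s). distinct (tree_list T))"

context
  fixes v
  assumes valid: "valid v"
begin

interpretation layered "els (left v)" "base_of v" "height (base_of v)"
  using valid by (simp add: valid_def)

lemma distinct_ground: "distinct (tree_list (left v))"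
  using valid by (simp add: valid_def)

lemma els_layer: "els (layer v c) = {x \<in> els (left v). height (base_of v) x = length (tree_list c)}"
  using reach_spec[OF base distinct_ground] by (auto simp: layer_def shorter_def)

lemma edges_hyp:
  assumes "length (tree_list c) = Suc n"
  shows "els ` els (edges v (layer v c) P) = hyp n (els P)"
proof -
  have *: "b \<in> els P \<and> A \<subseteq> els (layer v c) \<longleftrightarrow> b \<in> els P \<and> (\<forall>x\<in>A. height (base_of v) x = Suc n)"
    if "(A, b) \<in> base_of v" for A b
    unfolding els_layer assms using baseD[OF that] by auto
  show ?thesis
    unfolding els_edges hyp_def
    by (rule Collect_cong, rule iff_exI, rule conj_cong[OF refl], rule *)
qed

lemma extend_spec:
  assumes P: "els P \<in> goods n" "distinct (tree_list P)" and c: "length (tree_list c) = Suc n"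
  shows "els ` els (extend v (layer v c) P) = {els P \<union> X | X. X \<in> mintrans (hyp n (els P))}"
    "distinct (map els (tree_list (extend v (layer v c) P)))"
    "\<And>T. T \<in> els (extend v (layer v c) P) \<Longrightarrow> distinct (tree_list T)"
proof -
  let ?Q = "layer v c"
  let ?M = "mtrans (edges v ?Q P) ?Q"
  have "els ` els ?M = mintrans (els ` els (edges v ?Q P))"
    by (rule mtrans_spec(1)) (rule els_edges_subset)
  then have m1: "els ` els ?M = mintrans (hyp n (els P))" unfolding edges_hyp[OF c] .
  have m2: "found (edges v ?Q P) ?Q ?M" by (rule mtrans_spec(2)) (rule els_edges_subset)
  have X: "els X \<in> mintrans (hyp n (els P))" "distinct (tree_list X)" if "X \<in> els ?M" for X
  proof -
    show "els X \<in> mintrans (hyp n (els P))" using m1 imageI[OF that, of els] by simp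
    have "part X (left v)"
    proof (rule part_trans)
      show "part X ?Q" using m2 that by (simp add: found_def)
      show "part ?Q (left v)" unfolding layer_def by (rule part_filt)
    qed
    then show "distinct (tree_list X)" using distinct_ground by (simp add: part_def)
  qed
  have "els ` els (extend v ?Q P) = (\<lambda>X. X \<union> els P) ` els ` els ?M"
    using els_cmap_if[of "\<lambda>_. True" "\<lambda>X. app X P" ?M]
    by (simp add: extend_def image_image del: els_cmap)
  then show "els ` els (extend v ?Q P) = {els P \<union> X | X. X \<in> mintrans (hyp n (els P))}"
    unfolding m1 by auto
  show "distinct (map els (tree_list (extend v ?Q P)))"
    unfolding extend_def
  proof (rule distinct_cmap[where \<psi> = els])
    show "distinct (map els (tree_list ?M))" using m2 by (simp add: found_def)
    fix X Y u w assume "X \<in> els ?M" "Y \<in> els ?M" "u \<in> els (Node (app X P) Leaf)"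
      "w \<in> els (Node (app Y P) Leaf)" "els u = els w"
    then show "els X = els Y"
      using good_union_inject(2)[OF P(1) X(1) P(1) X(1), of X Y] by (simp add: Un_commute)
  qed simp
  fix T assume "T \<in> els (extend v ?Q P)"
  then obtain Y where Y: "Y \<in> els ?M" "T = app Y P" by (auto simp: extend_def)
  obtain a where a: "good n a (els P)" using P(1) unfolding goods_def by blast
  have "els Y \<inter> els P = {}" using hyp_disjoint[OF a X(1)[OF Y(1)]] good_subset[OF a] by blast
  then show "distinct (tree_list T)" using X(2)[OF Y(1)] P(2) unfolding Y(2) app_def by simp
qed

lemma stage_advance:
  assumes "stage v n s"
  shows "stage v (Suc n) (advance v s)"
proof -
  let ?c = "Node Leaf (left s)"
  let ?Q = "layer v ?c"
  have c: "length (tree_list ?c) = Suc n" using assms by (simp add: stage_def)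
  have P: "els P \<in> goods n" "distinct (tree_list P)" if "P \<in> els (right s)" for P
    using assms that unfolding stage_def by auto
  note e = extend_spec[OF P c]
  have "els ` els (right (advance v s)) = (\<Union>P\<in>els (right s). els ` els (extend v ?Q P))"
    by (auto simp: advance_def)
  also have "\<dots> = (\<Union>P\<in>els (right s). {els P \<union> X | X. X \<in> mintrans (hyp n (els P))})"
    using e(1) by simp
  also have "\<dots> = (\<Union>P\<in>els ` els (right s). {P \<union> X | X. X \<in> mintrans (hyp n P)})" by simp
  also have "\<dots> = goods (Suc n)" using assms unfolding goods_Suc stage_def by auto
  finally have "els ` els (right (advance v s)) = goods (Suc n)" .
  moreover have "distinct (map els (tree_list (right (advance v s))))"
    unfolding advance_def right.simps
  proof (rule distinct_cmap[where \<psi> = els])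
    show "distinct (map els (tree_list (right s)))" using assms by (simp add: stage_def)
    fix x y u w assume *: "x \<in> els (right s)" "y \<in> els (right s)" "u \<in> els (extend v ?Q x)"
      "w \<in> els (extend v ?Q y)" "els u = els w"
    obtain X where X: "X \<in> mintrans (hyp n (els x))" "els u = els x \<union> X" using e(1)[OF *(1,1)] *(3) by blast
    obtain Y where Y: "Y \<in> mintrans (hyp n (els y))" "els w = els y \<union> Y" using e(1)[OF *(2,2)] *(4) by blast
    show "els x = els y"
      using good_union_inject(1)[OF P(1)[OF *(1)] X(1) P(1)[OF *(2)] Y(1)] X(2) Y(2) *(5) by simp
  qed (use e(2) in blast)
  moreover have "\<forall>T\<in>els (right (advance v s)). distinct (tree_list T)"
    using e(3) by (auto simp: advance_def)
  moreover have "left (advance v s) = list_tree (replicate (Suc n) Leaf)"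
    using assms by (simp add: advance_def stage_def)
  ultimately show ?thesis unfolding stage_def by blast
qed

lemma stage_init: "stage v 0 (Node Leaf (cmap (\<lambda>a. Node (Node a Leaf) Leaf) (left v)))"
proof -
  have "distinct (map els (tree_list (cmap (\<lambda>a. Node (Node a Leaf) Leaf) (left v))))"
    by (rule distinct_cmap[where \<psi> = "\<lambda>a. a"]) (use distinct_ground in auto)
  moreover have "els ` els (cmap (\<lambda>a. Node (Node a Leaf) Leaf) (left v)) = goods 0"
    using els_cmap_if[of "\<lambda>_. True" "\<lambda>a. Node a Leaf" "left v"] unfolding goods_0
    by (auto simp: image_image simp del: els_cmap)
  ultimately show ?thesis unfolding stage_def by auto
qed

lemma stage_fold: "stage v n s \<Longrightarrow> stage v (n + length xs) (fold (\<lambda>_ s. advance v s) xs s)"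
proof (induction xs arbitrary: n s)
  case (Cons x xs)
  then show ?case using Cons.IH[OF stage_advance[OF Cons.prems]] by simp
qed simp

lemma card_ground: "card (els (left v)) = length (tree_list (left v))"
  by (rule distinct_card[OF distinct_ground])

lemma stage_partials: "stage v (card (els (left v))) (partials v)"
  unfolding partials_def card_ground using stage_fold[OF stage_init] by simp

lemma enumerate_mi_spec:
  shows "els ` els (enumerate_mi v) = meet_irreducibles (els (left v)) (base_of v)"
    "distinct (map els (tree_list (enumerate_mi v)))"
    "\<And>T. T \<in> els (enumerate_mi v) \<Longrightarrow> distinct (tree_list T)"
proof -
  let ?U = "els (left v)"
  have g: "els ` els (right (partials v)) = goods (card ?U)"
    and d: "distinct (map els (tree_list (right (partials v))))"
    using stage_partials by (simp_all add: stage_def)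
  have "els (filt (\<lambda>x. x \<notin> els T) (left v)) = ?U - els T" for T by auto
  then have "els ` els (enumerate_mi v) = (\<lambda>T. ?U - T) ` els ` els (right (partials v))"
    using els_cmap_if[of "\<lambda>_. True" "\<lambda>T. filt (\<lambda>x. x \<notin> els T) (left v)" "right (partials v)"]
    by (simp add: enumerate_mi_def image_image del: els_cmap els_filt)
  then show "els ` els (enumerate_mi v) = meet_irreducibles ?U (base_of v)"
    by (simp add: meet_irreducibles_goods g)
  show "distinct (map els (tree_list (enumerate_mi v)))"
    unfolding enumerate_mi_def
  proof (rule distinct_cmap[where \<psi> = els, OF _ d])
    fix x y u w assume *: "x \<in> els (right (partials v))" "y \<in> els (right (partials v))"
      "u \<in> els (Node (filt (\<lambda>z. z \<notin> els x) (left v)) Leaf)"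
      "w \<in> els (Node (filt (\<lambda>z. z \<notin> els y) (left v)) Leaf)" "els u = els w"
    have "els u = ?U - els x" "els w = ?U - els y" using *(3,4) by auto
    then have "?U - els x = ?U - els y" using *(5) by simp
    moreover have "els x \<in> goods (card ?U)" "els y \<in> goods (card ?U)" using g *(1,2) by blast+
    ultimately show "els x = els y" by (rule inj_onD[OF inj_on_complement])
  qed simp
  show "distinct (tree_list T)" if "T \<in> els (enumerate_mi v)" for T
    using that distinct_ground by (auto simp: enumerate_mi_def filt_def)
qed

end

section \<open>Running time in terms of input and number of outputs\<close>

definition instance_size :: "tree \<Rightarrow> nat" where
  "instance_size v = nodes v + card (meet_irreducibles (els (left v)) (base_of v)) + 1"

lemma layer_edges_nodes:
  "nodes (layer v c) \<le> nodes v" "nodes (edges v Q P) \<le> nodes v * Suc (nodes v) + 1"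
proof -
  show "nodes (layer v c) \<le> nodes v"
    unfolding layer_def by (rule order_trans[OF nodes_filt_le nodes_left])
  have "nodes A \<le> nodes v" if A: "A \<in> els (edges v Q P)" for A
  proof -
    obtain i where i: "i \<in> els (right v)" "A = left i"
      using A unfolding edges_def els_cmap_if by blast
    then show ?thesis using nodes_els[OF i(1)] nodes_left[of i] nodes_right[of v] by simp
  qed
  from nodes_list_le[OF this]
  have "nodes (edges v Q P) \<le> length (tree_list (edges v Q P)) * Suc (nodes v) + 1" by blast
  moreover have "length (tree_list (edges v Q P)) \<le> nodes v"
  proof -
    have "length (tree_list (edges v Q P)) \<le> (\<Sum>i\<leftarrow>tree_list (right v). 1)"
      unfolding edges_def length_cmap by (rule sum_list_mono) simp
    also have "\<dots> = length (tree_list (right v))" by (simp add: sum_list_triv)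
    finally show ?thesis using length_tree_list[of "right v"] nodes_right[of v] by simp
  qed
  then have "length (tree_list (edges v Q P)) * Suc (nodes v) \<le> nodes v * Suc (nodes v)"
    by (rule mult_le_mono1)
  ultimately show "nodes (edges v Q P) \<le> nodes v * Suc (nodes v) + 1" by linarith
qed

text \<open>The list of partial complements has no repetitions as sets, so its length is the size of
  a family that is no larger than the output. Each member is a duplicate-free list of ground
  elements and hence no larger than the ground list.\<close>

lemma stage_nodes:
  assumes v: "valid v" and s: "stage v n s" and n: "n \<le> card (els (left v))"
  shows "nodes s \<le> instance_size v ^ 6"
proof -
  interpret layered "els (left v)" "base_of v" "height (base_of v)"
    using v by (simp add: valid_def)
  let ?N = "instance_size v"
  have N2: "2 \<le> ?N" using nodes_pos[of v] by (simp add: instance_size_def)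
  have nv: "Suc (nodes v) \<le> ?N" by (simp add: instance_size_def)
  have "nodes (left s) \<le> length (tree_list (left s)) * Suc 1 + 1"
    using s by (intro nodes_list_le) (auto simp: stage_def split: if_splits)
  also have "\<dots> \<le> ?N + ?N + 1"
  proof -
    have "length (tree_list (left s)) = n" using s by (simp add: stage_def)
    moreover have "n \<le> nodes v"
      using n card_length[of "tree_list (left v)"] length_tree_list[of "left v"] nodes_left[of v] by linarith
    ultimately show ?thesis using nv by simp
  qed
  also have "\<dots> \<le> ?N ^ (1 + 2)" by (rule power_sum_le[OF N2]) simp_all
  finally have 1: "nodes (left s) \<le> ?N ^ 4" by (rule power_le[OF N2]) simp
  have "nodes T \<le> nodes v" if T: "T \<in> els (right s)" for T
  proof -
    have "els T \<in> goods n" "distinct (tree_list T)" using s T by (auto simp: stage_def)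
    then have "els T \<subseteq> els (left v)" using good_in_U unfolding goods_def by blast
    then have "(\<Sum>x\<in>els T. nodes x + 1) \<le> (\<Sum>x\<in>els (left v). nodes x + 1)"
      by (intro sum_mono2) auto
    then have "nodes T \<le> nodes (left v)"
      unfolding nodes_eq_tree_list[of T] nodes_eq_tree_list[of "left v"]
      using sum_list_distinct_conv_sum_set[OF \<open>distinct (tree_list T)\<close>, of "\<lambda>x. nodes x + 1"]
        sum_list_distinct_conv_sum_set[OF distinct_ground[OF v], of "\<lambda>x. nodes x + 1"] by simp
    then show ?thesis using nodes_left[of v] by simp
  qed
  then have "nodes (right s) \<le> length (tree_list (right s)) * Suc (nodes v) + 1" by (rule nodes_list_le)
  also have "\<dots> \<le> ?N * ?N + 0 + 1"
  proof -
    have "length (tree_list (right s)) = card (goods n)"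
      using s distinct_card[of "map els (tree_list (right s))"] by (simp add: stage_def)
    then have "length (tree_list (right s)) \<le> ?N" using card_goods_le[OF n] by (simp add: instance_size_def)
    then show ?thesis using mult_mono[OF _ nv] by simp
  qed
  also have "\<dots> \<le> ?N ^ (2 + 2)" by (rule power_sum_le[OF N2]) (simp_all add: power2_eq_square)
  finally have 2: "nodes (right s) \<le> ?N ^ 4" by simp
  have "nodes s \<le> ?N ^ (4 + 2)" using power_sum_le[OF N2 1 2] nodes_le_parts[of s] by linarith
  then show ?thesis by simp
qed

text \<open>Here the output bound enters the running time: the minimal transversals of one layer are
  counted by the family at \<open>Suc n\<close>, which is at most the output only while
  \<open>Suc n\<close> does not exceed \<open>card U\<close>; hence the strict bound on
  \<open>n\<close>.\<close>

lemma feasible_extend: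
  "feasible (\<lambda>a. valid (left a) \<and> (\<exists>n < card (els (left (left a))).
       length (tree_list (left (right a))) = Suc n \<and>
       els (right (right a)) \<in> layered.goods (els (left (left a))) (base_of (left a)) (height (base_of (left a))) n) \<and>
       nodes a \<le> instance_size (left a) ^ 12)
     (\<lambda>a. qpoly (instance_size (left a)))
     (\<lambda>a. extend (left a) (layer (left a) (left (right a))) (right (right a)))"
    (is "feasible ?D ?m _")
proof -
  have N2: "2 \<le> instance_size v" for v using nodes_pos[of v] by (simp add: instance_size_def)
  have Nm: "instance_size v \<le> qpoly (instance_size v)" for v using qpoly_ge N2[of v] by simp
  have m2: "2 \<le> ?m a" for a using Nm[of "left a"] N2[of "left a"] by linarith
  have id: "feasible ?D ?m (\<lambda>a. a)"
  proof (rule feasible_id)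
    fix a assume "?D a"
    then show "nodes a \<le> ?m a ^ 12" using power_mono[OF Nm, of "left a" 12] by linarith
  qed (rule m2)
  let ?Q = "\<lambda>a. layer (left a) (left (right a))"
  let ?E = "\<lambda>a. edges (left a) (?Q a) (right (right a))"
  have Q: "feasible ?D ?m ?Q" by (intro feasible_poly2[OF poly_layer] feasible_left feasible_right id)
  have E: "feasible ?D ?m ?E" by (intro feasible_poly3[OF poly_edges] feasible_left feasible_right id Q)
  have "feasible ?D ?m (\<lambda>a. (\<lambda>z. mtrans (left z) (right z)) (Node (?E a) (?Q a)))"
  proof (rule feasible_comp[OF feasible_Node[OF E Q] feasible_mtrans])
    fix a assume a: "?D a"
    let ?v = "left a"
    let ?N = "instance_size ?v"
    let ?z = "Node (?E a) (?Q a)"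
    show "\<forall>e\<in>els (left ?z). els e \<subseteq> els (right ?z)" using els_edges_subset by simp
    from a have v: "valid ?v" by blast
    interpret layered "els (left ?v)" "base_of ?v" "height (base_of ?v)"
      using v by (simp add: valid_def)
    obtain n where n: "n < card (els (left ?v))" "length (tree_list (left (right a))) = Suc n"
      "els (right (right a)) \<in> goods n" using a by blast
    have "card (mintrans (els ` els (left ?z))) \<le> card (goods (Suc n))"
      using card_mintrans_le[OF n(3)] edges_hyp[OF v n(2)] by simp
    also have "\<dots> \<le> card (meet_irreducibles (els (left ?v)) (base_of ?v))"
      by (rule card_goods_le) (use n in simp)
    finally have card: "Suc (card (mintrans (els ` els (left ?z)))) \<le> ?N" by (simp add: instance_size_def)
    have nv: "Suc (nodes ?v) \<le> ?N" by (simp add: instance_size_def)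
    have "nodes (?E a) \<le> nodes ?v * Suc (nodes ?v) + 1" by (rule layer_edges_nodes(2))
    also have "\<dots> \<le> ?N * ?N + 0 + 1"
    proof -
      have "nodes ?v * Suc (nodes ?v) \<le> ?N * ?N" using nv by (intro mult_le_mono) linarith+
      then show ?thesis by linarith
    qed
    also have "\<dots> \<le> ?N ^ (2 + 2)" by (rule power_sum_le[OF N2]) (simp_all add: power2_eq_square)
    finally have 1: "nodes (?E a) \<le> ?N ^ 4" by simp
    have "nodes (?Q a) \<le> ?N ^ 1" using layer_edges_nodes(1)[of ?v "left (right a)"] nv by simp
    then have 2: "nodes (?Q a) \<le> ?N ^ 4" by (rule power_le[OF N2]) simp
    have 3: "nodes ?z \<le> ?N ^ (4 + 2)" using power_sum_le[OF N2 1 2] by simp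
    have "Suc (nodes ?z) \<le> ?N ^ (4 + 2 + 2)" using power_sum_le[OF N2 3, of 0] by simp
    \<comment> \<open>The argument of \<open>mtrans\<close> contributes the eighth power and the
      number of its minimal transversals one more factor; this is where the exponent 9 comes
      from.\<close>
    then have "Suc (nodes ?z) * Suc (card (mintrans (els ` els (left ?z)))) \<le> ?N ^ (4 + 2 + 2) * ?N"
      using card by (rule mult_mono) simp_all
    also have "\<dots> = ?N ^ 9" by (simp add: eval_nat_numeral)
    finally show "qpoly (Suc (nodes ?z) * Suc (card (mintrans (els ` els (left ?z))))) \<le> ?m a ^ (9 * (9 + 1))"
      by (intro qpoly_power N2) simp_all
  qed
  then have M: "feasible ?D ?m (\<lambda>a. mtrans (?E a) (?Q a))" by simp
  show ?thesis
    unfolding extend_def by (rule feasible_cmap[OF M id]) (intro poly_intros)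
qed

text \<open>The stage is the length of the processed prefix of the ground list. Inside the body one
  element is still being processed, so the stage is strictly below \<open>card U\<close>, as
  \<open>feasible_extend\<close> requires.\<close>

lemma feasible_enumerate_mi: "feasible valid (\<lambda>v. qpoly (instance_size v)) enumerate_mi"
proof -
  let ?m = "\<lambda>v. qpoly (instance_size v)"
  let ?J = "\<lambda>v ys s. (\<exists>zs. tree_list (left v) = ys @ zs) \<and> stage v (length ys) s"
  have N2: "2 \<le> instance_size v" for v using nodes_pos[of v] by (simp add: instance_size_def)
  have Nm: "instance_size v ^ k \<le> ?m v ^ k" for v k
    using qpoly_ge[of "instance_size v"] N2[of v] by (intro power_mono) auto
  have m2: "2 \<le> ?m v" for v using Nm[of v 1] N2[of v] by simp
  have id: "feasible valid ?m (\<lambda>v. v)"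
  proof (rule feasible_id)
    fix v show "nodes v \<le> ?m v ^ 1" using Nm[of v 1] by (simp add: instance_size_def)
  qed (rule m2)
  have L: "feasible valid ?m left" by (rule feasible_left[OF id])
  have szN: "nodes s \<le> instance_size v ^ 6" if v: "valid v" and J: "?J v ys s" for v ys s
  proof (rule stage_nodes[OF v])
    show "stage v (length ys) s" using J by blast
    show "length ys \<le> card (els (left v))" using J unfolding card_ground[OF v] by auto
  qed
  have sz: "nodes s \<le> ?m v ^ 6" if "valid v" "?J v ys s" for v ys s
    using szN[OF that] Nm[of v 6] by (rule order_trans)
  let ?F = "fold_dom valid left ?J"
  have idf: "feasible ?F (\<lambda>z. ?m (right z)) (\<lambda>z. z)"
    by (rule feasible_fold_id[OF id L sz])
  let ?S = "\<lambda>z. right (left z)"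
  have body: "feasible (elem_dom ?F (\<lambda>z. right (?S z))) (\<lambda>w. ?m (right (right w)))
      (\<lambda>w. (\<lambda>P z. extend (right z) (layer (right z) (Node Leaf (left (?S z)))) P) (left w) (right w))"
    (is "feasible ?G _ _")
  proof -
    have idg: "feasible ?G (\<lambda>w. ?m (right (right w))) (\<lambda>w. w)"
      by (rule feasible_elem_id[OF idf]) (intro feasible_right feasible_left idf)
    let ?y = "\<lambda>w. Node (right (right w)) (Node (Node Leaf (left (?S (right w)))) (left w))"
    have "feasible ?G (\<lambda>w. ?m (right (right w)))
        (\<lambda>w. (\<lambda>a. extend (left a) (layer (left a) (left (right a))) (right (right a))) (?y w))"
    proof (rule feasible_comp[OF _ feasible_extend, where j = 1])
      show "feasible ?G (\<lambda>w. ?m (right (right w))) ?y"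
        by (intro feasible_Node feasible_right feasible_left feasible_Leaf'[OF idg] idg)
    next
      fix w assume w: "?G w"
      let ?v = "right (right w)" and ?s = "?S (right w)"
      obtain ys zs where yz: "valid ?v" "tree_list (left ?v) = ys @ left (left (right w)) # zs"
        "stage ?v (length ys) ?s" and P: "left w \<in> els (right ?s)"
        using w unfolding elem_dom_def fold_dom_def by blast
      have n: "length ys < card (els (left ?v))" 
        using card_ground[OF yz(1)] arg_cong[OF yz(2), of length] by simp
      have len: "length (tree_list (left ?s)) = length ys" using yz(3) by (simp add: stage_def)
      have g: "els (left w) \<in> layered.goods (els (left ?v)) (base_of ?v) (height (base_of ?v)) (length ys)"
        using yz(3) P by (auto simp: stage_def)
      let ?N = "instance_size ?v"
      have s6: "nodes ?s \<le> ?N ^ 6" by (rule szN[of _ ys]) (use yz in auto)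
      have "nodes (left ?s) + nodes (left w) \<le> nodes ?s"
        using P nodes_els[OF P] by (cases ?s) auto
      then have 1: "nodes (Node (Node Leaf (left ?s)) (left w)) \<le> ?N ^ 6 + 3" using s6 by simp
      have v1: "nodes ?v + 1 \<le> ?N" by (simp add: instance_size_def)
      have N6: "?N ^ 6 + ?N ^ 6 + 1 \<le> ?N ^ (6 + 2)" by (rule power_sum_le[OF N2]) simp_all
      have "2 ^ 6 \<le> ?N ^ 6" using N2 by (rule power_mono) simp
      moreover have "?N \<le> ?N ^ 6" using N2[of ?v] by (intro self_le_power) auto
      ultimately have "nodes (?y w) \<le> ?N ^ 6 + ?N ^ 6 + ?N ^ 6 + 1" using 1 v1 by simp
      also have "\<dots> \<le> ?N ^ 8 + ?N ^ 8 + 1"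
        using N6 by (simp only: numeral_plus_numeral semiring_norm)
      also have "\<dots> \<le> ?N ^ (8 + 2)" by (rule power_sum_le[OF N2]) simp_all
      finally have "nodes (?y w) \<le> ?N ^ 12" by (rule power_le[OF N2]) simp
      then show "valid (left (?y w)) \<and> (\<exists>n<card (els (left (left (?y w)))).
         length (tree_list (left (right (?y w)))) = Suc n \<and>
         els (right (right (?y w))) \<in> layered.goods (els (left (left (?y w)))) (base_of (left (?y w)))
           (height (base_of (left (?y w)))) n) \<and> nodes (?y w) \<le> instance_size (left (?y w)) ^ 12"
        using yz(1) n len g by auto
    qed simp
    then show ?thesis by simp
  qed
  have rnd: "feasible ?F (\<lambda>z. ?m (right z)) (\<lambda>z. advance (right z) (?S z))"
    unfolding advance_def
    by (intro feasible_Node feasible_Leaf'[OF idf] feasible_left feasible_right idf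
        feasible_cmap_dom[OF _ idf body])
  have "feasible valid ?m partials"
    unfolding partials_def
  proof (rule feasible_fold[where J = ?J and j = 6, OF L _ id])
    show "feasible ?F (\<lambda>z. ?m (right z)) (\<lambda>z. advance (right z) (?S z))" by (rule rnd)
    show "feasible valid ?m (\<lambda>v. Node Leaf (cmap (\<lambda>a. Node (Node a Leaf) Leaf) (left v)))"
      by (intro feasible_Node feasible_Leaf'[OF id] feasible_cmap[OF L id] poly_intros)
    show "?J v [] (Node Leaf (cmap (\<lambda>a. Node (Node a Leaf) Leaf) (left v)))" if "valid v" for v
      using stage_init[OF that] by simp
    show "?J v (ys @ [x]) (advance v s)"
      if "valid v" "tree_list (left v) = ys @ x # zs" "?J v ys s" for v ys x zs s
      using stage_advance[OF that(1), of "length ys" s] that by auto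
  qed (rule sz)
  then show ?thesis
    unfolding enumerate_mi_def
    by (intro feasible_cmap[OF feasible_right id] poly_intros)
qed

subsection \<open>Encodings\<close>

lemma inj_nat_tree: "inj nat_tree"
proof (rule injI)
  fix m n :: nat
  show "nat_tree m = nat_tree n \<Longrightarrow> m = n"
  proof (induction m arbitrary: n rule: less_induct)
    case (less m)
    have "m = 0 \<longleftrightarrow> n = 0"
      using less.prems by (subst (asm) nat_tree.simps, subst (asm) (2) nat_tree.simps) (auto split: if_splits)
    moreover have ?case if "m \<noteq> 0" "n \<noteq> 0"
    proof -
      have "odd m = odd n" "nat_tree (m div 2) = nat_tree (n div 2)"
        using less.prems that by (subst (asm) (1 2) nat_tree.simps; auto split: if_splits)+
      then have "odd m = odd n" "m div 2 = n div 2" using less.IH that by auto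
      then show ?thesis by (metis odd_two_times_div_two_succ even_two_times_div_two)
    qed
    ultimately show ?case by auto
  qed
qed

lemma list_all2_encodes_nat: "list_all2 encodes_nat xs vs \<longleftrightarrow> vs = map nat_tree xs"
proof (induction xs arbitrary: vs)
  case (Cons x xs)
  then show ?case by (cases vs) (auto simp: encodes_nat_def)
qed simp

lemma encodes_nat_set:
  "encodes_set encodes_nat S v \<longleftrightarrow> distinct (tree_list v) \<and> els v = nat_tree ` S"
proof
  assume "encodes_set encodes_nat S v"
  then show "distinct (tree_list v) \<and> els v = nat_tree ` S"
    unfolding encodes_set_def list_all2_encodes_nat
    using inj_nat_tree by (auto simp: distinct_map intro: inj_on_subset[OF inj_nat_tree subset_UNIV])
next
  assume v: "distinct (tree_list v) \<and> els v = nat_tree ` S"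
  define xs where "xs = map (inv nat_tree) (tree_list v)"
  have f: "nat_tree (inv nat_tree t) = t" if "t \<in> els v" for t
    using that v by (auto intro!: f_inv_into_f)
  have "map nat_tree xs = tree_list v" 
    unfolding xs_def map_map by (rule map_idI) (simp add: f)
  moreover from this have "distinct (map nat_tree xs)" using v by simp
  then have "distinct xs" by (simp add: distinct_map)
  moreover have "set xs = S" using v inj_nat_tree by (auto simp: xs_def image_image)
  ultimately show "encodes_set encodes_nat S v"
    unfolding encodes_set_def list_all2_encodes_nat by (metis tree_list_inverse)
qed

section \<open>Renaming the ground set along an injection\<close>

definition image_base :: "('a \<Rightarrow> 'b) \<Rightarrow> 'a implication set \<Rightarrow> 'b implication set" where
  "image_base f \<Sigma> = (\<lambda>(A, b). (f ` A, f b)) ` \<Sigma>"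

lemma encodes_baseD:
  assumes "encodes_base (U, \<Sigma>) v"
  shows "distinct (tree_list (left v))" "els (left v) = nat_tree ` U"
    "base_of v = image_base nat_tree \<Sigma>"
proof -
  let ?E = "encodes_pair (encodes_set encodes_nat) encodes_nat"
  obtain x y where v: "v = Node x y" "encodes_set encodes_nat U x" "encodes_set ?E \<Sigma> y"
    using assms unfolding encodes_base_def encodes_pair_def[of _ _ "(U, \<Sigma>)"] by auto
  then show "distinct (tree_list (left v))" "els (left v) = nat_tree ` U"
    by (auto simp: encodes_nat_set)
  obtain xs vs where xs: "set xs = \<Sigma>" "list_all2 ?E xs vs" "y = list_tree vs"
    using v(3) unfolding encodes_set_def by blast
  have "(\<lambda>i. (els (left i), right i)) ` set vs = image_base nat_tree (set xs)"
    using xs(2) by induction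
      (auto simp: image_base_def encodes_pair_def encodes_nat_set encodes_nat_def)
  then show "base_of v = image_base nat_tree \<Sigma>" by (simp add: base_of_def v xs)
qed

lemma closure_system_image:
  assumes "inj f"
  shows "closure_system (f ` U) (image_base f \<Sigma>) = image f ` closure_system U \<Sigma>"
proof -
  have "satisfies (f ` C) (image_base f \<Sigma>) \<longleftrightarrow> satisfies C \<Sigma>" for C
    unfolding satisfies_def image_base_def
    by (auto simp: inj_image_subset_iff[OF assms] inj_image_mem_iff[OF assms] split: prod.splits)
  then show ?thesis
    unfolding closure_system_def
    by (auto simp: subset_image_iff inj_image_subset_iff[OF assms] image_iff)
qed

lemma meet_irreducibles_image:
  assumes "inj f"
  shows "meet_irreducibles (f ` U) (image_base f \<Sigma>) = image f ` meet_irreducibles U \<Sigma>"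
proof -
  have inj: "inj (image f)" using inj_image_eq_iff[OF assms] by (intro injI) simp
  have "image f M \<in> meet_irreducibles (f ` U) (image_base f \<Sigma>) \<longleftrightarrow> M \<in> meet_irreducibles U \<Sigma>" for M
    unfolding meet_irreducibles_def closure_system_image[OF assms]
    by (simp add: inj_image_mem_iff[OF inj] image_Int[OF assms, symmetric] inj_image_eq_iff[OF assms])
  moreover have "meet_irreducibles (f ` U) (image_base f \<Sigma>) \<subseteq> range (image f)"
    unfolding meet_irreducibles_def closure_system_image[OF assms] by auto
  ultimately show ?thesis by blast
qed

lemma ranked_image:
  assumes "inj f" "ranked \<Sigma>"
  shows "ranked (image_base f \<Sigma>)"
proof -
  obtain r :: "'a \<Rightarrow> nat" where "\<forall>(A, b)\<in>\<Sigma>. \<forall>x\<in>A. (\<forall>y\<in>A. r x = r y) \<and> r x < r b"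
    using assms(2) unfolding ranked_def by blast
  then show ?thesis
    unfolding ranked_def image_base_def
    by (intro exI[of _ "\<lambda>y. r (inv f y)"]) (fastforce simp: inv_f_f[OF assms(1)])
qed

text \<open>Distinctness is required of the sets and not just of the lists encoding them, since
  permuted lists denote the same member.\<close>

lemma encodes_familyI:
  assumes "els ` els w = image nat_tree ` F" "distinct (map els (tree_list w))"
    and "\<And>T. T \<in> els w \<Longrightarrow> distinct (tree_list T)"
  shows "encodes_family F w"
proof -
  define xs where "xs = map (\<lambda>t. nat_tree -` els t) (tree_list w)"
  have inv: "nat_tree ` (nat_tree -` els t) = els t" if "t \<in> els w" for t
  proof -
    have "els t \<in> image nat_tree ` F" using assms(1) that by blast
    then show ?thesis by auto
  qed
  have "map (image nat_tree) xs = map els (tree_list w)"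
    unfolding xs_def using inv by simp
  then have "distinct (map (image nat_tree) xs)" using assms(2) by simp
  then have "distinct xs" by (simp add: distinct_map)
  moreover have "set xs = F"
  proof -
    have "set xs = vimage nat_tree ` els ` els w" by (auto simp: xs_def)
    also have "\<dots> = F" unfolding assms(1) image_image
      by (simp add: inj_vimage_image_eq[OF inj_nat_tree])
    finally show ?thesis .
  qed
  moreover have "list_all2 (encodes_set encodes_nat) xs (tree_list w)"
    unfolding xs_def list_all2_map1
    by (rule list_all2_same[THEN iffD2]) (use inv assms(3) in \<open>auto simp: encodes_nat_set\<close>)
  ultimately show ?thesis
    unfolding encodes_family_def encodes_set_def[of "encodes_set encodes_nat"] by (metis tree_list_inverse)
qed

lemma encodes_base_valid:
  assumes "encodes_base (U, \<Sigma>) v" "finite U" "implicational_base U \<Sigma>" "has_layering U \<Sigma>"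
  shows "valid v"
proof -
  note e = encodes_baseD[OF assms(1)]
  have "implicational_base (nat_tree ` U) (image_base nat_tree \<Sigma>)"
    using assms(3) unfolding implicational_base_def image_base_def by fastforce
  then have "layered (nat_tree ` U) (image_base nat_tree \<Sigma>) (height (image_base nat_tree \<Sigma>))"
    using assms(2) ranked_image[OF inj_nat_tree has_layering_ranked[OF assms(4)]]
    by (intro layered_height) auto
  then show ?thesis using e by (simp add: valid_def)
qed

section \<open>The exponent in terms of the natural logarithm\<close>

lemma floor_log_bigo: "(\<lambda>N. real (Suc (floor_log N) * c)) \<in> O(\<lambda>N. ln (real N))"
\<comment> \<open>For \<open>N \<ge> 2\<close> the binary logarithm is at least 1, so
  \<open>Suc (floor_log N)\<close> is at most twice the binary logarithm; this explains
  \<open>2 / ln 2\<close>.\<close>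
proof (rule bigoI[where c = "2 * real c / ln 2"])
  have "norm (real (Suc (floor_log N) * c)) \<le> 2 * real c / ln 2 * norm (ln (real N))" if "2 \<le> N" for N
  proof -
    have "real (2 ^ floor_log N) \<le> real N"
      using floor_log_exp2_le[of N] that by (simp only: of_nat_le_iff)
    then have "ln (2 ^ floor_log N) \<le> ln (real N)" using that by (subst ln_le_cancel_iff) auto
    then have "real (floor_log N) * ln 2 \<le> ln (real N)" by (simp add: ln_realpow)
    moreover have "ln 2 \<le> ln (real N)" using that by simp
    ultimately have "real (Suc (floor_log N)) * ln 2 \<le> 2 * ln (real N)" by (simp add: algebra_simps)
    then have "real (Suc (floor_log N)) \<le> 2 * ln (real N) / ln 2" by (simp add: pos_le_divide_eq)
    then have "real (Suc (floor_log N)) * real c \<le> 2 * ln (real N) / ln 2 * real c"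
      by (rule mult_right_mono) simp
    moreover have "norm (real (Suc (floor_log N) * c)) = real (Suc (floor_log N)) * real c"
      by (simp only: of_nat_mult real_norm_def) simp
    moreover have "2 * real c / ln 2 * norm (ln (real N)) = 2 * ln (real N) / ln 2 * real c"
      using that by simp
    ultimately show ?thesis by (simp only:)
  qed
  then show "\<forall>\<^sub>F N in at_top. norm (real (Suc (floor_log N) * c)) \<le> 2 * real c / ln 2 * norm (ln (real N))"
    using eventually_ge_at_top[of 2] by (rule eventually_mono[rotated])
qed

theorem theorem6:
  "output_quasipolynomial_time encodes_base encodes_family
     {(U :: nat set, \<Sigma> :: nat implication set).
        finite U \<and> implicational_base U \<Sigma> \<and> has_layering U \<Sigma>}
     (\<lambda>(U, \<Sigma>). meet_irreducibles U \<Sigma>)"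
proof -
  let ?m = "\<lambda>v. qpoly (instance_size v)"
  obtain k where k: "\<And>n. \<exists>Q e. \<forall>P. length P = n \<longrightarrow> computes (P @ Q) e valid ?m k enumerate_mi"
    using feasible_enumerate_mi unfolding feasible_def by blast
  \<comment> \<open>One position is reserved in front of the fragment, to be filled with the main
    body \<open>e\<close> itself.\<close>
  obtain Q e where Q: "\<forall>P. length P = 1 \<longrightarrow> computes (P @ Q) e valid ?m k enumerate_mi"
    using k[of 1] by blast
  define P where "P = e # Q"
  have P: "computes P e valid ?m k enumerate_mi" using Q[rule_format, of "[e]"] by (simp add: P_def)
  \<comment> \<open>The exponent obtained by unfolding \<open>qpoly N ^ (k + 2)\<close>; the extra 2
    pays for the call of the main function.\<close>
  define f where "f N = real (Suc (floor_log N) * (k + 2))" for N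
  have "\<exists>w t. runs_to P v w t \<and> encodes_family (meet_irreducibles U \<Sigma>) w \<and>
      real t \<le> real (nodes v + nodes w) powr f (nodes v + nodes w)"
    if x: "finite U" "implicational_base U \<Sigma>" "has_layering U \<Sigma>" and v: "encodes_base (U, \<Sigma>) v"
    for U \<Sigma> v
  proof -
    let ?w = "enumerate_mi v"
    let ?N = "nodes v + nodes ?w"
    have val: "valid v" by (rule encodes_base_valid[OF v x])
    note spec = enumerate_mi_spec[OF val]
    have mi: "meet_irreducibles (els (left v)) (base_of v) = image nat_tree ` meet_irreducibles U \<Sigma>"
      unfolding encodes_baseD[OF v] by (rule meet_irreducibles_image[OF inj_nat_tree])
    have fam: "encodes_family (meet_irreducibles U \<Sigma>) ?w"
      by (rule encodes_familyI[OF spec(1)[unfolded mi] spec(2,3)])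
    obtain t where t: "t \<le> ?m v ^ k" "eval P [v] e ?w t" using computesD[OF P val] by blast
    have run: "runs_to P v ?w (1 + t + 1)"
      unfolding runs_to_def by (rule eval_Call1[OF _ eval_Param0]) (use t in \<open>simp_all add: P_def\<close>)
    \<comment> \<open>The running time is bounded through the number of outputs, which is strictly
      below the number of nodes of the output tree; strictness makes up for the 1 in
      \<open>instance_size\<close>.\<close>
    have "card (meet_irreducibles (els (left v)) (base_of v)) = length (tree_list ?w)"
      using distinct_card[OF spec(2)] spec(1) by simp
    then have "instance_size v \<le> ?N"
      using length_tree_list[of ?w] by (simp add: instance_size_def)
    moreover have N2: "2 \<le> instance_size v" using nodes_pos[of v] by (simp add: instance_size_def)
    ultimately have mN: "?m v \<le> qpoly ?N" by (intro qpoly_mono) auto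
    have m2: "2 \<le> ?m v" using qpoly_ge[of "instance_size v"] N2 by linarith
    have "1 + t + 1 \<le> ?m v ^ (k + 2)"
    proof -
      have "1 \<le> ?m v ^ k" using m2 by simp
      then show ?thesis using power_sum_le[OF m2 t(1), of 1] by simp
    qed
    also have "\<dots> \<le> qpoly ?N ^ (k + 2)" using mN by (rule power_mono) simp
    also have "\<dots> = ?N ^ (Suc (floor_log ?N) * (k + 2))" unfolding qpoly_def power_mult ..
    finally have "real (1 + t + 1) \<le> real (?N ^ (Suc (floor_log ?N) * (k + 2)))"
      by (simp only: of_nat_le_iff)
    also have "\<dots> = real ?N powr f ?N"
    proof -
      have "0 < real ?N" using nodes_pos[of v] by simp
      then show ?thesis unfolding f_def by (simp only: powr_realpow of_nat_power)
    qed
    finally show ?thesis using run fam by blast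
  qed
  moreover have "f \<in> O(\<lambda>N. ln (real N))" unfolding f_def by (rule floor_log_bigo)
  ultimately show ?thesis
    unfolding output_quasipolynomial_time_def Let_def by (intro exI[of _ P] exI[of _ f]) auto
qed

end
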